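(* Let $n\geq 2$, $m\geq 1$ be integers, let $F_n$ and $F_m$ be free groups of ranks $n$ and $m$, and let $w_1\in F_n$, $w_2\in F_m$ be nontrivial elements. Let $G=F_n*_{w_1=w_2}F_m$ be the amalgamated free product of $F_n$ and $F_m$ identifying the infinite cyclic subgroups $\langle w_1\rangle\subseteq F_n$ and $\langle w_2\rangle\subseteq F_m$ via $w_1\mapsto w_2$. Then the space $\mathcal{LO}(G)$ of left orders of $G$ has no isolated points.
   Context: A left order on a group $G$ is a total order $\preceq$ on $G$ such that $f\preceq h$ implies $gf\preceq gh$ for all $f,g,h\in G$. $\mathcal{LO}(G)$ is the set of all left orders on $G$, with the topology in which a local base at $\preceq$ is given by the sets $V_{g_1,\dots,g_k}=\{\preceq'\in\mathcal{LO}(G)\mid \mathrm{id}\prec' g_i \text{ for } i=1,\dots,k\}$, where $\{g_1,\dots,g_k\}$ runs over finite subsets of $\preceq$-positive elements of $G$ (elements $g$ with $\mathrm{id}\prec g$). *)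

theory Defs
  imports "HOL-Algebra.Generated_Groups" "HOL-Analysis.Analysis"
begin

section \<open>Monoids presented by generators and relations\<close>

text \<open>The congruence on the free monoid of words over \<open>S\<close> generated by the pairs in \<open>R\<close>.\<close>

inductive word_cong :: "'a set \<Rightarrow> ('a list \<times> 'a list) set \<Rightarrow> 'a list \<Rightarrow> 'a list \<Rightarrow> bool"
  for S :: "'a set" and R :: "('a list \<times> 'a list) set" where
  refl: "u \<in> lists S \<Longrightarrow> word_cong S R u u"
| sym: "word_cong S R u v \<Longrightarrow> word_cong S R v u"
| trans: "word_cong S R u v \<Longrightarrow> word_cong S R v w \<Longrightarrow> word_cong S R u w"
| rel: "(u, v) \<in> R \<Longrightarrow> p @ u @ q \<in> lists S \<Longrightarrow> p @ v @ q \<in> lists S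
        \<Longrightarrow> word_cong S R (p @ u @ q) (p @ v @ q)"

definition word_class :: "'a set \<Rightarrow> ('a list \<times> 'a list) set \<Rightarrow> 'a list \<Rightarrow> 'a list set" where
  "word_class S R u = {v. word_cong S R u v}"

definition presented_monoid :: "'a set \<Rightarrow> ('a list \<times> 'a list) set \<Rightarrow> 'a list set monoid" where
  "presented_monoid S R =
     \<lparr>carrier = word_class S R ` lists S,
      monoid.mult = (\<lambda>X Y. \<Union>x\<in>X. \<Union>y\<in>Y. word_class S R (x @ y)),
      monoid.one = word_class S R []\<rparr>"

lemma word_cong_lists:
  "word_cong S R u v \<Longrightarrow> u \<in> lists S \<and> v \<in> lists S"
  by (induction rule: word_cong.induct) auto

lemma word_cong_context:
  assumes "word_cong S R u v" "p \<in> lists S" "q \<in> lists S"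
  shows "word_cong S R (p @ u @ q) (p @ v @ q)"
  using assms(1)
proof (induction rule: word_cong.induct)
  case (refl u)
  then show ?case using assms(2,3) by (intro word_cong.refl) simp
next
  case (rel u v p' q')
  then show ?case
    using word_cong.rel[of u v R "p @ p'" "q' @ q" S] assms(2,3) by simp
next
  case (sym u v)
  then show ?case by (blast intro: word_cong.sym)
next
  case (trans u v w)
  then show ?case by (blast intro: word_cong.trans)
qed

lemma word_cong_append:
  assumes "word_cong S R u u'" "word_cong S R v v'"
  shows "word_cong S R (u @ v) (u' @ v')"
proof -
  have l: "u' \<in> lists S" "v \<in> lists S" "[] \<in> lists S"
    using assms[THEN word_cong_lists] by simp_all
  have "word_cong S R (u @ v) (u' @ v)"
    using word_cong_context[OF assms(1) l(3) l(2)] by simp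
  moreover have "word_cong S R (u' @ v) (u' @ v')"
    using word_cong_context[OF assms(2) l(1) l(3)] by simp
  ultimately show ?thesis by (rule word_cong.trans)
qed

lemma word_class_eq_iff:
  assumes "u \<in> lists S"
  shows "word_class S R u = word_class S R v \<longleftrightarrow> word_cong S R u v"
proof
  assume "word_class S R u = word_class S R v"
  then have "word_cong S R v u"
    using word_cong.refl[OF assms] unfolding word_class_def by blast
  then show "word_cong S R u v" by (rule word_cong.sym)
next
  assume "word_cong S R u v"
  then show "word_class S R u = word_class S R v"
    unfolding word_class_def by (blast intro: word_cong.sym word_cong.trans)
qed

lemma presented_monoid_mult:
  assumes "u \<in> lists S" "v \<in> lists S"
  shows "word_class S R u \<otimes>\<^bsub>presented_monoid S R\<^esub> word_class S R v = word_class S R (u @ v)"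
proof -
  have "word_class S R (x @ y) = word_class S R (u @ v)"
    if "x \<in> word_class S R u" "y \<in> word_class S R v" for x y
  proof -
    have "word_cong S R (u @ v) (x @ y)"
      using that by (simp add: word_class_def word_cong_append)
    then show ?thesis
      using word_class_eq_iff[of "u @ v" S R "x @ y"] assms by simp
  qed
  moreover have "u \<in> word_class S R u" "v \<in> word_class S R v"
    using assms by (auto simp: word_class_def intro: word_cong.refl)
  ultimately have "(\<Union>x\<in>word_class S R u. \<Union>y\<in>word_class S R v. word_class S R (x @ y)) =
      word_class S R (u @ v)"
    by blast
  then show ?thesis by (simp add: presented_monoid_def)
qed

lemma group_presented_monoid:
  assumes "\<And>s. s \<in> S \<Longrightarrow> \<exists>t\<in>S. word_cong S R [t, s] []"
  shows "group (presented_monoid S R)"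
proof (rule groupI)
  let ?G = "presented_monoid S R"
  have car: "carrier ?G = word_class S R ` lists S" and one: "\<one>\<^bsub>?G\<^esub> = word_class S R []"
    by (auto simp: presented_monoid_def)
  show "\<one>\<^bsub>?G\<^esub> \<in> carrier ?G" by (simp add: car one)
  have ex: "\<exists>u\<in>lists S. x = word_class S R u" if "x \<in> carrier ?G" for x
    using that unfolding car by blast
  have app: "u @ v \<in> lists S" if "u \<in> lists S" "v \<in> lists S" for u v
    using that by simp
  note mult = presented_monoid_mult
  show "x \<otimes>\<^bsub>?G\<^esub> y \<in> carrier ?G" if x: "x \<in> carrier ?G" and y: "y \<in> carrier ?G" for x y
  proof -
    obtain u where u: "u \<in> lists S" "x = word_class S R u" using ex[OF x] by blast
    obtain v where v: "v \<in> lists S" "y = word_class S R v" using ex[OF y] by blast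
    show ?thesis
      unfolding u(2) v(2) mult[OF u(1) v(1)] car by (intro imageI app u v)
  qed
  show "x \<otimes>\<^bsub>?G\<^esub> y \<otimes>\<^bsub>?G\<^esub> z = x \<otimes>\<^bsub>?G\<^esub> (y \<otimes>\<^bsub>?G\<^esub> z)"
    if x: "x \<in> carrier ?G" and y: "y \<in> carrier ?G" and z: "z \<in> carrier ?G" for x y z
  proof -
    obtain u where u: "u \<in> lists S" "x = word_class S R u" using ex[OF x] by blast
    obtain v where v: "v \<in> lists S" "y = word_class S R v" using ex[OF y] by blast
    obtain w where w: "w \<in> lists S" "z = word_class S R w" using ex[OF z] by blast
    show ?thesis
      unfolding u(2) v(2) w(2) mult[OF u(1) v(1)] mult[OF v(1) w(1)]
        mult[OF app[OF u(1) v(1)] w(1)] mult[OF u(1) app[OF v(1) w(1)]] append_assoc ..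
  qed
  show "\<one>\<^bsub>?G\<^esub> \<otimes>\<^bsub>?G\<^esub> x = x" if x: "x \<in> carrier ?G" for x
  proof -
    obtain u where u: "u \<in> lists S" "x = word_class S R u" using ex[OF x] by blast
    show ?thesis unfolding u(2) one mult[OF lists.Nil u(1)] append_Nil ..
  qed
  have inv: "\<exists>v\<in>lists S. word_cong S R (v @ u) []" if "u \<in> lists S" for u
    using that
  proof (induction u)
    case Nil
    have "word_cong S R ([] @ []) []" by (simp add: word_cong.refl)
    then show ?case by (rule bexI) simp
  next
    case (Cons s u)
    then obtain v t where v: "v \<in> lists S" "word_cong S R (v @ u) []"
      and t: "t \<in> S" "word_cong S R [t, s] []"
      using assms[of s] by auto
    have "word_cong S R (v @ [t, s] @ u) (v @ [] @ u)"
      by (rule word_cong_context) (use Cons v t in auto)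
    then have "word_cong S R (v @ [t, s] @ u) []"
      using word_cong.trans v(2) by fastforce
    then have "word_cong S R ((v @ [t]) @ s # u) []" by simp
    with v t show ?case by (intro bexI[of _ "v @ [t]"]) auto
  qed
  show "\<exists>y\<in>carrier ?G. y \<otimes>\<^bsub>?G\<^esub> x = \<one>\<^bsub>?G\<^esub>" if x: "x \<in> carrier ?G" for x
  proof -
    obtain u where u: "u \<in> lists S" "x = word_class S R u" using ex[OF x] by blast
    obtain v where v: "v \<in> lists S" "word_cong S R (v @ u) []" using inv[OF u(1)] by blast
    have "word_class S R v \<otimes>\<^bsub>?G\<^esub> x = \<one>\<^bsub>?G\<^esub>"
      unfolding u(2) one mult[OF v(1) u(1)] word_class_eq_iff[OF app[OF v(1) u(1)]] by (rule v(2))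
    moreover have "word_class S R v \<in> carrier ?G" unfolding car by (intro imageI v)
    ultimately show ?thesis by (rule bexI)
  qed
qed


section \<open>Free groups\<close>

text \<open>The letter \<open>(True, x)\<close> stands for the generator \<open>x\<close> and \<open>(False, x)\<close> for its
  inverse.\<close>

definition free_group :: "'a set \<Rightarrow> (bool \<times> 'a) list set monoid" where
  "free_group X =
     presented_monoid (UNIV \<times> X) {([(b, x), (\<not> b, x)], []) | b x. x \<in> X}"

definition free_group_of_rank :: "'a monoid \<Rightarrow> nat \<Rightarrow> bool" where
  "free_group_of_rank F n \<longleftrightarrow> group F \<and> F \<cong> free_group {..<n}"

lemma group_free_group: "group (free_group X)"
  unfolding free_group_def
proof (rule group_presented_monoid)
  fix s :: "bool \<times> 'a"
  assume s: "s \<in> UNIV \<times> X"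
  let ?R = "{([(b, x), (\<not> b, x)], []) | b x. x \<in> X} :: ((bool \<times> 'a) list \<times> _) set"
  have "([(\<not> fst s, snd s), s], []) \<in> ?R" using s by (cases s) auto
  then have "word_cong (UNIV \<times> X) ?R ([] @ [(\<not> fst s, snd s), s] @ []) ([] @ [] @ [])"
    by (rule word_cong.rel) (use s in auto)
  then show "\<exists>t\<in>UNIV \<times> X. word_cong (UNIV \<times> X) ?R [t, s] []"
    using s by (intro bexI[of _ "(\<not> fst s, snd s)"]) auto
qed


section \<open>Amalgamated free products\<close>

text \<open>
  The free product of \<open>A\<close> and \<open>B\<close> in which each element \<open>h\<close> of the subgroup \<open>H\<close> of \<open>A\<close> is
  identified with the element \<open>\<phi> h\<close> of \<open>B\<close>. Words are lists of elements of
  the two groups, taken up to multiplication inside a factor, deletion of identities and the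
  identification of \<open>h\<close> with \<open>\<phi> h\<close>.
\<close>

definition amalgam_rels ::
  "'a monoid \<Rightarrow> 'a set \<Rightarrow> ('a \<Rightarrow> 'b) \<Rightarrow> 'b monoid \<Rightarrow> (('a + 'b) list \<times> ('a + 'b) list) set" where
  "amalgam_rels A H \<phi> B =
     {([Inl x, Inl y], [Inl (x \<otimes>\<^bsub>A\<^esub> y)]) | x y. x \<in> carrier A \<and> y \<in> carrier A} \<union>
     {([Inr x, Inr y], [Inr (x \<otimes>\<^bsub>B\<^esub> y)]) | x y. x \<in> carrier B \<and> y \<in> carrier B} \<union>
     {([Inl \<one>\<^bsub>A\<^esub>], []), ([Inr \<one>\<^bsub>B\<^esub>], [])} \<union>
     {([Inl h], [Inr (\<phi> h)]) | h. h \<in> H}"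

definition amalgamated_product ::
  "'a monoid \<Rightarrow> 'a set \<Rightarrow> ('a \<Rightarrow> 'b) \<Rightarrow> 'b monoid \<Rightarrow> ('a + 'b) list set monoid" where
  "amalgamated_product A H \<phi> B =
     presented_monoid (carrier A <+> carrier B) (amalgam_rels A H \<phi> B)"

text \<open>
  The map between cyclic subgroups taking \<open>a\<^sup>k\<close> to \<open>b\<^sup>k\<close>. When \<open>a\<close> has infinite order the
  exponent \<open>k\<close> is determined by \<open>a\<^sup>k\<close>, so the choice plays no role.
\<close>

definition cyclic_map :: "'a monoid \<Rightarrow> 'a \<Rightarrow> 'b monoid \<Rightarrow> 'b \<Rightarrow> 'a \<Rightarrow> 'b" where
  "cyclic_map A a B b x = b [^]\<^bsub>B\<^esub> (SOME k::int. x = a [^]\<^bsub>A\<^esub> k)"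

definition cyclic_amalgam :: "'a monoid \<Rightarrow> 'a \<Rightarrow> 'b monoid \<Rightarrow> 'b \<Rightarrow> ('a + 'b) list set monoid" where
  "cyclic_amalgam A a B b = amalgamated_product A (generate A {a}) (cyclic_map A a B b) B"

lemma group_amalgamated_product:
  fixes A :: "'a monoid" and B :: "'b monoid"
  assumes "group A" "group B"
  shows "group (amalgamated_product A H \<phi> B)"
  unfolding amalgamated_product_def
proof (rule group_presented_monoid)
  interpret A: group A by fact
  interpret B: group B by fact
  fix s :: "'a + 'b"
  assume s: "s \<in> carrier A <+> carrier B"
  let ?cong = "word_cong (carrier A <+> carrier B) (amalgam_rels A H \<phi> B)"
  have *: "?cong u v"
    if "(u, v) \<in> amalgam_rels A H \<phi> B" "u \<in> lists (carrier A <+> carrier B)"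
       "v \<in> lists (carrier A <+> carrier B)" for u v
    using word_cong.rel[of u v _ "[]" "[]"] that by simp
  show "\<exists>t\<in>carrier A <+> carrier B. ?cong [t, s] []"
  proof (cases s)
    case (Inl x)
    with s have x: "x \<in> carrier A" by auto
    have "?cong [Inl (inv\<^bsub>A\<^esub> x), Inl x] [Inl (inv\<^bsub>A\<^esub> x \<otimes>\<^bsub>A\<^esub> x)]"
      by (rule *) (use x in \<open>auto simp: amalgam_rels_def simp del: A.l_inv\<close>)
    moreover have "?cong [Inl \<one>\<^bsub>A\<^esub>] []"
      by (rule *) (auto simp: amalgam_rels_def)
    ultimately have "?cong [Inl (inv\<^bsub>A\<^esub> x), Inl x] []"
      using x word_cong.trans by fastforce
    with x Inl show ?thesis by (intro bexI[of _ "Inl (inv\<^bsub>A\<^esub> x)"]) auto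
  next
    case (Inr x)
    with s have x: "x \<in> carrier B" by auto
    have "?cong [Inr (inv\<^bsub>B\<^esub> x), Inr x] [Inr (inv\<^bsub>B\<^esub> x \<otimes>\<^bsub>B\<^esub> x)]"
      by (rule *) (use x in \<open>auto simp: amalgam_rels_def simp del: B.l_inv\<close>)
    moreover have "?cong [Inr \<one>\<^bsub>B\<^esub>] []"
      by (rule *) (auto simp: amalgam_rels_def)
    ultimately have "?cong [Inr (inv\<^bsub>B\<^esub> x), Inr x] []"
      using x word_cong.trans by fastforce
    with x Inr show ?thesis by (intro bexI[of _ "Inr (inv\<^bsub>B\<^esub> x)"]) auto
  qed
qed


section \<open>The space of left orders\<close>

definition left_orders :: "'a monoid \<Rightarrow> 'a rel set" where
  "left_orders G =
     {r. linear_order_on (carrier G) r \<and>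
         (\<forall>f\<in>carrier G. \<forall>g\<in>carrier G. \<forall>h\<in>carrier G.
            (f, h) \<in> r \<longrightarrow> (g \<otimes>\<^bsub>G\<^esub> f, g \<otimes>\<^bsub>G\<^esub> h) \<in> r)}"

definition positive_elements :: "'a monoid \<Rightarrow> 'a rel \<Rightarrow> 'a set" where
  "positive_elements G r = {g \<in> carrier G. (\<one>\<^bsub>G\<^esub>, g) \<in> r \<and> g \<noteq> \<one>\<^bsub>G\<^esub>}"

definition basic_nbhd :: "'a monoid \<Rightarrow> 'a set \<Rightarrow> 'a rel set" where
  "basic_nbhd G P = {r \<in> left_orders G. P \<subseteq> positive_elements G r}"

definition left_order_space :: "'a monoid \<Rightarrow> 'a rel topology" where
  "left_order_space G =
     topology (\<lambda>U. U \<subseteq> left_orders G \<and>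
       (\<forall>r\<in>U. \<exists>P. finite P \<and> P \<subseteq> positive_elements G r \<and> basic_nbhd G P \<subseteq> U))"

lemma openin_left_order_space:
  "openin (left_order_space G) U \<longleftrightarrow> U \<subseteq> left_orders G \<and>
     (\<forall>r\<in>U. \<exists>P. finite P \<and> P \<subseteq> positive_elements G r \<and> basic_nbhd G P \<subseteq> U)"
proof -
  let ?op = "\<lambda>U. U \<subseteq> left_orders G \<and>
     (\<forall>r\<in>U. \<exists>P. finite P \<and> P \<subseteq> positive_elements G r \<and> basic_nbhd G P \<subseteq> U)"
  have "istopology ?op"
    unfolding istopology_def
  proof (intro conjI allI impI)
    fix U V
    assume U: "?op U" and V: "?op V"
    show "U \<inter> V \<subseteq> left_orders G" using U by blast
    show "\<forall>r\<in>U \<inter> V. \<exists>P. finite P \<and> P \<subseteq> positive_elements G r \<and> basic_nbhd G P \<subseteq> U \<inter> V"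
    proof
      fix r assume r: "r \<in> U \<inter> V"
      obtain P where P: "finite P" "P \<subseteq> positive_elements G r" "basic_nbhd G P \<subseteq> U"
        using r U by blast
      obtain Q where Q: "finite Q" "Q \<subseteq> positive_elements G r" "basic_nbhd G Q \<subseteq> V"
        using r V by blast
      have "basic_nbhd G (P \<union> Q) \<subseteq> U \<inter> V"
        using P(3) Q(3) by (auto simp: basic_nbhd_def)
      with P Q show "\<exists>P. finite P \<and> P \<subseteq> positive_elements G r \<and> basic_nbhd G P \<subseteq> U \<inter> V"
        by (intro exI[of _ "P \<union> Q"]) auto
    qed
  next
    fix \<U> assume \<U>: "\<forall>U\<in>\<U>. ?op U"
    show "\<Union>\<U> \<subseteq> left_orders G" using \<U> by blast
    show "\<forall>r\<in>\<Union>\<U>. \<exists>P. finite P \<and> P \<subseteq> positive_elements G r \<and> basic_nbhd G P \<subseteq> \<Union>\<U>"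
    proof
      fix r assume "r \<in> \<Union>\<U>"
      then obtain U where U: "U \<in> \<U>" "r \<in> U" by blast
      then obtain P where P: "finite P" "P \<subseteq> positive_elements G r" "basic_nbhd G P \<subseteq> U"
        using \<U> by meson
      have "basic_nbhd G P \<subseteq> \<Union>\<U>" using P(3) U(1) by (rule subset_trans[OF _ Union_upper])
      with P show "\<exists>P. finite P \<and> P \<subseteq> positive_elements G r \<and> basic_nbhd G P \<subseteq> \<Union>\<U>"
        by (intro exI[of _ P] conjI)
    qed
  qed
  then show ?thesis
    unfolding left_order_space_def by (simp add: topology_inverse')
qed

lemma openin_basic_nbhd:
  assumes "finite P"
  shows "openin (left_order_space G) (basic_nbhd G P)"
  unfolding openin_left_order_space using assms by (auto simp: basic_nbhd_def)

lemma topspace_left_order_space: "topspace (left_order_space G) = left_orders G"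
proof
  show "topspace (left_order_space G) \<subseteq> left_orders G"
    using openin_topspace openin_left_order_space by blast
  have "basic_nbhd G {} = left_orders G" by (simp add: basic_nbhd_def)
  then show "left_orders G \<subseteq> topspace (left_order_space G)"
    using openin_basic_nbhd[of "{}" G] openin_subset by fastforce
qed

definition isolated_point :: "'a topology \<Rightarrow> 'a \<Rightarrow> bool" where
  "isolated_point X x \<longleftrightarrow> x \<in> topspace X \<and> openin X {x}"

end

theory Submission
  imports Defs "HOL-Library.Poly_Mapping"
begin

text \<open>
  Write \<open>G\<close> for the amalgam and \<open>w\<close> for the common image of the two given elements. An isolated
  order would be the only one making some finite set \<open>P\<close> positive. It is therefore enough to
  find an action of \<open>G\<close> by increasing maps on a linearly ordered set and a point \<open>v\<close> such that
  every \<open>p\<close> in \<open>P\<close> moves \<open>v\<close> up while some nontrivial \<open>g\<close> fixes \<open>v\<close>: comparing elements by where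
  they send \<open>v\<close>, and breaking ties on the stabiliser of \<open>v\<close> either with the given order or with
  its reverse, yields two different orders that both make \<open>P\<close> positive (\<open>two_orders\<close>).

  The factors are free, so arbitrary increasing maps may be chosen for their generators. The
  whole difficulty is that the two resulting maps for \<open>w\<close> must coincide. On the line they do
  not, but they can be made isomorphic. Call an increasing bijection mixing if its domain is
  countable, dense and without ends and if between any two points whose orbits do not interleave
  there are points that it moves up, points that it moves down and fixed points; the same is
  required beyond every single orbit, above and below. A back-and-forth argument shows that any
  two mixing maps are isomorphic, and that the isomorphism can be made to extend any finite
  matching of points under which the orbits interleave in the same way (\<open>mixing_isomorphic\<close>).
  Moreover, an increasing bijection of the line that fixes \<open>0\<close> and the ends of an interval
  \<open>[- T, T]\<close>, in which it moves some point up and some point down, becomes mixing when it acts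
  coordinatewise on finitely supported sequences, ordered lexicographically, with entries in a
  suitable countable set (\<open>mixing_from_line\<close>). Hence the action of the second factor can be
  carried over to the space of the first one so that the two maps for \<open>w\<close> agree, with finitely
  many points kept in place; the two actions then combine to an action of \<open>G\<close> (\<open>realization\<close>,
  \<open>amalgam_action\<close>).

  The finite matching comes from the given order. Let \<open>K\<close> be a finite set of elements containing
  \<open>1\<close> and \<open>P\<close> whose members can be reached from \<open>1\<close> inside \<open>K\<close> by multiplying with generators.
  The left order embeds in its set of cuts, on which \<open>G\<close> acts by translation. Finitely many
  cuts, among them \<open>w\<close>-fixed ones separating orbits that do not interleave, force the \<open>w\<close>-orbits
  of the points of \<open>K\<close> to interleave as they do in the given order, whichever extensions to the
  line are chosen (\<open>ex_pins\<close>, \<open>orbit_data\<close>). The extensions for the two factors therefore induce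
  the same interleaving.

  The stabiliser is made nontrivial by using the rank of the first factor. The largest of the
  finitely many cuts is the cut \<open>M\<close> of an element \<open>s x\<close>, where \<open>s\<close> is a word in the generators
  of the first factor and \<open>x\<close> belongs to \<open>K\<close>. Each of the first two generators moves \<open>M\<close>
  upwards, possibly after inversion, and nothing has been prescribed for it there; both may thus
  send \<open>M\<close> to one and the same new point. This produces two different elements of \<open>G\<close> with the
  same effect on the base point (\<open>perturbation\<close>).
\<close>

section \<open>Automorphisms of linear orders\<close>

abbreviation finv :: "('a \<Rightarrow> 'b) \<Rightarrow> 'b \<Rightarrow> 'a" where "finv f \<equiv> inv_into UNIV f"

definition order_aut :: "('a::linorder \<Rightarrow> 'a) \<Rightarrow> bool" where
  "order_aut f \<longleftrightarrow> strict_mono f \<and> bij f"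

lemma order_aut_less_iff: "order_aut f \<Longrightarrow> f x < f y \<longleftrightarrow> x < y"
  unfolding order_aut_def by (simp add: strict_mono_less)

lemma order_aut_inv:
  assumes "order_aut f" shows "order_aut (finv f)"
proof -
  have b: "bij f" and m: "strict_mono f" using assms by (auto simp: order_aut_def)
  have "finv f x < finv f y" if "x < y" for x y
    using that m b by (metis bij_inv_eq_iff strict_mono_less)
  then show ?thesis using b by (auto simp: order_aut_def strict_mono_def bij_imp_bij_inv)
qed

lemma order_aut_id: "order_aut (\<lambda>x. x)" "order_aut id"
  by (auto simp: order_aut_def strict_mono_def bij_def)

lemma order_aut_comp: "order_aut f \<Longrightarrow> order_aut g \<Longrightarrow> order_aut (f \<circ> g)"
  by (auto simp: order_aut_def bij_comp strict_mono_o)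

lemma order_aut_funpow: "order_aut f \<Longrightarrow> order_aut (f ^^ n)"
  by (induction n) (auto simp: order_aut_id order_aut_comp)

definition zpow :: "('a \<Rightarrow> 'a) \<Rightarrow> int \<Rightarrow> 'a \<Rightarrow> 'a" where
  "zpow f k = (if 0 \<le> k then f ^^ nat k else finv f ^^ nat (- k))"

lemma zpow_0 [simp]: "zpow f 0 x = x" and zpow_1: "zpow f 1 x = f x"
  by (simp_all add: zpow_def)

lemma zpow_nat: "zpow f (int n) = f ^^ n"
  by (simp add: zpow_def)

lemma zpow_Suc: "zpow f (int (Suc n)) x = zpow f (int n) (f x)"
  by (simp only: zpow_nat funpow_Suc_right comp_apply)

lemma zpow_plus_1:
  assumes "bij f" shows "zpow f (k + 1) x = f (zpow f k x)"
proof (cases "0 \<le> k")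
  case True
  then show ?thesis by (simp add: zpow_def nat_add_distrib)
next
  case False
  then obtain n where n: "nat (- k) = Suc n" by (cases "nat (- k)") auto
  then have "nat (- (k + 1)) = n" by linarith
  then show ?thesis using False n assms
    by (auto simp: zpow_def bij_is_surj surj_f_inv_f)
qed

lemma zpow_minus_1:
  assumes "bij f" shows "zpow f (k - 1) x = finv f (zpow f k x)"
  using zpow_plus_1[OF assms, of "k - 1" x] assms by (simp add: bij_is_inj)

lemma zpow_add:
  assumes "bij f" shows "zpow f (k + l) x = zpow f k (zpow f l x)"
proof (induction k rule: int_induct[where k = 0])
  case base
  then show ?case by simp
next
  case (step1 i)
  then show ?case using zpow_plus_1[OF assms, of "i + l" x] zpow_plus_1[OF assms, of i]
    by (simp add: algebra_simps)
next
  case (step2 i)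
  then show ?case using zpow_minus_1[OF assms, of "i + l" x] zpow_minus_1[OF assms, of i]
    by (simp add: algebra_simps)
qed

lemma order_aut_zpow: "order_aut f \<Longrightarrow> order_aut (zpow f k)"
  by (simp add: zpow_def order_aut_funpow order_aut_inv)

lemma zpow_less_iff: "order_aut f \<Longrightarrow> zpow f k x < zpow f k y \<longleftrightarrow> x < y"
  by (simp add: order_aut_zpow order_aut_less_iff)

lemma zpow_le_iff: "order_aut f \<Longrightarrow> zpow f k x \<le> zpow f k y \<longleftrightarrow> x \<le> y"
  by (simp add: zpow_less_iff flip: not_less)

lemma zpow_shift:
  assumes "order_aut f"
  shows "zpow f k x < zpow f l y \<longleftrightarrow> zpow f (k - l) x < y"
proof -
  have "zpow f k x = zpow f l (zpow f (k - l) x)"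
    using zpow_add[of f l "k - l" x] assms by (simp add: order_aut_def)
  then show ?thesis using zpow_less_iff[OF assms] by simp
qed

text \<open>
  For fixed \<open>x\<close> the iterates \<open>zpow f k x\<close> are monotone in \<open>k\<close>, so this sign is all there is to
  know about the orbit of a single point; see \<open>drift_determines_orbit\<close>.
\<close>

definition drift :: "('a::linorder \<Rightarrow> 'a) \<Rightarrow> 'a \<Rightarrow> int" where
  "drift f x = (if x < f x then 1 else if f x < x then - 1 else 0)"

lemma drift_cases: "drift f x \<in> {- 1, 0, 1}" by (simp add: drift_def)

lemma zpow_mono_up:
  assumes f: "order_aut f" and x: "x < f x" shows "zpow f k x < x \<longleftrightarrow> k < 0"
proof -
  have up: "x < zpow f (int n) x" if "n > 0" for n
    using that
  proof (induction n)
    case (Suc n)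
    have "zpow f (int n) x < zpow f (int (Suc n)) x"
      unfolding zpow_Suc using x by (simp add: zpow_less_iff f)
    then show ?case using Suc by (cases "n = 0") auto
  qed simp
  show ?thesis
  proof (cases "k < 0")
    case True
    then have "x < zpow f (- k) x" using up[of "nat (- k)"] by simp
    then have "zpow f k x < zpow f k (zpow f (- k) x)" using f by (simp add: zpow_less_iff)
    then show ?thesis using True f zpow_add[of f k "- k" x] by (simp add: order_aut_def)
  next
    case False
    then show ?thesis using up[of "nat k"] by (cases "k = 0") auto
  qed
qed

lemma zpow_finv: "bij f \<Longrightarrow> zpow (finv f) k = zpow f (- k)"
  by (cases k rule: int_cases3) (auto simp: zpow_def inv_inv_eq)

lemma zpow_mono_down:
  assumes f: "order_aut f" and x: "f x < x" shows "zpow f k x < x \<longleftrightarrow> 0 < k"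
proof -
  have bf: "bij f" using f by (simp add: order_aut_def)
  have "x < finv f x"
    using x order_aut_less_iff[OF f, of x "finv f x"] by (simp add: surj_f_inv_f[OF bij_is_surj[OF bf]])
  from zpow_mono_up[OF order_aut_inv[OF f] this, of "- k"] show ?thesis
    by (simp add: zpow_finv[OF bf])
qed

lemma zpow_fixed:
  assumes f: "order_aut f" and x: "f x = x" shows "zpow f k x = x"
proof (induction k rule: int_induct[where k = 0])
  case (step1 i)
  then show ?case using zpow_plus_1[of f i x] f x by (simp add: order_aut_def)
next
  case (step2 i)
  have "finv f x = x" using f x by (metis bij_inv_eq_iff order_aut_def)
  then show ?case using step2 zpow_minus_1[of f i x] f by (simp add: order_aut_def)
qed simp

lemma drift_determines_orbit:
  assumes "order_aut f" "order_aut g" "drift f x = drift g y"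
  shows "zpow f k x < x \<longleftrightarrow> zpow g k y < y"
proof -
  consider "x < f x" "y < g y" | "f x < x" "g y < y" | "f x = x" "g y = y"
    using assms(3) unfolding drift_def
    by (metis (full_types) neg_equal_zero neq_iff zero_neq_neg_one zero_neq_one one_neq_neg_one)
  then show ?thesis
    by cases (simp_all add: assms zpow_mono_up zpow_mono_down zpow_fixed)
qed

text \<open>
  As \<open>f\<close> preserves the order, the whole orbit of \<open>x\<close> then lies below the whole orbit of \<open>y\<close>.
  If neither of two points has its orbit below the other, the orbits interleave and span the
  same convex set, called an orbital below.
\<close>

definition orbit_below :: "('a::linorder \<Rightarrow> 'a) \<Rightarrow> 'a \<Rightarrow> 'a \<Rightarrow> bool" where
  "orbit_below f x y \<longleftrightarrow> (\<forall>k. zpow f k x < y)"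

text \<open>
  These are the richness conditions under which back-and-forth never gets stuck: a point in no
  known orbital lies in a gap between two of them, or beyond all of them, and each such gap
  offers all three directions of motion. The set \<open>Z\<close> is a parameter because it has to be
  countable, which the type of sequences to which the notion is applied is not.
\<close>

definition mixing_on :: "'a::linorder set \<Rightarrow> ('a \<Rightarrow> 'a) \<Rightarrow> bool" where
  "mixing_on Z f \<longleftrightarrow> countable Z \<and> Z \<noteq> {} \<and> order_aut f \<and> f ` Z = Z \<and>
     (\<forall>a\<in>Z. \<forall>b\<in>Z. a < b \<longrightarrow> (\<exists>c\<in>Z. a < c \<and> c < b)) \<and>
     (\<forall>d\<in>{- 1, 0, 1}.
        (\<forall>a\<in>Z. \<exists>c\<in>Z. drift f c = d \<and> orbit_below f a c) \<and>
        (\<forall>b\<in>Z. \<exists>c\<in>Z. drift f c = d \<and> orbit_below f c b) \<and>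
        (\<forall>a\<in>Z. \<forall>b\<in>Z. orbit_below f a b \<longrightarrow>
           (\<exists>c\<in>Z. drift f c = d \<and> orbit_below f a c \<and> orbit_below f c b)))"

lemma zpow_image:
  assumes "bij f" "f ` Z = Z" shows "zpow f k ` Z = Z"
proof -
  have i: "finv f ` Z = Z"
    by (metis assms bij_is_inj image_inv_f_f)
  have "(g ^^ n) ` Z = Z" if "g ` Z = Z" for g :: "'a \<Rightarrow> 'a" and n
    using that by (induction n) (simp_all only: funpow.simps image_comp[symmetric] image_id id_apply)
  then show ?thesis using i assms by (simp add: zpow_def)
qed

subsection \<open>Back and forth\<close>

text \<open>
  A piece of an isomorphism from \<open>f\<close> to \<open>g\<close>. It says that \<open>zpow f k a\<close> may be sent to
  \<open>zpow g k a'\<close> for all pairs and all \<open>k\<close> without violating the order: by \<open>zpow_shift\<close> it is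
  enough to compare iterates of one point with the other point itself.
\<close>

definition orbit_matching ::
  "('a::linorder \<Rightarrow> 'a) \<Rightarrow> ('b::linorder \<Rightarrow> 'b) \<Rightarrow> ('a \<times> 'b) set \<Rightarrow> bool" where
  "orbit_matching f g p \<longleftrightarrow>
     (\<forall>(a, a')\<in>p. \<forall>(b, b')\<in>p. \<forall>k. zpow f k a < b \<longleftrightarrow> zpow g k a' < b')"

lemma orbit_matchingD:
  assumes "orbit_matching f g p" "(a, a') \<in> p" "(b, b') \<in> p"
  shows "zpow f k a < b \<longleftrightarrow> zpow g k a' < b'"
  using assms unfolding orbit_matching_def by fastforce

lemma orbit_matching_converse: "orbit_matching g f (p\<inverse>) \<longleftrightarrow> orbit_matching f g p"
  unfolding orbit_matching_def by fastforce

lemma orbit_matching_zpow: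
  assumes "orbit_matching f g p" "order_aut f" "order_aut g" "(a, a') \<in> p" "(b, b') \<in> p"
  shows "zpow f k a < zpow f l b \<longleftrightarrow> zpow g k a' < zpow g l b'"
  using orbit_matchingD[OF assms(1,4,5)] by (simp add: zpow_shift assms)

lemma orbit_matching_insert:
  assumes p: "orbit_matching f g p" and f: "order_aut f" and g: "order_aut g"
    and "\<And>x x' k. (x, x') \<in> p \<Longrightarrow> zpow f k x < a \<longleftrightarrow> zpow g k x' < b"
    and "\<And>x x' k. (x, x') \<in> p \<Longrightarrow> a < zpow f k x \<longleftrightarrow> b < zpow g k x'"
    and "\<And>k. zpow f k a < a \<longleftrightarrow> zpow g k b < b"
  shows "orbit_matching f g (insert (a, b) p)"
proof -
  have "zpow f k a < x \<longleftrightarrow> zpow g k b < x'" if "(x, x') \<in> p" for k x x'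
    using assms(5)[OF that, of "- k"] zpow_shift[OF f, of 0 a "- k" x] zpow_shift[OF g, of 0 b "- k" x']
    by simp
  then show ?thesis
    using assms(4-6) orbit_matchingD[OF p] unfolding orbit_matching_def by blast
qed

lemma int_crossing:
  fixes P :: "int \<Rightarrow> bool"
  assumes "P l" "\<not> P k" shows "\<exists>m e. e \<in> {1, - 1} \<and> P m \<and> \<not> P (m + e)"
proof (rule ccontr)
  assume *: "\<not> ?thesis"
  then have up: "P m \<Longrightarrow> P (m + 1)" and down: "P m \<Longrightarrow> P (m - 1)" for m
    by (force, metis (no_types, opaque_lifting) add_uminus_conv_diff insertCI)
  have "P i" for i
    by (induction i rule: int_induct[where k = l]) (use assms up down in auto)
  then show False using assms by simp
qed

text \<open>
  Since iterates are monotone in the exponent, an orbit has no point strictly between two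
  consecutive ones.
\<close>

lemma orbit_discrete:
  assumes f: "order_aut f" and e: "e \<in> {1, - 1}" and y: "y < zpow f e y" "y < zpow f j y"
  shows "zpow f e y \<le> zpow f j y"
proof (rule ccontr)
  assume "\<not> ?thesis"
  then have 1: "zpow f (j - e) y < y" by (simp add: not_le zpow_shift[OF f])
  have 2: "zpow f (- j) y < y" and 3: "zpow f (- e) y < y"
    using y zpow_shift[OF f, of 0 y _ y] by auto
  consider "y < f y" "e = 1" | "f y < y" "e = - 1"
    using e y 3 by (auto simp: zpow_1)
  then show False
    by cases (use 1 2 in \<open>auto simp: zpow_mono_up[OF f] zpow_mono_down[OF f]\<close>)
qed

lemma drift_between:
  assumes f: "order_aut f" and e: "e \<in> {1, - 1}" and "y \<le> a" "a < zpow f e y"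
  shows "drift f a = e"
proof -
  have "a < zpow f e a" using assms zpow_le_iff[OF f, of e y a] by simp
  then show ?thesis
    using e zpow_shift[OF f, of 0 a "- 1" a] by (auto simp: drift_def zpow_1)
qed

lemma finite_arg_max:
  fixes h :: "'a \<Rightarrow> 'b::linorder"
  assumes "finite A" "A \<noteq> {}" obtains x where "x \<in> A" "\<And>y. y \<in> A \<Longrightarrow> h y \<le> h x"
proof -
  obtain x where "x \<in> A" "h x = Max (h ` A)" using Max_in[of "h ` A"] assms by fastforce
  then show thesis using that[of x] assms(1) by simp
qed

lemma finite_arg_min:
  fixes h :: "'a \<Rightarrow> 'b::linorder"
  assumes "finite A" "A \<noteq> {}" obtains x where "x \<in> A" "\<And>y. y \<in> A \<Longrightarrow> h x \<le> h y"
proof -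
  obtain x where "x \<in> A" "h x = Min (h ` A)" using Min_in[of "h ` A"] assms by fastforce
  then show thesis using that[of x] assms(1) by simp
qed

text \<open>
  A partner for a new point \<open>a\<close> is found in one of three ways. If \<open>a\<close> lies on the orbit of a
  matched point, its image is forced. If \<open>a\<close> only lies in the orbital of some matched point,
  then by \<open>orbit_discrete\<close> each matched orbit constrains the image through two consecutive
  iterates alone, so that density supplies it; its direction of motion is that of the orbital
  and hence automatically correct. Otherwise \<open>a\<close> sits in a gap between matched orbitals, and a
  mixing map has a point with the required direction of motion in the corresponding gap.
\<close>

lemma orbit_matching_extend:
  fixes f :: "'a::linorder \<Rightarrow> 'a" and g :: "'b::linorder \<Rightarrow> 'b"
  assumes fZ: "mixing_on Z f" and gY: "mixing_on Y g"
    and p: "orbit_matching f g p" and fin: "finite p" and sub: "p \<subseteq> Z \<times> Y" and a: "a \<in> Z"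
  shows "\<exists>b\<in>Y. orbit_matching f g (insert (a, b) p)"
proof -
  have f: "order_aut f" and g: "order_aut g" using fZ gY by (auto simp: mixing_on_def)
  then have bf: "bij f" and bg: "bij g" by (auto simp: order_aut_def)
  have Zp: "zpow f k x \<in> Z" if "x \<in> Z" for k x
    using zpow_image[OF bf] fZ that by (auto simp: mixing_on_def)
  have Yp: "zpow g k x \<in> Y" if "x \<in> Y" for k x
    using zpow_image[OF bg] gY that by (auto simp: mixing_on_def)
  note mp = orbit_matching_zpow[OF p f g]
  consider (orbit) x x' k where "(x, x') \<in> p" "zpow f k x = a"
    | (orbital) x0 x0' k l where "(x0, x0') \<in> p" "zpow f k x0 < a" "a < zpow f l x0"
        "\<forall>(x, x')\<in>p. \<forall>k. zpow f k x \<noteq> a"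
    | (new) "\<forall>(x, x')\<in>p. orbit_below f x a \<or> (\<forall>k. a < zpow f k x)"
    unfolding orbit_below_def
    by (smt (verit, ccfv_threshold) case_prodI2 linorder_neqE)
  then show ?thesis
  proof cases
    case orbit
    let ?b = "zpow g k x'"
    have "orbit_matching f g (insert (a, ?b) p)"
    proof (rule orbit_matching_insert[OF p f g])
      fix y y' m assume y: "(y, y') \<in> p"
      show "zpow f m y < a \<longleftrightarrow> zpow g m y' < ?b" "a < zpow f m y \<longleftrightarrow> ?b < zpow g m y'"
        using mp[OF y orbit(1)] mp[OF orbit(1) y] orbit(2) by auto
    next
      fix m show "zpow f m a < a \<longleftrightarrow> zpow g m ?b < ?b"
        using mp[OF orbit(1) orbit(1), of "m + k" k] orbit(2) zpow_add[OF bf, of m k x]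
          zpow_add[OF bg, of m k x'] by simp
    qed
    then show ?thesis using orbit(1) sub Yp by blast
  next
    case orbital
    have ne: "zpow f k x \<noteq> a" if "(x, x') \<in> p" for x x' k using orbital(4) that by auto
    \<comment> \<open>the points of \<open>p\<close> in the orbital of \<open>a\<close>, moved next to \<open>a\<close>\<close>
    define In where "In = {(x, x'). (x, x') \<in> p \<and> (\<exists>k l. zpow f k x < a \<and> a < zpow f l x)}"
    have "\<exists>m e. e \<in> {1, - 1} \<and> zpow f m (fst q) < a \<and> a < zpow f (m + e) (fst q)" if qIn: "q \<in> In" for q
    proof -
      obtain x x' where q: "q = (x, x')" "(x, x') \<in> p" using qIn unfolding In_def by (cases q) auto
      then obtain k l where "zpow f k x < a" "\<not> zpow f l x < a"
        using qIn unfolding In_def by (auto dest: less_not_sym)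
      then obtain m e where "e \<in> {1, - 1}" "zpow f m x < a" "\<not> zpow f (m + e) x < a"
        using int_crossing[of "\<lambda>k. zpow f k x < a" k l] by auto
      then show ?thesis using ne[OF q(2)] q by (metis fst_conv linorder_neqE)
    qed
    then obtain m e where me: "\<And>q. q \<in> In \<Longrightarrow> e q \<in> {1, - 1 :: int}"
      "\<And>q. q \<in> In \<Longrightarrow> zpow f (m q) (fst q) < a" "\<And>q. q \<in> In \<Longrightarrow> a < zpow f (m q + e q) (fst q)"
      by metis
    have Inp: "In \<subseteq> p" by (auto simp: In_def)
    have finI: "finite In" using fin Inp finite_subset by blast
    have neI: "In \<noteq> {}" using orbital In_def by auto
    let ?y = "\<lambda>q. zpow f (m q) (fst q)" and ?Y = "\<lambda>q. zpow f (m q + e q) (fst q)"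
    obtain ql where ql: "ql \<in> In" "\<And>q. q \<in> In \<Longrightarrow> ?y q \<le> ?y ql"
      using finite_arg_max[OF finI neI, of ?y] by blast
    obtain qu where qu: "qu \<in> In" "\<And>q. q \<in> In \<Longrightarrow> ?Y qu \<le> ?Y q"
      using finite_arg_min[OF finI neI, of ?Y] by blast
    have pl: "(fst ql, snd ql) \<in> p" and pu: "(fst qu, snd qu) \<in> p" using ql qu Inp by auto
    have eY: "?Y q = zpow f (e q) (?y q)" for q
      using zpow_add[OF bf, of "e q" "m q"] by (simp add: add.commute)
    \<comment> \<open>no iterate of a matched point lies strictly between \<open>?y ql\<close> and \<open>a\<close>, or strictly
      between \<open>a\<close> and \<open>?Y qu\<close>\<close>
    have low: "zpow f k x \<le> ?y ql" if x: "(x, x') \<in> p" "zpow f k x < a" for x x' k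
    proof (rule ccontr)
      assume "\<not> ?thesis"
      then have gt: "?y ql < zpow f k x" by simp
      show False
      proof (cases "(x, x') \<in> In")
        case True
        let ?q = "(x, x')"
        have "zpow f k x = zpow f (k - m ?q) (?y ?q)"
          using zpow_add[OF bf, of "k - m ?q" "m ?q"] by simp
        moreover have "?y ?q < zpow f k x" using gt ql(2)[OF True] by simp
        moreover have "?y ?q < ?Y ?q" using me(2,3)[OF True] by (rule less_trans)
        ultimately have "?Y ?q \<le> zpow f k x"
          using orbit_discrete[OF f me(1)[OF True], of "?y ?q" "k - m ?q"] eY[of ?q] by simp
        then show False using me(3)[OF True] x(2) by simp
      next
        case False
        then have "\<not> a < zpow f (k + e ql) x" using x by (auto simp: In_def)
        moreover have "?Y ql < zpow f (k + e ql) x"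
          using gt zpow_less_iff[OF f, of "e ql" "?y ql" "zpow f k x"]
            zpow_add[OF bf, of "e ql" k x]
          unfolding eY add.commute[of k] by simp
        ultimately show False using me(3)[OF ql(1)] by simp
      qed
    qed
    have upp: "?Y qu \<le> zpow f k x" if x: "(x, x') \<in> p" "a < zpow f k x" for x x' k
    proof (rule ccontr)
      assume "\<not> ?thesis"
      then have lt: "zpow f k x < ?Y qu" by simp
      show False
      proof (cases "(x, x') \<in> In")
        case True
        let ?q = "(x, x')"
        have "zpow f k x = zpow f (k - m ?q) (?y ?q)"
          using zpow_add[OF bf, of "k - m ?q" "m ?q"] by simp
        moreover have "?y ?q < zpow f k x" using me(2)[OF True] x(2) by simp
        moreover have "?y ?q < ?Y ?q" using me(2,3)[OF True] by (rule less_trans)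
        ultimately have "?Y ?q \<le> zpow f k x"
          using orbit_discrete[OF f me(1)[OF True], of "?y ?q" "k - m ?q"] eY[of ?q] by simp
        then show False using qu(2)[OF True] lt by simp
      next
        case False
        then have "\<not> zpow f (k - e qu) x < a" using x by (auto simp: In_def)
        moreover have "zpow f (k - e qu) x < ?y qu"
          using lt zpow_less_iff[OF f, of "e qu" "zpow f (k - e qu) x" "?y qu"]
            zpow_add[OF bf, of "e qu" "k - e qu" x]
          by (simp add: eY)
        ultimately show False using me(2)[OF qu(1)] by simp
      qed
    qed
    let ?l = "zpow g (m ql) (snd ql)" and ?u = "zpow g (m qu + e qu) (snd qu)"
    have "?y ql < ?Y qu" using me(2)[OF ql(1)] me(3)[OF qu(1)] by (rule less_trans)
    then have "?l < ?u" using mp[OF pl pu] by simp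
    moreover have "?l \<in> Y" "?u \<in> Y" using pl pu sub Yp by blast+
    ultimately obtain b where b: "b \<in> Y" "?l < b" "b < ?u"
      using gY unfolding mixing_on_def by blast
    have lb: "zpow g k x' < b" if "(x, x') \<in> p" "zpow f k x < a" for x x' k
      using low[OF that] mp[OF pl that(1), of "m ql" k] b(2) by auto
    have ub: "b < zpow g k x'" if "(x, x') \<in> p" "a < zpow f k x" for x x' k
      using upp[OF that] mp[OF that(1) pu, of k "m qu + e qu"] b(3) by auto
    have "drift f a = e ql"
      using drift_between[OF f me(1)[OF ql(1)], of "?y ql" a] me(2,3)[OF ql(1)] by (simp add: eY)
    moreover have "?u \<le> zpow g (m ql + e ql) (snd ql)"
      using qu(2)[OF ql(1)] mp[OF pl pu, of "m ql + e ql" "m qu + e qu"] by auto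
    then have "drift g b = e ql"
      using drift_between[OF g me(1)[OF ql(1)], of "?l" b] b(2,3) zpow_add[OF bg, of "e ql" "m ql"]
      by (simp add: add.commute)
    ultimately have "drift f a = drift g b" by simp
    then have "orbit_matching f g (insert (a, b) p)"
      by (intro orbit_matching_insert[OF p f g] drift_determines_orbit f g)
        (meson lb ub ne linorder_neqE not_less_iff_gr_or_eq)+
    then show ?thesis using b(1) by blast
  next
    case new
    \<comment> \<open>only the matched points next to the gap matter for the position of the partner\<close>
    let ?Low = "{q \<in> p. orbit_below f (fst q) a}" and ?Up = "{q \<in> p. \<forall>k. a < zpow f k (fst q)}"
    have pLU: "p = ?Low \<union> ?Up" using new by auto
    have finLU: "finite ?Low" "finite ?Up" using fin by auto
    have lowtrans: "orbit_below g x c" if "x \<le> y" "orbit_below g y c" for x y c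
      using that zpow_le_iff[OF g] unfolding orbit_below_def by (meson le_less_trans)
    have uptrans: "orbit_below g c y" if "x \<le> y" "orbit_below g c x" for x y c
      using that unfolding orbit_below_def by (meson less_le_trans)
    have ple: "fst q \<le> fst q' \<longleftrightarrow> snd q \<le> snd q'" if "q \<in> p" "q' \<in> p" for q q'
      using orbit_matchingD[OF p, of "fst q'" "snd q'" "fst q" "snd q" 0] that by auto
    have dr: "drift f a \<in> {- 1, 0, 1}" by (rule drift_cases)
    have sndY: "snd q \<in> Y" if "q \<in> p" for q using that sub by auto
    have low: "orbit_below g (snd q) b"
      if "q \<in> ?Low" "ql \<in> ?Low" "fst q \<le> fst ql" "orbit_below g (snd ql) b" for q ql b
      using lowtrans[of "snd q" "snd ql" b] ple[of q ql] that by auto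
    have upp: "orbit_below g b (snd q)"
      if "q \<in> ?Up" "qu \<in> ?Up" "fst qu \<le> fst q" "orbit_below g b (snd qu)" for q qu b
      using uptrans[of "snd qu" "snd q" b] ple[of qu q] that by auto
    have "\<exists>b\<in>Y. drift g b = drift f a \<and> (\<forall>q\<in>?Low. orbit_below g (snd q) b) \<and>
        (\<forall>q\<in>?Up. orbit_below g b (snd q))"
    proof (cases "?Low = {}")
      case True
      show ?thesis
      proof (cases "?Up = {}")
        case True
        with \<open>?Low = {}\<close> gY dr show ?thesis unfolding mixing_on_def
          by (metis (no_types, lifting) empty_iff ex_in_conv)
      next
        case False
        then obtain qu where qu: "qu \<in> ?Up" "\<And>q. q \<in> ?Up \<Longrightarrow> fst qu \<le> fst q"
          using finite_arg_min[OF finLU(2), of fst] by blast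
        obtain b where b: "b \<in> Y" "drift g b = drift f a" "orbit_below g b (snd qu)"
          using gY dr sndY[of qu] qu(1) unfolding mixing_on_def by blast
        show ?thesis
          by (intro bexI[of _ b] conjI ballI b(1,2)) (use True in blast, use upp[OF _ qu(1) qu(2) b(3)] in blast)
      qed
    next
      case False
      then obtain ql where ql: "ql \<in> ?Low" "\<And>q. q \<in> ?Low \<Longrightarrow> fst q \<le> fst ql"
        using finite_arg_max[OF finLU(1), of fst] by blast
      show ?thesis
      proof (cases "?Up = {}")
        case True
        obtain b where b: "b \<in> Y" "drift g b = drift f a" "orbit_below g (snd ql) b"
          using gY dr sndY[of ql] ql(1) unfolding mixing_on_def by blast
        show ?thesis
          by (intro bexI[of _ b] conjI ballI b(1,2)) (use low[OF _ ql(1) ql(2) b(3)] in blast, use True in blast)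
      next
        case False
        then obtain qu where qu: "qu \<in> ?Up" "\<And>q. q \<in> ?Up \<Longrightarrow> fst qu \<le> fst q"
          using finite_arg_min[OF finLU(2), of fst] by blast
        have "zpow f k (fst ql) < fst qu" for k
          using ql(1) qu(1) unfolding orbit_below_def
          by (smt (verit) mem_Collect_eq less_trans zpow_0)
        then have "orbit_below g (snd ql) (snd qu)"
          using orbit_matchingD[OF p, of "fst ql" "snd ql" "fst qu" "snd qu"] ql(1) qu(1)
          unfolding orbit_below_def by auto
        then obtain b where b: "b \<in> Y" "drift g b = drift f a" "orbit_below g (snd ql) b"
            "orbit_below g b (snd qu)"
          using gY dr sndY[of qu] sndY[of ql] qu(1) ql(1) unfolding mixing_on_def by blast
        show ?thesis
          by (intro bexI[of _ b] conjI ballI b(1,2))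
            (use low[OF _ ql(1) ql(2) b(3)] in blast, use upp[OF _ qu(1) qu(2) b(4)] in blast)
      qed
    qed
    then obtain b where b: "b \<in> Y" "drift g b = drift f a"
      "\<And>q. q \<in> ?Low \<Longrightarrow> orbit_below g (snd q) b" "\<And>q. q \<in> ?Up \<Longrightarrow> orbit_below g b (snd q)"
      by blast
    have lowp: "zpow f k x < a \<and> zpow g k x' < b" if "(x, x') \<in> ?Low" for x x' k
      using that b(3)[OF that] by (auto simp: orbit_below_def)
    have uppp: "a < zpow f k x \<and> b < zpow g k x'" if "(x, x') \<in> ?Up" for x x' k
      using that b(4)[OF that] zpow_shift[OF g, of 0 b k x'] by (auto simp: orbit_below_def)
    have "orbit_matching f g (insert (a, b) p)"
    proof (rule orbit_matching_insert[OF p f g])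
      fix x x' k assume "(x, x') \<in> p"
      then consider "(x, x') \<in> ?Low" | "(x, x') \<in> ?Up" using pLU by blast
      then show "zpow f k x < a \<longleftrightarrow> zpow g k x' < b" "a < zpow f k x \<longleftrightarrow> b < zpow g k x'"
        by (cases, use lowp[of x x' k] uppp[of x x' k] in \<open>auto dest: less_not_sym\<close>)+
    qed (rule drift_determines_orbit[OF f g b(2)[symmetric]])
    then show ?thesis using b(1) by blast
  qed
qed

text \<open>
  Cantor's back-and-forth: the matching is extended alternately by the next point of \<open>Z\<close> and,
  through its converse, by the next point of \<open>Y\<close>. Its union is the graph of an isomorphism.
\<close>

theorem mixing_isomorphic:
  fixes f :: "'a::linorder \<Rightarrow> 'a" and g :: "'b::linorder \<Rightarrow> 'b"
  assumes fZ: "mixing_on Z f" and gY: "mixing_on Y g"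
    and p: "orbit_matching f g p" "finite p" "p \<subseteq> Z \<times> Y"
  obtains h where "bij_betw h Z Y" "\<And>x y. x \<in> Z \<Longrightarrow> y \<in> Z \<Longrightarrow> h x < h y \<longleftrightarrow> x < y"
    "\<And>x. x \<in> Z \<Longrightarrow> h (f x) = g (h x)" "\<And>x x'. (x, x') \<in> p \<Longrightarrow> h x = x'"
proof -
  let ?zs = "from_nat_into Z" and ?ys = "from_nat_into Y"
  have f: "order_aut f" and g: "order_aut g" and cZ: "countable Z" "Z \<noteq> {}" and cY: "countable Y" "Y \<noteq> {}"
    and fZ': "f ` Z = Z"
    using fZ gY by (auto simp: mixing_on_def)
  let ?P = "\<lambda>q. finite q \<and> q \<subseteq> Z \<times> Y \<and> orbit_matching f g q \<and> p \<subseteq> q"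
  let ?Q = "\<lambda>n q q'. q \<subseteq> q' \<and> ?zs n \<in> Domain q' \<and> ?ys n \<in> Range q'"
  have step: "\<exists>q'. ?P q' \<and> ?Q n q q'" if q: "?P q" for q and n :: nat
  proof -
    have zn: "?zs n \<in> Z" and yn: "?ys n \<in> Y" using cZ cY by (simp_all add: from_nat_into)
    obtain b where b: "b \<in> Y" "orbit_matching f g (insert (?zs n, b) q)"
      using orbit_matching_extend[OF fZ gY _ _ _ zn, of q] q by blast
    let ?q = "insert (?zs n, b) q"
    have "orbit_matching g f (?q\<inverse>)" "finite (?q\<inverse>)" "?q\<inverse> \<subseteq> Y \<times> Z"
      using b q zn unfolding orbit_matching_converse by auto
    then obtain c where c: "c \<in> Z" "orbit_matching g f (insert (?ys n, c) (?q\<inverse>))"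
      using orbit_matching_extend[OF gY fZ _ _ _ yn] by blast
    have "insert (?ys n, c) (?q\<inverse>) = (insert (c, ?ys n) ?q)\<inverse>" by auto
    then have "orbit_matching f g (insert (c, ?ys n) ?q)" using c(2) by (metis orbit_matching_converse)
    then show ?thesis
      using q b(1) c(1) zn yn by (intro exI[of _ "insert (c, ?ys n) ?q"]) auto
  qed
  have "\<exists>Q. \<forall>n. ?P (Q n) \<and> ?Q n (Q n) (Q (Suc n))"
    by (rule dependent_nat_choice) (use p in blast, rule step)
  then obtain Q where Q': "\<forall>n. ?P (Q n) \<and> ?Q n (Q n) (Q (Suc n))" ..
  have Q: "?P (Q n)" "?Q n (Q n) (Q (Suc n))" for n using spec[OF Q', of n] by (iprover+)
  define U where "U = (\<Union>n. Q n)"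
  have mono: "Q m \<subseteq> Q n" if "m \<le> n" for m n
    by (rule lift_Suc_mono_le[of Q, OF conjunct1[OF Q(2)] that])
  have U: "orbit_matching f g U"
    unfolding orbit_matching_def
  proof (clarify)
    fix a a' b b' k assume "(a, a') \<in> U" "(b, b') \<in> U"
    then obtain m n where "(a, a') \<in> Q m" "(b, b') \<in> Q n" by (auto simp: U_def)
    then have "(a, a') \<in> Q (max m n)" "(b, b') \<in> Q (max m n)"
      using mono[of m "max m n"] mono[of n "max m n"] by auto
    then show "zpow f k a < b \<longleftrightarrow> zpow g k a' < b'"
      by (rule orbit_matchingD[rotated]) (use Q(1)[of "max m n"] in iprover)
  qed
  have USub: "U \<subseteq> Z \<times> Y" unfolding U_def by (rule UN_least) (use Q(1) in iprover)
  have less: "a < b \<longleftrightarrow> a' < b'" if "(a, a') \<in> U" "(b, b') \<in> U" for a a' b b'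
    using orbit_matchingD[OF U that, of 0] by simp
  have eq: "a = b \<longleftrightarrow> a' = b'" if "(a, a') \<in> U" "(b, b') \<in> U" for a a' b b'
    using less[OF that] less[OF that(2,1)] by (metis linorder_neqE less_irrefl)
  have dom: "\<exists>y. (x, y) \<in> U" if xZ: "x \<in> Z" for x
  proof -
    obtain n where "?zs n = x" using from_nat_into_surj[OF cZ(1) xZ] by blast
    then have "x \<in> Domain (Q (Suc n))" using Q(2)[of n] by simp
    then show ?thesis by (auto simp: U_def)
  qed
  have ran: "\<exists>x. (x, y) \<in> U" if yY: "y \<in> Y" for y
  proof -
    obtain n where "?ys n = y" using from_nat_into_surj[OF cY(1) yY] by blast
    then have "y \<in> Range (Q (Suc n))" using Q(2)[of n] by simp
    then show ?thesis by (auto simp: U_def)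
  qed
  define h where "h x = (SOME y. (x, y) \<in> U)" for x
  have h: "(x, h x) \<in> U" if "x \<in> Z" for x
    unfolding h_def using dom[OF that] by (rule someI_ex)
  have h_eq: "h x = y" if "(x, y) \<in> U" for x y
    using eq[OF h that] that USub by blast
  show thesis
  proof
    show "bij_betw h Z Y"
      unfolding bij_betw_def
    proof
      show "inj_on h Z" using eq[OF h h] by (intro inj_onI) blast
      have "h ` Z \<subseteq> Y" using h USub by blast
      moreover have "y \<in> h ` Z" if "y \<in> Y" for y
        using ran[OF that] h_eq USub by blast
      ultimately show "h ` Z = Y" by blast
    qed
    show "h x < h y \<longleftrightarrow> x < y" if "x \<in> Z" "y \<in> Z" for x y
      using less[OF h h] that by blast
    show "h (f x) = g (h x)" if "x \<in> Z" for x
    proof -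
      have fx: "f x \<in> Z" using that fZ' by blast
      have "\<not> zpow g 1 (h x) < h (f x)"
        using orbit_matchingD[OF U h[OF that] h[OF fx], of 1] by (simp add: zpow_1)
      moreover have "\<not> h (f x) < zpow g 1 (h x)"
        using orbit_matching_zpow[OF U f g h[OF fx] h[OF that], of 0 1] by (simp add: zpow_1)
      ultimately show ?thesis by (simp add: zpow_1)
    qed
    show "h x = x'" if "(x, x') \<in> p" for x x'
    proof (rule h_eq)
      have "p \<subseteq> Q 0" using Q(1)[of 0] by iprover
      then show "(x, x') \<in> U" using that by (auto simp: U_def)
    qed
  qed
qed

section \<open>Mixing by lexicographic powers\<close>

abbreviation lookup :: "('a \<Rightarrow>\<^sub>0 'b::zero) \<Rightarrow> 'a \<Rightarrow> 'b" where "lookup \<equiv> Poly_Mapping.lookup"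

text \<open>
  It acts on every coordinate only for functions that fix \<open>0\<close>, the value of almost all
  coordinates; all functions below do.
\<close>

abbreviation coordwise :: "('a::zero \<Rightarrow> 'a) \<Rightarrow> ('b \<Rightarrow>\<^sub>0 'a) \<Rightarrow> ('b \<Rightarrow>\<^sub>0 'a)" where
  "coordwise \<equiv> Poly_Mapping.map"

lemma lookup_coordwise: "g 0 = 0 \<Longrightarrow> lookup (coordwise g p) k = g (lookup p k)"
  by (auto simp: Poly_Mapping.map.rep_eq when_def)

lemma coordwise_comp: "f 0 = 0 \<Longrightarrow> g 0 = 0 \<Longrightarrow> coordwise f (coordwise g p) = coordwise (\<lambda>x. f (g x)) p"
  by (rule poly_mapping_eqI) (simp add: lookup_coordwise)

lemma coordwise_id: "coordwise (\<lambda>x. x) p = p" 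
  by (rule poly_mapping_eqI) (simp add: lookup_coordwise)

lemma coordwise_single: "f 0 = 0 \<Longrightarrow> coordwise f (Poly_Mapping.single k a) = Poly_Mapping.single k (f a)"
  by (rule poly_mapping_eqI) (simp add: lookup_coordwise lookup_single when_def)

lemma less_poly_mapping_iff:
  "p < q \<longleftrightarrow> (\<exists>k. lookup p k < lookup q k \<and> (\<forall>k'<k. lookup p k' = lookup q k'))"
  by (simp add: less_poly_mapping.rep_eq less_fun_def)

lemma less_poly_mappingI:
  assumes "lookup p k < lookup q k" "\<And>j. j < k \<Longrightarrow> lookup p j = lookup q j" shows "p < q"
  using assms less_poly_mapping_iff by blast

lemma poly_mapping_less_coord:
  fixes p q :: "nat \<Rightarrow>\<^sub>0 real"
  assumes "\<And>j. j < k \<Longrightarrow> lookup p j = lookup q j" "p < q" shows "lookup p k \<le> lookup q k"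
proof -
  obtain i where i: "lookup p i < lookup q i" "\<forall>j<i. lookup p j = lookup q j"
    using assms(2) less_poly_mapping_iff by blast
  then have "k \<le> i" using assms(1)[of i] by (metis less_irrefl not_le)
  then show ?thesis using i by (cases "k = i") auto
qed

lemma single_less_iff:
  fixes a b :: real
  shows "Poly_Mapping.single (0::nat) a < Poly_Mapping.single 0 b \<longleftrightarrow> a < b"
  unfolding less_poly_mapping_iff by (auto simp: lookup_single when_def)

lemma order_aut_coordwise:
  assumes f: "order_aut f" and f0: "f (0::real) = 0"
  shows "order_aut (coordwise f :: (nat \<Rightarrow>\<^sub>0 real) \<Rightarrow> _)"
proof -
  have bf: "bij f" using f by (simp add: order_aut_def)
  have i0: "finv f 0 = 0" using bf f0 by (metis bij_inv_eq_iff)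
  have "coordwise f p < coordwise f q" if "p < q" for p q :: "nat \<Rightarrow>\<^sub>0 real"
    using that f bf by (auto simp: less_poly_mapping_iff lookup_coordwise f0 order_aut_less_iff)
  moreover have "bij (coordwise f :: (nat \<Rightarrow>\<^sub>0 real) \<Rightarrow> _)"
    by (rule o_bij[of "coordwise (finv f)"])
      (auto simp: fun_eq_iff coordwise_comp coordwise_id f0 i0 bij_is_inj[OF bf] surj_f_inv_f[OF bij_is_surj[OF bf]])
  ultimately show ?thesis by (auto simp: order_aut_def strict_mono_def)
qed

lemma finv_coordwise:
  assumes f: "order_aut f" and f0: "f (0::real) = 0"
  shows "finv (coordwise f :: (nat \<Rightarrow>\<^sub>0 real) \<Rightarrow> _) = coordwise (finv f)"
proof -
  have bf: "bij f" using f by (simp add: order_aut_def)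
  have i0: "finv f 0 = 0" using bf f0 by (metis bij_inv_eq_iff)
  have "inj (coordwise f :: (nat \<Rightarrow>\<^sub>0 real) \<Rightarrow> _)" using order_aut_coordwise[OF assms]
    by (simp add: order_aut_def bij_is_inj)
  moreover have "coordwise f (coordwise (finv f) p) = p" for p :: "nat \<Rightarrow>\<^sub>0 real"
    by (simp add: coordwise_comp f0 i0 surj_f_inv_f[OF bij_is_surj[OF bf]] coordwise_id)
  ultimately show ?thesis by (metis ext inv_f_f)
qed

lemma finv_fixed: "order_aut f \<Longrightarrow> f x = x \<Longrightarrow> finv f x = x"
  by (metis bij_inv_eq_iff order_aut_def)

lemma zpow_coordwise:
  assumes f: "order_aut f" and f0: "f (0::real) = 0"
  shows "zpow (coordwise f) k p = coordwise (zpow f k) (p :: nat \<Rightarrow>\<^sub>0 real)"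
proof (induction k rule: int_induct[where k = 0])
  case base
  then show ?case by (simp add: zpow_def id_def coordwise_id)
next
  case (step1 i)
  have "bij (coordwise f :: (nat \<Rightarrow>\<^sub>0 real) \<Rightarrow> _)" "bij f" using order_aut_coordwise[OF assms] f by (auto simp: order_aut_def)
  then show ?case using step1 zpow_fixed[OF f f0]
    by (simp add: zpow_plus_1 coordwise_comp f0)
next
  case (step2 i)
  have "bij (coordwise f :: (nat \<Rightarrow>\<^sub>0 real) \<Rightarrow> _)" "bij f" using order_aut_coordwise[OF assms] f by (auto simp: order_aut_def)
  then show ?case using step2 zpow_fixed[OF f f0]
    by (simp add: zpow_minus_1 finv_coordwise[OF assms] coordwise_comp f0 finv_fixed[OF f])
qed

definition seqs :: "real set \<Rightarrow> (nat \<Rightarrow>\<^sub>0 real) set" where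
  "seqs S = {p. \<forall>k. lookup p k \<in> S}"

lemma countable_seqs:
  assumes "countable S" shows "countable (seqs S)"
proof -
  have "seqs S \<subseteq> (\<lambda>xs. Abs_poly_mapping (\<lambda>k. if k < length xs then xs ! k else 0)) ` lists S"
  proof
    fix p assume p: "p \<in> seqs S"
    have "finite {k. lookup p k \<noteq> 0}" by simp
    then obtain n where n: "\<And>k. lookup p k \<noteq> 0 \<Longrightarrow> k < n"
      unfolding finite_nat_set_iff_bounded by auto
    let ?xs = "map (lookup p) [0..<n]"
    have "(\<lambda>k. if k < length ?xs then ?xs ! k else 0) = lookup p" using n by (auto simp: fun_eq_iff)
    then have "p = Abs_poly_mapping (\<lambda>k. if k < length ?xs then ?xs ! k else 0)" by (simp only: lookup_inverse)
    moreover have "?xs \<in> lists S" using p by (auto simp: seqs_def)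
    ultimately show "p \<in> (\<lambda>xs. Abs_poly_mapping (\<lambda>k. if k < length xs then xs ! k else 0)) ` lists S"
      by blast
  qed
  then show ?thesis by (rule countable_subset) (intro countable_image countable_lists assms)
qed

lemma coordwise_seqs:
  assumes "order_aut f" "f 0 = 0" "f ` S = S" shows "coordwise f ` seqs S = seqs S"
proof -
  have i: "finv f ` S = S" by (metis assms(1,3) bij_is_inj image_inv_f_f order_aut_def)
  have sub: "coordwise g ` seqs S \<subseteq> seqs S" if "g 0 = 0" "g ` S = S" for g
    using that by (auto simp: seqs_def lookup_coordwise)
  have "p \<in> coordwise f ` seqs S" if "p \<in> seqs S" for p
  proof -
    have "coordwise (finv f) p \<in> seqs S" using sub[OF finv_fixed[OF assms(1,2)] i] that by blast
    moreover have "coordwise f (coordwise (finv f) p) = p"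
      using assms(1,2) finv_fixed[OF assms(1,2)]
      by (simp add: coordwise_comp order_aut_def bij_is_surj surj_f_inv_f coordwise_id)
    ultimately show ?thesis by (metis image_eqI)
  qed
  then show ?thesis using sub[OF assms(2,3)] by blast
qed

text \<open>
  The witnesses in \<open>mixing_on_seqs\<close> have this form. The prefix of \<open>p\<close> and \<open>e\<close> will be fixed by
  the map, so that \<open>e\<close> alone decides on which side of the orbit of \<open>p\<close> the whole orbit of the
  branch lies, while \<open>s\<close> is left free to give it any direction of motion.
\<close>

definition branch :: "(nat \<Rightarrow>\<^sub>0 real) \<Rightarrow> nat \<Rightarrow> real \<Rightarrow> real \<Rightarrow> (nat \<Rightarrow>\<^sub>0 real)" where
  "branch p j e s = Abs_poly_mapping
     (\<lambda>k. if k < j then lookup p k else if k = j then e else if k = Suc j then s else 0)"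

lemma lookup_branch:
  "lookup (branch p j e s) k = (if k < j then lookup p k else if k = j then e else if k = Suc j then s else 0)"
proof -
  have "finite {k. (if k < j then lookup p k else if k = j then e else if k = Suc j then s else 0) \<noteq> 0}"
    by (rule finite_subset[of _ "{..Suc j}"]) auto
  then show ?thesis unfolding branch_def by simp
qed

lemma branch_in_seqs:
  assumes "p \<in> seqs S" "e \<in> S" "s \<in> S" "0 \<in> S" shows "branch p j e s \<in> seqs S"
  using assms by (auto simp: seqs_def lookup_branch)

lemma drift_branch:
  assumes f: "order_aut f" "f 0 = 0" and "\<And>k. k < j \<Longrightarrow> f (lookup p k) = lookup p k" "f e = e"
  shows "drift (coordwise f) (branch p j e s) = drift f s"
proof -
  let ?c = "branch p j e s"
  have eq: "lookup (coordwise f ?c) k = lookup ?c k" if "k \<noteq> Suc j" for k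
    using that assms by (auto simp: lookup_coordwise lookup_branch)
  have at: "lookup ?c (Suc j) = s" "lookup (coordwise f ?c) (Suc j) = f s"
    using assms by (auto simp: lookup_coordwise lookup_branch)
  consider "s < f s" | "f s < s" | "f s = s" by fastforce
  then show ?thesis
  proof cases
    case 1
    then have "?c < coordwise f ?c" using eq at by (intro less_poly_mappingI[of _ "Suc j"]) auto
    then show ?thesis using 1 by (simp add: drift_def)
  next
    case 2
    then have "coordwise f ?c < ?c" using eq at by (intro less_poly_mappingI[of _ "Suc j"]) auto
    then show ?thesis using 2 by (auto simp: drift_def)
  next
    case 3
    then have "coordwise f ?c = ?c" using eq at by (intro poly_mapping_eqI) (metis)
    then show ?thesis using 3 by (simp add: drift_def)
  qed
qed

lemma branch_above:
  assumes f: "order_aut f" "f 0 = 0" and pre: "\<And>k. k < j \<Longrightarrow> f (lookup p k) = lookup p k"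
    and e: "f e = e" "lookup p j < e"
  shows "orbit_below (coordwise f) p (branch p j e s)"
  unfolding orbit_below_def
proof
  fix k
  have "lookup (zpow (coordwise f) k p) i = zpow f k (lookup p i)" for i
    by (simp add: zpow_coordwise[OF f] lookup_coordwise zpow_fixed[OF f])
  moreover have "zpow f k (lookup p j) < e"
    using zpow_less_iff[OF f(1), of k "lookup p j" e] zpow_fixed[OF f(1) e(1)] e(2) by simp
  ultimately show "zpow (coordwise f) k p < branch p j e s"
    by (intro less_poly_mappingI[of _ j]) (auto simp: lookup_branch zpow_fixed[OF f(1)] pre)
qed

lemma branch_below:
  assumes f: "order_aut f" "f 0 = 0" and pre: "\<And>k. k < j \<Longrightarrow> f (lookup p k) = lookup p k"
    and e: "f e = e" "e < lookup p j"
  shows "orbit_below (coordwise f) (branch p j e s) p"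
  unfolding orbit_below_def
proof
  fix k
  have "lookup (zpow (coordwise f) k (branch p j e s)) i = zpow f k (lookup (branch p j e s) i)" for i
    by (simp add: zpow_coordwise[OF f] lookup_coordwise zpow_fixed[OF f])
  then show "zpow (coordwise f) k (branch p j e s) < p"
    by (intro less_poly_mappingI[of _ j]) (auto simp: lookup_branch zpow_fixed[OF f(1)] pre e)
qed

text \<open>
  For a point that is moved and has a bounded orbit, the least fixed point above it.
\<close>

definition orbit_sup :: "(real \<Rightarrow> real) \<Rightarrow> real \<Rightarrow> real" where
  "orbit_sup f x = (SUP k. zpow f k x)"

lemma orbit_sup_fixed:
  assumes f: "order_aut f" and b: "\<And>k. zpow f k x \<le> b"
  shows "f (orbit_sup f x) = orbit_sup f x"
proof -
  have bf: "bij f" using f by (simp add: order_aut_def)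
  have bdd: "bdd_above (range (\<lambda>k. zpow f k x))" using b by (intro bdd_aboveI) auto
  have le: "zpow f k x \<le> orbit_sup f x" for k
    unfolding orbit_sup_def by (rule cSUP_upper[OF _ bdd]) simp
  have le_f: "f u \<le> f v \<longleftrightarrow> u \<le> v" for u v using order_aut_less_iff[OF f] by (meson not_le)
  have "orbit_sup f x \<le> f (orbit_sup f x)"
    unfolding orbit_sup_def
  proof (rule cSUP_least)
    fix k :: int
    show "zpow f k x \<le> f (SUP k. zpow f k x)"
      using le[of "k - 1"] zpow_plus_1[OF bf, of "k - 1" x] le_f[of "zpow f (k - 1) x" "orbit_sup f x"]
      by (simp add: orbit_sup_def)
  qed simp
  moreover have "orbit_sup f x \<le> finv f (orbit_sup f x)"
    unfolding orbit_sup_def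
  proof (rule cSUP_least)
    fix k :: int
    show "zpow f k x \<le> finv f (SUP k. zpow f k x)"
      using le[of "k + 1"] zpow_plus_1[OF bf, of k x] le_f[of "zpow f k x" "finv f (orbit_sup f x)"]
        surj_f_inv_f[OF bij_is_surj[OF bf]]
      by (simp add: orbit_sup_def)
  qed simp
  then have "f (orbit_sup f x) \<le> orbit_sup f x"
    using le_f[of "orbit_sup f x" "finv f (orbit_sup f x)"] surj_f_inv_f[OF bij_is_surj[OF bf]] by simp
  ultimately show ?thesis by simp
qed

lemma less_orbit_sup:
  assumes f: "order_aut f" and b: "\<And>k. zpow f k x \<le> b" and ne: "f x \<noteq> x"
  shows "x < orbit_sup f x"
proof -
  have bdd: "bdd_above (range (\<lambda>k. zpow f k x))" using b by (intro bdd_aboveI) auto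
  have "zpow f 0 x \<le> orbit_sup f x"
    unfolding orbit_sup_def by (rule cSUP_upper[OF _ bdd]) simp
  moreover have "x \<noteq> orbit_sup f x" using orbit_sup_fixed[OF f b] ne by metis
  ultimately show ?thesis by simp
qed

text \<open>
  Such a place is where a sequence can be left in either direction: an entry that is moved or
  equal to \<open>0\<close> differs from the extreme entries \<open>T\<close> and \<open>- T\<close>, which are fixed and not \<open>0\<close>. It
  exists beyond every \<open>N\<close> with fixed entries before, because almost all entries are \<open>0\<close>.
\<close>

lemma first_moved_place:
  fixes p :: "nat \<Rightarrow>\<^sub>0 real"
  assumes "f 0 = 0" "\<And>k. k < N \<Longrightarrow> f (lookup p k) = lookup p k"
  obtains j where "N \<le> j" "\<And>k. k < j \<Longrightarrow> f (lookup p k) = lookup p k"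
    "f (lookup p j) \<noteq> lookup p j \<or> lookup p j = 0"
proof (cases "\<exists>j. f (lookup p j) \<noteq> lookup p j")
  case True
  define j where "j = (LEAST j. f (lookup p j) \<noteq> lookup p j)"
  have "f (lookup p j) \<noteq> lookup p j" unfolding j_def using True by (rule LeastI_ex)
  moreover have "f (lookup p k) = lookup p k" if "k < j" for k
    using that not_less_Least unfolding j_def by blast
  ultimately show ?thesis using that[of j] assms(2) by (meson not_le)
next
  case False
  have "finite {k. lookup p k \<noteq> 0}" by simp
  then obtain n where "\<And>k. lookup p k \<noteq> 0 \<Longrightarrow> k < n"
    unfolding finite_nat_set_iff_bounded by auto
  then have "lookup p (max N n) = 0" by (metis max.cobounded2 not_le)
  then show ?thesis using that[of "max N n"] False by auto
qed

text \<open>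
  The orbit of a sequence is decided at its first moved entry. To separate the orbit of \<open>a\<close>
  from an orbit above it, leave \<open>a\<close> at a place where all earlier entries are fixed, through a
  fixed entry larger than the whole orbit of the entry of \<open>a\<close>: the extreme entry \<open>T\<close> if this
  happens after the first difference from the upper sequence \<open>b\<close>, and otherwise the supremum
  of the orbit of the entry of \<open>a\<close>. If the supremum is the entry of \<open>b\<close> itself, leave \<open>b\<close>
  downwards at a later place instead. The entry after the branching place then gives the new
  sequence any of the three directions of motion.
\<close>

theorem mixing_on_seqs:
  assumes f: "order_aut f" and f0: "f 0 = 0" and T: "0 < T" "f T = T" "f (- T) = - T"
    and S: "countable S" "S \<subseteq> {- T..T}" "0 \<in> S" "T \<in> S" "- T \<in> S" "f ` S = S"
    and sup: "\<And>x. x \<in> S \<Longrightarrow> orbit_sup f x \<in> S"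
    and up: "\<exists>x\<in>S. x < f x" and down: "\<exists>x\<in>S. f x < x"
  shows "mixing_on (seqs S) (coordwise f)"
proof -
  let ?Z = "seqs S"
  have Slook: "lookup p k \<in> S" if "p \<in> ?Z" for p k using that by (simp add: seqs_def)
  have Sz: "zpow f k x \<in> S" if "x \<in> S" for k x
    using zpow_image[of f S k] f S(6) that by (auto simp: order_aut_def)
  have bd: "zpow f k x \<le> T" if "x \<in> S" for k x using subsetD[OF S(2) Sz[OF that, of k]] by simp
  have supfix: "f (orbit_sup f x) = orbit_sup f x" if "x \<in> S" for x
    using orbit_sup_fixed[OF f bd[OF that]] .
  have suplt: "x < orbit_sup f x" if "x \<in> S" "f x \<noteq> x" for x
    using less_orbit_sup[OF f bd[OF that(1)] that(2)] .
  have dS: "\<exists>s\<in>S. drift f s = d" if "d \<in> {- 1, 0, 1}" for d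
  proof -
    obtain u v where "u \<in> S" "u < f u" "v \<in> S" "f v < v" using up down by blast
    then have "drift f u = 1" "drift f v = - 1" "drift f 0 = 0" by (auto simp: drift_def f0)
    then show ?thesis using that \<open>u \<in> S\<close> \<open>v \<in> S\<close> S(3) by auto
  qed
  \<comment> \<open>every sequence can be left upwards and downwards, arbitrarily late as long as its
    entries are fixed\<close>
  have above: "\<exists>j\<ge>N. (\<forall>k<j. f (lookup p k) = lookup p k) \<and> orbit_below (coordwise f) p (branch p j T s)
      \<and> orbit_below (coordwise f) (branch p j (- T) s) p"
    if p: "p \<in> ?Z" and N: "\<And>k. k < N \<Longrightarrow> f (lookup p k) = lookup p k" for p N s
  proof -
    obtain j where j: "N \<le> j" "\<And>k. k < j \<Longrightarrow> f (lookup p k) = lookup p k"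
      "f (lookup p j) \<noteq> lookup p j \<or> lookup p j = 0"
      using first_moved_place[OF f0 N] by blast
    have "lookup p j \<noteq> T" "lookup p j \<noteq> - T" using j(3) T by auto
    then have "lookup p j < T" "- T < lookup p j"
      using Slook[OF p, of j] S(2) by (auto simp: less_le)
    then show ?thesis using j(1,2) branch_above[OF f f0 j(2) T(2)] branch_below[OF f f0 j(2) T(3)] by blast
  qed
  have brZ: "branch p j e s \<in> ?Z" if "p \<in> ?Z" "e \<in> S" "s \<in> S" for p j e s
    using branch_in_seqs[OF that S(3)] .
  have dense: "\<exists>c\<in>?Z. a < c \<and> c < b" if ab: "a \<in> ?Z" "b \<in> ?Z" "a < b" for a b
  proof -
    obtain i where i: "lookup a i < lookup b i" "\<forall>k<i. lookup a k = lookup b k"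
      using ab(3) less_poly_mapping_iff by blast
    have "finite {k. lookup a k \<noteq> 0}" by simp
    then obtain n where "\<And>k. lookup a k \<noteq> 0 \<Longrightarrow> k < n"
      unfolding finite_nat_set_iff_bounded by auto
    then have j: "lookup a (max (Suc i) n) = 0" by (metis max.cobounded2 not_le)
    let ?c = "branch a (max (Suc i) n) T 0"
    have "a < ?c"
      by (rule less_poly_mappingI[of _ "max (Suc i) n"]) (auto simp: lookup_branch j T)
    moreover have "?c < b"
      by (rule less_poly_mappingI[of _ i]) (use i in \<open>auto simp: lookup_branch\<close>)
    ultimately show ?thesis using brZ[OF ab(1) S(4,3)] by blast
  qed
  have between: "\<exists>c\<in>?Z. drift (coordwise f) c = d \<and> orbit_below (coordwise f) a c \<and> orbit_below (coordwise f) c b"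
    if ab: "a \<in> ?Z" "b \<in> ?Z" "orbit_below (coordwise f) a b" and d: "d \<in> {- 1, 0, 1}" for a b d
  proof -
    obtain s where s: "s \<in> S" "drift f s = d" using dS[OF d] by blast
    have lz: "lookup (zpow (coordwise f) k p) i = zpow f k (lookup p i)" for k i and p :: "nat \<Rightarrow>\<^sub>0 real"
      by (simp add: zpow_coordwise[OF f f0] lookup_coordwise zpow_fixed[OF f f0])
    have ob: "zpow (coordwise f) k a < b" for k using ab(3) by (simp add: orbit_below_def)
    have "a < b" using ob[of 0] by simp
    then obtain i where i: "lookup a i < lookup b i" "\<And>k. k < i \<Longrightarrow> lookup a k = lookup b k"
      using less_poly_mapping_iff by blast
    \<comment> \<open>a moved common entry would be pushed above the one of \<open>b\<close> by \<open>f\<close> or by its inverse\<close>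
    have fixa: "f (lookup a k) = lookup a k" if "k < i" for k
      using that
    proof (induction k rule: less_induct)
      case (less k)
      have lo: "f (lookup a k') = lookup a k'" if "k' < k" for k' using less that by simp
      have "lookup (zpow (coordwise f) e a) k \<le> lookup b k" for e
        using poly_mapping_less_coord[OF _ ob, of k e] lz lo zpow_fixed[OF f] i(2) less.prems by auto
      then have "zpow f 1 (lookup a k) \<le> lookup a k" "zpow f (- 1) (lookup a k) \<le> lookup a k"
        using i(2)[OF less.prems] lz by metis+
      moreover have "zpow f (- 1) (lookup a k) \<le> lookup a k \<longleftrightarrow> lookup a k \<le> f (lookup a k)"
        using zpow_shift[OF f, of 0 "lookup a k" "- 1" "lookup a k"] by (simp add: zpow_1 flip: not_less)
      ultimately show ?case by (simp add: zpow_1)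
    qed
    then have fixb: "f (lookup b k) = lookup b k" if "k < i" for k using i(2) that by metis
    have le: "zpow f e (lookup a i) \<le> lookup b i" for e
      using poly_mapping_less_coord[OF _ ob, of i e] lz fixa zpow_fixed[OF f] i(2) by auto
    show ?thesis
    proof (cases "f (lookup a i) = lookup a i")
      case True
      then have "\<And>k. k < Suc i \<Longrightarrow> f (lookup a k) = lookup a k" using fixa less_Suc_eq by auto
      then obtain j where j: "Suc i \<le> j" "\<And>k. k < j \<Longrightarrow> f (lookup a k) = lookup a k"
          "orbit_below (coordwise f) a (branch a j T s)"
        using above[OF ab(1), of "Suc i" s] by blast
      have "orbit_below (coordwise f) (branch a j T s) b"
        unfolding orbit_below_def
      proof
        fix k
        show "zpow (coordwise f) k (branch a j T s) < b"
          by (rule less_poly_mappingI[of _ i])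
            (use j i fixb in \<open>auto simp: lz lookup_branch zpow_fixed[OF f]\<close>)
      qed
      then show ?thesis using j brZ[OF ab(1) S(4) s(1)] drift_branch[OF f f0 j(2) T(2)] s(2) by blast
    next
      case False
      let ?z = "orbit_sup f (lookup a i)"
      have zS: "?z \<in> S" "f ?z = ?z" "lookup a i < ?z"
        using sup supfix suplt False Slook[OF ab(1)] by auto
      have "?z \<le> lookup b i" unfolding orbit_sup_def by (rule cSUP_least) (use le in auto)
      then consider "?z < lookup b i" | "?z = lookup b i" by fastforce
      then show ?thesis
      proof cases
        case 1
        let ?c = "branch a i ?z s"
        have "branch b i ?z s = ?c" by (rule poly_mapping_eqI) (simp add: lookup_branch i(2))
        then have "orbit_below (coordwise f) ?c b" using branch_below[OF f f0 fixb zS(2) 1, of s] by simp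
        then show ?thesis
          using branch_above[OF f f0 fixa zS(2,3)] brZ[OF ab(1) zS(1) s(1)] drift_branch[OF f f0 fixa zS(2)] s(2)
          by blast
      next
        case 2
        then have "\<And>k. k < Suc i \<Longrightarrow> f (lookup b k) = lookup b k" using fixb zS less_Suc_eq by metis
        then obtain j where j: "Suc i \<le> j" "\<And>k. k < j \<Longrightarrow> f (lookup b k) = lookup b k"
            "orbit_below (coordwise f) (branch b j (- T) s) b"
          using above[OF ab(2), of "Suc i" s] by blast
        have "zpow f k (lookup a i) < ?z" for k
          using zpow_less_iff[OF f, of k "lookup a i" ?z] zpow_fixed[OF f zS(2)] zS(3) by simp
        then have "orbit_below (coordwise f) a (branch b j (- T) s)"
          unfolding orbit_below_def
          by (intro allI less_poly_mappingI[of _ i])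
            (use j i 2 fixa in \<open>auto simp: lz lookup_branch zpow_fixed[OF f]\<close>)
        then show ?thesis using j brZ[OF ab(2) S(5) s(1)] drift_branch[OF f f0 j(2) T(3)] s(2) by blast
      qed
    qed
  qed
  have ends: "(\<exists>c\<in>?Z. drift (coordwise f) c = d \<and> orbit_below (coordwise f) a c) \<and>
      (\<exists>c\<in>?Z. drift (coordwise f) c = d \<and> orbit_below (coordwise f) c a)"
    if a: "a \<in> ?Z" and d: "d \<in> {- 1, 0, 1}" for a d
  proof -
    obtain s where s: "s \<in> S" "drift f s = d" using dS[OF d] by blast
    obtain j where j: "\<And>k. k < j \<Longrightarrow> f (lookup a k) = lookup a k"
        "orbit_below (coordwise f) a (branch a j T s)" "orbit_below (coordwise f) (branch a j (- T) s) a"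
      using above[OF a, of 0 s] by blast
    then show ?thesis
      using brZ[OF a _ s(1)] S(4,5) drift_branch[OF f f0 j(1)] T(2,3) s(2) by blast
  qed
  have "(0 :: nat \<Rightarrow>\<^sub>0 real) \<in> ?Z" using S(3) by (simp add: seqs_def)
  then show ?thesis
    unfolding mixing_on_def
    using countable_seqs[OF S(1)] order_aut_coordwise[OF f f0] coordwise_seqs[OF f f0 S(6)] dense between ends by blast
qed

section \<open>Homeomorphisms of the line with prescribed values\<close>

definition mono_rel :: "('a::linorder \<times> 'b::linorder) set \<Rightarrow> bool" where
  "mono_rel R \<longleftrightarrow> (\<forall>(x, y)\<in>R. \<forall>(x', y')\<in>R. x < x' \<longleftrightarrow> y < y')"

lemma mono_relD: "mono_rel R \<Longrightarrow> (x, y) \<in> R \<Longrightarrow> (x', y') \<in> R \<Longrightarrow> x < x' \<longleftrightarrow> y < y'"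
  unfolding mono_rel_def by fastforce

lemma mono_rel_converse: "mono_rel (R\<inverse>) \<longleftrightarrow> mono_rel R"
  unfolding mono_rel_def by fastforce

lemma mono_rel_insert:
  assumes "mono_rel R" "\<And>x y. (x, y) \<in> R \<Longrightarrow> (x < a \<longleftrightarrow> y < b) \<and> (a < x \<longleftrightarrow> b < y)"
  shows "mono_rel (insert (a, b) R)"
  using assms unfolding mono_rel_def by auto

text \<open>
  Piecewise linear interpolation, one point at a time from left to right.
\<close>

lemma extend_strict_mono_on:
  fixes f :: "real \<Rightarrow> real"
  assumes "finite D" "strict_mono_on D f"
  shows "\<exists>t. order_aut t \<and> (\<forall>x\<in>D. t x = f x)"
  using assms
proof (induction D rule: finite_linorder_max_induct)
  case empty
  then show ?case using order_aut_id by auto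
next
  case (insert b A)
  have "strict_mono_on A f" using insert.prems by (auto simp: strict_mono_on_def)
  then obtain t where t: "order_aut t" "\<And>x. x \<in> A \<Longrightarrow> t x = f x" using insert.IH by blast
  show ?case
  proof (cases "A = {}")
    case True
    have "order_aut (\<lambda>x. x + (f b - b))"
      unfolding order_aut_def strict_mono_def
      by (auto intro!: bij_betw_byWitness[where f' = "\<lambda>x. x - (f b - b)"])
    then show ?thesis using True by (intro exI[of _ "\<lambda>x. x + (f b - b)"]) auto
  next
    case False
    define a where "a = Max A"
    have a: "a \<in> A" "\<And>x. x \<in> A \<Longrightarrow> x \<le> a" using False insert.hyps by (auto simp: a_def)
    then have ab: "a < b" "f a < f b" using insert.hyps insert.prems by (auto simp: strict_mono_on_def)
    define s where "s = (f b - f a) / (b - a)"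
    have s: "0 < s" using ab by (simp add: s_def)
    \<comment> \<open>keep \<open>t\<close> up to \<open>a\<close> and continue along the straight line through the last two points\<close>
    define t' where "t' x = (if x \<le> a then t x else f a + s * (x - a))" for x
    have ta: "t a = f a" using t(2) a(1) .
    have tle: "t x \<le> f a \<longleftrightarrow> x \<le> a" for x
      using order_aut_less_iff[OF t(1), of a x] ta by (simp flip: not_less)
    have "strict_mono t'"
    proof (rule strict_monoI)
      fix x y :: real assume "x < y"
      consider "y \<le> a" | "x \<le> a" "a < y" | "a < x" by linarith
      then show "t' x < t' y"
      proof cases
        case 1
        then show ?thesis using \<open>x < y\<close> order_aut_less_iff[OF t(1)] by (simp add: t'_def)
      next
        case 2
        have "0 < s * (y - a)" using 2 s by simp
        then show ?thesis using 2 tle[of x] by (simp add: t'_def)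
      next
        case 3
        then show ?thesis using \<open>x < y\<close> s by (simp add: t'_def)
      qed
    qed
    moreover have "\<exists>x. t' x = y" for y
    proof (cases "y \<le> f a")
      case True
      obtain x where x: "t x = y" using t(1) by (metis bij_pointE order_aut_def)
      then show ?thesis using True tle[of x] by (auto simp: t'_def)
    next
      case False
      then have "0 < (y - f a) / s" using s by simp
      then show ?thesis using s by (intro exI[of _ "a + (y - f a) / s"]) (simp add: t'_def)
    qed
    ultimately have "order_aut t'"
      unfolding order_aut_def bij_def by (metis strict_mono_imp_inj_on surjI surj_def)
    moreover have "t' b = f b" using ab by (simp add: t'_def s_def)
    moreover have "t' x = f x" if "x \<in> A" for x using a(2)[OF that] t(2)[OF that] by (simp add: t'_def)
    ultimately show ?thesis by (intro exI[of _ t']) auto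
  qed
qed

lemma extend_mono_rel:
  fixes R :: "(real \<times> real) set"
  assumes "finite R" "mono_rel R"
  obtains t where "order_aut t" "\<And>x y. (x, y) \<in> R \<Longrightarrow> t x = y"
proof -
  have uniq: "y = y'" if "(x, y) \<in> R" "(x, y') \<in> R" for x y y'
    using mono_relD[OF assms(2) that] mono_relD[OF assms(2) that(2,1)] by simp
  define f where "f x = (SOME y. (x, y) \<in> R)" for x
  have f: "(x, f x) \<in> R" if "(x, y) \<in> R" for x y unfolding f_def using that by (rule someI)
  have "strict_mono_on (Domain R) f"
  proof (rule strict_mono_onI)
    fix x x' assume "x \<in> Domain R" "x' \<in> Domain R" "x < x'"
    then show "f x < f x'" using mono_relD[OF assms(2) f f] by blast
  qed
  moreover have "finite (Domain R)" using assms(1) by (rule finite_Domain)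
  ultimately obtain t where "order_aut t" "\<forall>x\<in>Domain R. t x = f x"
    using extend_strict_mono_on by metis
  then show thesis using that uniq f by blast
qed

text \<open>
  The data are repeated with the opposite orientation on the negative axis, so that a word
  which moves a prescribed point also moves some point in the opposite direction. The fixed
  points are those that the passage to sequences needs: \<open>0\<close> as default entry, \<open>T\<close> and \<open>- T\<close> as
  extreme entries.
\<close>

lemma extend_mono_rel_odd:
  fixes R :: "nat \<Rightarrow> (real \<times> real) set"
  assumes "\<And>i. finite (R i)" "\<And>i. mono_rel (R i)" "\<And>i. R i \<subseteq> {0<..<T} \<times> {0<..<T}" and T: "0 < T"
  obtains t where "\<And>i. order_aut (t i)" "\<And>i. t i 0 = 0" "\<And>i. t i T = T" "\<And>i. t i (- T) = - T"
    "\<And>i x y. (x, y) \<in> R i \<Longrightarrow> t i x = y" "\<And>i x y. (x, y) \<in> R i \<Longrightarrow> t i (- x) = - y"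
proof -
  let ?R = "\<lambda>i. R i \<union> (\<lambda>(x, y). (- x, - y)) ` R i \<union> {(0, 0), (T, T), (- T, - T)}"
  have "\<exists>t. order_aut t \<and> (\<forall>(x, y)\<in>?R i. t x = y)" for i
  proof -
    have "mono_rel (?R i)"
      unfolding mono_rel_def
    proof (clarify)
      fix x y x' y' assume m: "(x, y) \<in> ?R i" "(x', y') \<in> ?R i"
      have c: "0 < x \<and> x < T \<and> 0 < y \<and> y < T" if "(x, y) \<in> R i" for x y
        using assms(3)[of i] that by auto
      have l: "x < x' \<longleftrightarrow> y < y'" if "(x, y) \<in> R i" "(x', y') \<in> R i" for x y x' y'
        using mono_relD[OF assms(2) that] .
      have cases: "(x, y) \<in> R i \<or> (- x, - y) \<in> R i \<or> (x = 0 \<and> y = 0) \<or> (x = T \<and> y = T)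
          \<or> (x = - T \<and> y = - T)" if "(x, y) \<in> ?R i" for x y
        using that by auto
      show "x < x' \<longleftrightarrow> y < y'"
        using cases[OF m(1)] cases[OF m(2)] T c[of x y] c[of x' y'] c[of "- x" "- y"] c[of "- x'" "- y'"]
          l[of x y x' y'] l[of "- x'" "- y'" "- x" "- y"]
        by (elim disjE) auto
    qed
    moreover have "finite (?R i)" using assms(1) by simp
    ultimately obtain t where t: "order_aut t" "\<And>x y. (x, y) \<in> ?R i \<Longrightarrow> t x = y"
      using extend_mono_rel[of "?R i"] by metis
    show ?thesis by (intro exI[of _ t] conjI t(1) ballI) (use t(2) in \<open>simp only: split_paired_all case_prod_conv\<close>)
  qed
  then have "\<exists>t. \<forall>i. order_aut (t i) \<and> (\<forall>(x, y)\<in>?R i. t i x = y)" by (rule choice[OF allI])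
  then obtain t where t': "\<forall>i. order_aut (t i) \<and> (\<forall>(x, y)\<in>?R i. t i x = y)" ..
  have t: "order_aut (t i)" "\<forall>(x, y)\<in>?R i. t i x = y" for i using spec[OF t', of i] by iprover+
  show thesis
  proof
    fix i
    show "order_aut (t i)" by (rule t)
    have tD: "t i x = y" if "(x, y) \<in> ?R i" for x y using bspec[OF t(2) that] by simp
    show "t i 0 = 0" "t i T = T" "t i (- T) = - T" by (rule tD, simp)+
    fix x y assume xy: "(x, y) \<in> R i"
    show "t i x = y" by (rule tD) (simp add: xy)
    have "(- x, - y) \<in> (\<lambda>(x, y). (- x, - y)) ` R i" using xy by (rule rev_image_eqI) simp
    then show "t i (- x) = - y" by (intro tD) simp
  qed
qed

section \<open>Words\<close>

fun letter_map :: "('i \<Rightarrow> 'x \<Rightarrow> 'x) \<Rightarrow> bool \<times> 'i \<Rightarrow> 'x \<Rightarrow> 'x" where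
  "letter_map t (b, i) = (if b then t i else finv (t i))"

primrec word_map :: "('i \<Rightarrow> 'x \<Rightarrow> 'x) \<Rightarrow> (bool \<times> 'i) list \<Rightarrow> 'x \<Rightarrow> 'x" where
  "word_map t [] = (\<lambda>x. x)"
| "word_map t (l # u) = (\<lambda>x. letter_map t l (word_map t u x))"

lemma word_map_append: "word_map t (u @ v) x = word_map t u (word_map t v x)"
  by (induction u) auto

lemma order_aut_letter_map: "(\<And>i. order_aut (t i)) \<Longrightarrow> order_aut (letter_map t l)"
  by (cases l) (auto simp: order_aut_inv)

lemma order_aut_word_map:
  assumes "\<And>i. order_aut (t i)" shows "order_aut (word_map t u)"
proof (induction u)
  case (Cons l u)
  show ?case using order_aut_comp[OF order_aut_letter_map[OF assms, where l = l] Cons] by (simp add: comp_def)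
qed (simp add: order_aut_id)

lemma letter_map_fixed: "(\<And>i. order_aut (t i)) \<Longrightarrow> (\<And>i. t i x = x) \<Longrightarrow> letter_map t l x = x"
  by (cases l) (auto simp: finv_fixed)

lemma word_map_fixed: "(\<And>i. order_aut (t i)) \<Longrightarrow> (\<And>i. t i x = x) \<Longrightarrow> word_map t u x = x"
  by (induction u) (auto simp: letter_map_fixed)

lemma letter_map_image:
  assumes "\<And>i. order_aut (t i)" "\<And>i. t i ` S = S" shows "letter_map t l ` S = S"
proof -
  have "finv (t i) ` S = S" for i by (metis assms bij_is_inj image_inv_f_f order_aut_def)
  then show ?thesis using assms by (cases l) auto
qed

lemma word_map_image:
  assumes "\<And>i. order_aut (t i)" "\<And>i. t i ` S = S" shows "word_map t u ` S = S"
proof (induction u)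
  case (Cons l u)
  have "word_map t (l # u) ` S = letter_map t l ` word_map t u ` S" by (auto simp: image_iff)
  then show ?case using Cons letter_map_image[OF assms] by simp
qed simp

text \<open>
  The last clause, minimality, is how bounds on the elements of the closure are obtained.
\<close>

lemma countable_closure:
  assumes "countable B" "countable (Ops :: ('a \<Rightarrow> 'a) set)"
  obtains S where "countable S" "B \<subseteq> S" "\<And>g x. g \<in> Ops \<Longrightarrow> x \<in> S \<Longrightarrow> g x \<in> S"
    "\<And>P. B \<subseteq> P \<Longrightarrow> (\<And>g x. g \<in> Ops \<Longrightarrow> x \<in> P \<Longrightarrow> g x \<in> P) \<Longrightarrow> S \<subseteq> P"
proof -
  let ?S = "(\<lambda>(gs, b). foldr (\<lambda>g. g) gs b) ` (lists Ops \<times> B)"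
  show thesis
  proof
    show "countable ?S" using assms by (intro countable_image countable_SIGMA countable_lists)
    show "B \<subseteq> ?S" by (force intro: image_eqI[of _ _ "([], _)"])
    show "g x \<in> ?S" if gx: "g \<in> Ops" "x \<in> ?S" for g x
    proof -
      obtain gs b where "gs \<in> lists Ops" "b \<in> B" "x = foldr (\<lambda>g. g) gs b" using gx(2) by auto
      then show ?thesis using gx(1) by (intro image_eqI[of _ _ "(g # gs, b)"]) auto
    qed
    show "?S \<subseteq> P" if P: "B \<subseteq> P" "\<And>g x. g \<in> Ops \<Longrightarrow> x \<in> P \<Longrightarrow> g x \<in> P" for P
    proof -
      have "foldr (\<lambda>g. g) gs b \<in> P" if "gs \<in> lists Ops" "b \<in> B" for gs b
        using that by (induction gs) (use P in auto)
      then show ?thesis by auto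
    qed
  qed
qed

text \<open>
  The entries are the closure of the given points under the generators, their inverses and
  suprema of orbits of the word. It stays within the interval because \<open>T\<close> and \<open>- T\<close> are fixed
  and orbits, hence also their suprema, remain between them.
\<close>

lemma mixing_from_line:
  fixes t :: "nat \<Rightarrow> real \<Rightarrow> real"
  assumes t: "\<And>i. order_aut (t i)" and fix0: "\<And>i. t i 0 = 0" "\<And>i. t i T = T" "\<And>i. t i (- T) = - T" and T: "0 < T"
    and K: "countable K" "K \<subseteq> {- T..T}"
    and a: "a \<in> {- T..T}" "a < word_map t u a" and b: "b \<in> {- T..T}" "word_map t u b < b"
  obtains S where "K \<subseteq> S" "\<And>i. t i ` S = S" "mixing_on (seqs S) (coordwise (word_map t u))"
proof -
  let ?f = "word_map t u"
  let ?Ops = "range t \<union> range (\<lambda>i. finv (t i)) \<union> {orbit_sup ?f}"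
  let ?B = "K \<union> {a, b, 0, T, - T}"
  obtain S where S: "countable S" "?B \<subseteq> S" "\<And>g x. g \<in> ?Ops \<Longrightarrow> x \<in> S \<Longrightarrow> g x \<in> S"
    "\<And>P. ?B \<subseteq> P \<Longrightarrow> (\<And>g x. g \<in> ?Ops \<Longrightarrow> x \<in> P \<Longrightarrow> g x \<in> P) \<Longrightarrow> S \<subseteq> P"
    using countable_closure[of ?B ?Ops] K(1) by auto
  have f: "order_aut ?f" using order_aut_word_map[OF t] .
  have ff: "?f 0 = 0" "?f T = T" "?f (- T) = - T" using fix0 by (auto intro!: word_map_fixed t)
  have le: "g x \<le> g y \<longleftrightarrow> x \<le> y" if "order_aut g" for g x y
    using order_aut_less_iff[OF that] by (meson not_le)
  have pres: "g x \<in> {- T..T}" if "order_aut g" "g T = T" "g (- T) = - T" "x \<in> {- T..T}" for g and x :: real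
    using le[OF that(1), of x T] le[OF that(1), of "- T" x] that by auto
  have "S \<subseteq> {- T..T}"
  proof (rule S(4))
    show "?B \<subseteq> {- T..T}" using K a b T by auto
    fix g x assume g: "g \<in> ?Ops" and x: "x \<in> {- T..T}"
    have zb: "zpow ?f k x \<in> {- T..T}" for k
      using pres[OF order_aut_zpow[OF f] zpow_fixed[OF f ff(2)] zpow_fixed[OF f ff(3)] x] .
    have "orbit_sup ?f x \<le> T" unfolding orbit_sup_def using zb by (intro cSUP_least) auto
    moreover have "x \<le> orbit_sup ?f x"
      using zb unfolding orbit_sup_def
      by (intro cSUP_upper2[where x = 0]) (auto intro!: bdd_aboveI[of _ T])
    ultimately show "g x \<in> {- T..T}"
      using g x pres[OF t, of _ x] pres[OF order_aut_inv[OF t], of _ x] fix0 finv_fixed[OF t] by auto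
  qed
  moreover have tS: "t i ` S = S" for i
  proof -
    have "x \<in> t i ` S" if "x \<in> S" for x
    proof (rule image_eqI)
      show "x = t i (finv (t i) x)" using t[of i] by (simp add: order_aut_def bij_is_surj surj_f_inv_f)
      show "finv (t i) x \<in> S" by (rule S(3)[OF _ that]) blast
    qed
    moreover have "t i x \<in> S" if "x \<in> S" for x using S(3)[of "t i" x] that by blast
    ultimately show ?thesis by blast
  qed
  ultimately have "mixing_on (seqs S) (coordwise ?f)"
    using S(1,2) S(3)[of "orbit_sup ?f"] a b word_map_image[of t S u, OF t tS]
    by (intro mixing_on_seqs[OF f ff(1) T ff(2,3)]) auto
  then show thesis using that S(2) tS by blast
qed

subsection \<open>Reduced words move points\<close>

definition reduced :: "(bool \<times> 'i) list \<Rightarrow> bool" where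
  "reduced u \<longleftrightarrow> (\<forall>p q b i. u \<noteq> p @ (b, i) # (\<not> b, i) # q)"

lemma reduced_Cons:
  assumes "reduced ((b, i) # u)" shows "reduced u" "u \<noteq> [] \<Longrightarrow> hd u \<noteq> (\<not> b, i)"
proof -
  show "reduced u"
    unfolding reduced_def
  proof (intro allI notI)
    fix p q c j assume "u = p @ (c, j) # (\<not> c, j) # q"
    then have "(b, i) # u = ((b, i) # p) @ (c, j) # (\<not> c, j) # q" by simp
    then show False using assms unfolding reduced_def by blast
  qed
  show "hd u \<noteq> (\<not> b, i)" if "u \<noteq> []"
  proof
    assume "hd u = (\<not> b, i)"
    then have "(b, i) # u = [] @ (b, i) # (\<not> b, i) # tl u" using that by (cases u) auto
    then show False using assms unfolding reduced_def by blast
  qed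
qed

lemma finite_gap:
  fixes L U P :: "real set"
  assumes "finite L" "finite U" "finite P" "\<And>l u. l \<in> L \<Longrightarrow> u \<in> U \<Longrightarrow> l < u"
  obtains z where "z \<notin> P" "\<And>l. l \<in> L \<Longrightarrow> l < z" "\<And>u. u \<in> U \<Longrightarrow> z < u"
proof -
  define m where "m = (if L = {} then (if U = {} then 0 else Min U - 1) else Max L)"
  define M where "M = (if U = {} then m + 1 else Min U)"
  have "Max L < Min U" if "L \<noteq> {}" "U \<noteq> {}" using that assms by auto
  then have "m < M" by (simp add: m_def M_def del: Min_gr_iff Max_less_iff)
  then have "infinite {m<..<M}" by simp
  then obtain z where "z \<in> {m<..<M} - P"
    using assms(3) by (metis Diff_eq_empty_iff all_not_in_conv finite_subset)
  moreover have "l \<le> m" if "l \<in> L" for l using that assms(1) by (auto simp: m_def)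
  moreover have "M \<le> u" if "u \<in> U" for u using that assms(2) by (auto simp: M_def)
  ultimately show thesis using that by (meson DiffE greaterThanLessThan_iff le_less_trans less_le_trans)
qed

text \<open>
  Prescribed values for a generator turn into prescribed values for its inverse, so that both
  kinds of letters can be treated alike.
\<close>

definition oriented :: "bool \<Rightarrow> ('a \<times> 'a) set \<Rightarrow> ('a \<times> 'a) set" where
  "oriented b R = (if b then R else R\<inverse>)"

lemma oriented_simps:
  "mono_rel (oriented b R) \<longleftrightarrow> mono_rel R" "oriented b (oriented b R) = R"
  "finite (oriented b R) \<longleftrightarrow> finite R" "oriented b R \<subseteq> P \<times> P \<longleftrightarrow> R \<subseteq> P \<times> P"
  "oriented b R \<subseteq> oriented b Q \<longleftrightarrow> R \<subseteq> Q"
  by (auto simp: oriented_def mono_rel_converse)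

text \<open>
  The image of \<open>1\<close> under the letters of a reduced word can be made a new point at every step.
  By induction only the letter read last has the current point \<open>y\<close> among its prescribed
  values, and there it leads to \<open>y\<close>. In a reduced word the next letter is not the inverse of
  that one, so its value at \<open>y\<close> is still free. It is placed in the gap which monotonicity
  leaves for it, away from the finite set \<open>P\<close> of points used so far. As \<open>1\<close> is in \<open>P\<close>, the
  word does not fix \<open>1\<close>. The points are kept positive so that \<open>extend_mono_rel_odd\<close> applies.
\<close>

lemma reduced_word_moves:
  fixes u :: "(bool \<times> 'i) list"
  assumes "reduced u"
  shows "\<exists>(R :: 'i \<Rightarrow> (real \<times> real) set) P y. finite P \<and> P \<subseteq> {0<..} \<and> 1 \<in> P \<and>
    (\<forall>i. R i \<subseteq> P \<times> P \<and> mono_rel (R i)) \<and> y \<in> P \<and> (u \<noteq> [] \<longrightarrow> y \<noteq> 1) \<and>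
    (\<forall>b i. y \<in> Domain (oriented b (R i)) \<longrightarrow> u \<noteq> [] \<and> hd u = (\<not> b, i)) \<and>
    (\<forall>t. (\<forall>i. bij (t i) \<and> (\<forall>(x, x')\<in>R i. t i x = x')) \<longrightarrow> word_map t u 1 = y)"
  using assms
proof (induction u)
  case Nil
  have "mono_rel {}" by (simp add: mono_rel_def)
  then show ?case by (intro exI[of _ "\<lambda>_. {}"] exI[of _ "{1}"] exI[of _ 1]) (auto simp: oriented_def)
next
  case (Cons l u)
  obtain b i where l: "l = (b, i)" by (cases l)
  note red = reduced_Cons[OF Cons.prems[unfolded l]]
  obtain R :: "'i \<Rightarrow> (real \<times> real) set" and P y where P: "finite P" "P \<subseteq> {0<..}" "1 \<in> P"
    and R: "\<And>i. R i \<subseteq> P \<times> P" "\<And>i. mono_rel (R i)" and y: "y \<in> P"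
      "\<And>b i. y \<in> Domain (oriented b (R i)) \<Longrightarrow> u \<noteq> [] \<and> hd u = (\<not> b, i)"
    and path: "\<And>t. (\<forall>i. bij (t i) \<and> (\<forall>(x, x')\<in>R i. t i x = x')) \<Longrightarrow> word_map t u 1 = y"
    using Cons.IH[OF red(1)] by metis
  let ?Q = "oriented b (R i)"
  have Q: "?Q \<subseteq> P \<times> P" "mono_rel ?Q" using R by (simp_all add: oriented_simps)
  then have finQ: "finite ?Q" using P(1) finite_subset by blast
  have new: "y \<notin> Domain ?Q" using y(2)[of b i] red(2) by auto
  \<comment> \<open>since \<open>u\<close> is reduced, the image of \<open>y\<close> under the new letter is not yet prescribed\<close>
  define Lo where "Lo = insert 0 {q. \<exists>p. (p, q) \<in> ?Q \<and> p < y}"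
  define Up where "Up = {q. \<exists>p. (p, q) \<in> ?Q \<and> y < p}"
  have "finite Lo" unfolding Lo_def finite_insert
    by (rule finite_subset[OF _ finite_Range[OF finQ]]) auto
  moreover have "finite Up" unfolding Up_def
    by (rule finite_subset[OF _ finite_Range[OF finQ]]) auto
  moreover have "q < q'" if q: "q \<in> Lo" "q' \<in> Up" for q q'
  proof -
    obtain p' where p': "(p', q') \<in> ?Q" "y < p'" using q(2) by (auto simp: Up_def)
    show ?thesis
    proof (cases "q = 0")
      case True
      then show ?thesis using p'(1) Q(1) P(2) by auto
    next
      case False
      then obtain p where "(p, q) \<in> ?Q" "p < y" using q(1) by (auto simp: Lo_def)
      then show ?thesis using mono_relD[OF Q(2) _ p'(1), of p q] p'(2) by simp
    qed
  qed
  ultimately obtain z where z: "z \<notin> P" "\<And>q. q \<in> Lo \<Longrightarrow> q < z" "\<And>q. q \<in> Up \<Longrightarrow> z < q"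
    using finite_gap[of Lo Up P] P(1) by metis
  let ?Q' = "insert (y, z) ?Q"
  let ?R = "R(i := oriented b ?Q')"
  have "mono_rel ?Q'"
  proof (rule mono_rel_insert[OF Q(2)])
    fix p q assume pq: "(p, q) \<in> ?Q"
    then have "p \<noteq> y" using new by auto
    then consider "p < y" | "y < p" by linarith
    then show "(p < y \<longleftrightarrow> q < z) \<and> (y < p \<longleftrightarrow> z < q)"
    proof cases
      case 1
      then have "q \<in> Lo" using pq by (auto simp: Lo_def)
      then show ?thesis using z(2)[of q] 1 by simp
    next
      case 2
      then have "q \<in> Up" using pq by (auto simp: Up_def)
      then show ?thesis using z(3)[of q] 2 by simp
    qed
  qed
  then have mono: "mono_rel (?R j)" for j using R(2) by (simp add: oriented_simps)
  have RP: "?R j \<subseteq> insert z P \<times> insert z P" for j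
    using R(1)[of j] Q(1) y(1) by (auto simp: oriented_def)
  have fresh: "l # u \<noteq> [] \<and> hd (l # u) = (\<not> c, j)" if "z \<in> Domain (oriented c (?R j))" for c j
  proof -
    have "(z, x) \<notin> R k" "(x, z) \<notin> R k" for x k using R(1)[of k] z(1) by auto
    moreover have "z \<noteq> y" using z(1) y(1) by blast
    ultimately show ?thesis using that l by (auto simp: oriented_def split: if_splits)
  qed
  have "word_map t (l # u) 1 = z" if t: "\<forall>j. bij (t j) \<and> (\<forall>(x, x')\<in>?R j. t j x = x')" for t
  proof -
    have sub: "R j \<subseteq> ?R j" for j by (auto simp: oriented_def)
    have tj: "bij (t j)" "\<forall>(x, x')\<in>?R j. t j x = x'" for j using spec[OF t, of j] by iprover+
    have "word_map t u 1 = y"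
      by (rule path) (intro allI conjI tj(1) ballI bspec[OF tj(2)] subsetD[OF sub])
    moreover have "letter_map t (b, i) y = z"
    proof -
      have "(if b then (y, z) else (z, y)) \<in> ?R i" by (simp add: oriented_def)
      then have "if b then t i y = z else t i z = y" using bspec[OF tj(2)[of i]] by (auto split: if_splits)
      moreover have "bij (t i)" by (rule tj)
      ultimately show ?thesis by (auto split: if_splits simp: bij_is_inj)
    qed
    ultimately show ?thesis by (simp add: l)
  qed
  moreover have "0 < z" using z(2)[of 0] by (simp add: Lo_def)
  ultimately show ?case
    using P mono RP fresh z(1)
    by (intro exI[of _ ?R] exI[of _ "insert z P"] exI[of _ z] conjI) auto
qed

section \<open>Orders from actions\<close>

text \<open>
  The maps need to be meaningful on \<open>Z\<close> only: the space on which the amalgam will act is a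
  countable subset of an uncountable type.
\<close>

definition set_action :: "'g monoid \<Rightarrow> 'x::linorder set \<Rightarrow> ('g \<Rightarrow> 'x \<Rightarrow> 'x) \<Rightarrow> bool" where
  "set_action G Z \<gamma> \<longleftrightarrow> (\<forall>v\<in>Z. \<gamma> \<one>\<^bsub>G\<^esub> v = v) \<and>
     (\<forall>g\<in>carrier G. \<forall>v\<in>Z. \<gamma> g v \<in> Z) \<and>
     (\<forall>g\<in>carrier G. \<forall>h\<in>carrier G. \<forall>v\<in>Z. \<gamma> (g \<otimes>\<^bsub>G\<^esub> h) v = \<gamma> g (\<gamma> h v)) \<and>
     (\<forall>g\<in>carrier G. \<forall>v\<in>Z. \<forall>v'\<in>Z. v < v' \<longrightarrow> \<gamma> g v < \<gamma> g v')"

lemma set_actionD: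
  assumes "set_action G Z \<gamma>"
  shows "v \<in> Z \<Longrightarrow> \<gamma> \<one>\<^bsub>G\<^esub> v = v" "g \<in> carrier G \<Longrightarrow> v \<in> Z \<Longrightarrow> \<gamma> g v \<in> Z"
    "g \<in> carrier G \<Longrightarrow> h \<in> carrier G \<Longrightarrow> v \<in> Z \<Longrightarrow> \<gamma> (g \<otimes>\<^bsub>G\<^esub> h) v = \<gamma> g (\<gamma> h v)"
    "g \<in> carrier G \<Longrightarrow> v \<in> Z \<Longrightarrow> v' \<in> Z \<Longrightarrow> v < v' \<Longrightarrow> \<gamma> g v < \<gamma> g v'"
  using assms unfolding set_action_def by blast+

text \<open>
  Left orders are a notion for records of type \<open>'g monoid\<close>, while the locale \<open>group\<close> covers
  all record extensions.
\<close>

locale plain_group = group G for G :: "'g monoid" (structure)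

lemma (in plain_group) mult_inv_cancel:
  assumes "x \<in> carrier G" "y \<in> carrier G"
  shows "x \<otimes> (inv x \<otimes> y) = y" "inv x \<otimes> (x \<otimes> y) = y"
  using assms by (simp_all add: m_assoc[symmetric])

definition positive_cone :: "'g monoid \<Rightarrow> 'g set \<Rightarrow> bool" where
  "positive_cone G Q \<longleftrightarrow> Q \<subseteq> carrier G \<and> \<one>\<^bsub>G\<^esub> \<notin> Q \<and>
     (\<forall>x\<in>Q. \<forall>y\<in>Q. x \<otimes>\<^bsub>G\<^esub> y \<in> Q) \<and> (\<forall>x\<in>carrier G. x = \<one>\<^bsub>G\<^esub> \<or> x \<in> Q \<or> inv\<^bsub>G\<^esub> x \<in> Q)"

definition cone_order :: "'g monoid \<Rightarrow> 'g set \<Rightarrow> 'g rel" where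
  "cone_order G Q = {(x, y). x \<in> carrier G \<and> y \<in> carrier G \<and> (x = y \<or> inv\<^bsub>G\<^esub> x \<otimes>\<^bsub>G\<^esub> y \<in> Q)}"

lemma (in plain_group) cone_order_left_order:
  assumes Q: "positive_cone G Q" shows "cone_order G Q \<in> left_orders G"
proof -
  have mult: "inv x \<otimes> z \<in> Q" if "x \<in> carrier G" "y \<in> carrier G" "z \<in> carrier G"
    "inv x \<otimes> y \<in> Q" "inv y \<otimes> z \<in> Q" for x y z
  proof -
    have "(inv x \<otimes> y) \<otimes> (inv y \<otimes> z) \<in> Q" using Q that(4,5) unfolding positive_cone_def by blast
    then show ?thesis using that by (simp add: m_assoc mult_inv_cancel)
  qed
  have "antisym (cone_order G Q)"
  proof (rule antisymI, rule ccontr)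
    fix x y assume "(x, y) \<in> cone_order G Q" "(y, x) \<in> cone_order G Q" "x \<noteq> y"
    then have "inv x \<otimes> x \<in> Q" "x \<in> carrier G" using mult[of x y x] by (auto simp: cone_order_def)
    then show False using Q by (simp add: positive_cone_def)
  qed
  moreover have "trans (cone_order G Q)"
    by (rule transI) (use mult in \<open>auto simp: cone_order_def\<close>)
  moreover have "total_on (carrier G) (cone_order G Q)"
    unfolding total_on_def
  proof (intro ballI impI)
    fix x y assume xy: "x \<in> carrier G" "y \<in> carrier G" "x \<noteq> y"
    then have "inv x \<otimes> y \<noteq> \<one>" using mult_inv_cancel(1)[OF xy(1,2)] by auto
    then have "inv x \<otimes> y \<in> Q \<or> inv (inv x \<otimes> y) \<in> Q" using Q xy by (auto simp: positive_cone_def)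
    then show "(x, y) \<in> cone_order G Q \<or> (y, x) \<in> cone_order G Q"
      using xy by (auto simp: cone_order_def inv_mult_group)
  qed
  moreover have "refl_on (carrier G) (cone_order G Q)" "cone_order G Q \<subseteq> carrier G \<times> carrier G"
    by (auto simp: cone_order_def refl_on_def)
  moreover have "(g \<otimes> f, g \<otimes> h) \<in> cone_order G Q"
    if "f \<in> carrier G" "g \<in> carrier G" "h \<in> carrier G" "(f, h) \<in> cone_order G Q" for f g h
  proof -
    have "inv (g \<otimes> f) \<otimes> (g \<otimes> h) = inv f \<otimes> h"
      using that(1-3) by (simp add: inv_mult_group m_assoc mult_inv_cancel)
    then show ?thesis using that by (auto simp: cone_order_def)
  qed
  ultimately show ?thesis by (simp add: left_orders_def order_on_defs)
qed

lemma (in plain_group) positive_elements_cone_order: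
  assumes Q: "positive_cone G Q" shows "positive_elements G (cone_order G Q) = Q"
  using Q by (auto simp: positive_elements_def cone_order_def positive_cone_def)

lemma (in plain_group) left_order_mult_iff:
  assumes r: "r \<in> left_orders G" and "g \<in> carrier G" "x \<in> carrier G" "y \<in> carrier G"
  shows "(g \<otimes> x, g \<otimes> y) \<in> r \<longleftrightarrow> (x, y) \<in> r"
proof
  have lo: "(g \<otimes> x, g \<otimes> y) \<in> r" if "(x, y) \<in> r" "g \<in> carrier G" "x \<in> carrier G" "y \<in> carrier G" for g x y
    using r that unfolding left_orders_def by blast
  show "(g \<otimes> x, g \<otimes> y) \<in> r" if "(x, y) \<in> r" by (rule lo[OF that assms(2-4)])
  show "(x, y) \<in> r" if "(g \<otimes> x, g \<otimes> y) \<in> r"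
    using lo[OF that, of "inv g"] assms by (simp add: m_assoc[symmetric])
qed

lemma (in plain_group) left_order_cone:
  assumes r: "r \<in> left_orders G" shows "positive_cone G (positive_elements G r)"
proof -
  have lin: "linear_order_on (carrier G) r" using r by (simp add: left_orders_def)
  then have tr: "trans r" and as: "antisym r" and tot: "total_on (carrier G) r"
    by (auto simp: order_on_defs)
  show ?thesis
    unfolding positive_cone_def
  proof (intro conjI ballI)
    show "positive_elements G r \<subseteq> carrier G" "\<one> \<notin> positive_elements G r"
      by (auto simp: positive_elements_def)
    show "x \<otimes> y \<in> positive_elements G r" if "x \<in> positive_elements G r" "y \<in> positive_elements G r" for x y
    proof -
      have xy: "x \<in> carrier G" "y \<in> carrier G" "(\<one>, x) \<in> r" "(\<one>, y) \<in> r" "y \<noteq> \<one>" "x \<noteq> \<one>"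
        using that by (auto simp: positive_elements_def)
      have xxy: "(x, x \<otimes> y) \<in> r" using left_order_mult_iff[OF r xy(1) one_closed xy(2)] xy by simp
      then have "(\<one>, x \<otimes> y) \<in> r" using tr xy(3) by (meson transD)
      moreover have "x \<otimes> y \<noteq> \<one>"
      proof
        assume "x \<otimes> y = \<one>"
        then have "x = \<one>" using xxy xy(3) as by (metis antisymD)
        then show False using xy(6) by simp
      qed
      ultimately show ?thesis using xy by (simp add: positive_elements_def)
    qed
    show "x = \<one> \<or> x \<in> positive_elements G r \<or> inv x \<in> positive_elements G r" if x: "x \<in> carrier G" for x
    proof (cases "x = \<one>")
      case False
      then consider "(\<one>, x) \<in> r" | "(x, \<one>) \<in> r" using tot x unfolding total_on_def by blast
      then show ?thesis
      proof cases
        case 2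
        then have "(\<one>, inv x) \<in> r" using left_order_mult_iff[OF r inv_closed[OF x] x one_closed] x by simp
        then show ?thesis using x False by (simp add: positive_elements_def)
      qed (use x False in \<open>simp add: positive_elements_def\<close>)
    qed simp
  qed
qed

text \<open>
  The elements that move \<open>v\<close> up form a semigroup, and those that fix \<open>v\<close> form a subgroup on
  which any cone \<open>N\<close> may be used to break ties; multiplying by an element of the stabiliser
  does not change whether \<open>v\<close> is moved up.
\<close>

lemma (in plain_group) dynamical_cone:
  assumes act: "set_action G Z \<gamma>" and v: "v \<in> Z" and N: "positive_cone G N"
  shows "positive_cone G {g \<in> carrier G. v < \<gamma> g v \<or> (\<gamma> g v = v \<and> g \<in> N)}"
proof -
  note \<gamma> = set_actionD[OF act]
  have inv: "v < \<gamma> (inv g) v" if g: "g \<in> carrier G" "\<gamma> g v < v" for g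
  proof -
    have "\<gamma> (inv g) (\<gamma> g v) < \<gamma> (inv g) v" by (rule \<gamma>(4)) (use g v \<gamma>(2) in auto)
    then show ?thesis using \<gamma>(3)[of "inv g" g v] \<gamma>(1)[OF v] g v by simp
  qed
  have inv_fix: "\<gamma> (inv g) v = v" if g: "g \<in> carrier G" "\<gamma> g v = v" for g
    using \<gamma>(3)[of "inv g" g v] \<gamma>(1)[OF v] g v by simp
  have m: "x \<otimes> y \<in> carrier G \<and> (v < \<gamma> (x \<otimes> y) v \<or> (\<gamma> (x \<otimes> y) v = v \<and> x \<otimes> y \<in> N))"
    if x: "x \<in> carrier G" "v < \<gamma> x v \<or> (\<gamma> x v = v \<and> x \<in> N)"
      and y: "y \<in> carrier G" "v < \<gamma> y v \<or> (\<gamma> y v = v \<and> y \<in> N)" for x y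
  proof -
    have xy: "\<gamma> (x \<otimes> y) v = \<gamma> x (\<gamma> y v)" using \<gamma>(3) x y v by simp
    show ?thesis
    proof (cases "\<gamma> x v = v \<and> \<gamma> y v = v")
      case True
      then have "x \<in> N" "y \<in> N" using x y by auto
      then have "x \<otimes> y \<in> N" using N by (simp add: positive_cone_def)
      then show ?thesis using True x y xy by simp
    next
      case False
      have "v < \<gamma> x (\<gamma> y v)"
      proof (cases "\<gamma> y v = v")
        case False
        then have "v < \<gamma> y v" using y by auto
        then have "\<gamma> x v < \<gamma> x (\<gamma> y v)" using \<gamma>(4)[OF x(1) v \<gamma>(2)[OF y(1) v]] by simp
        then show ?thesis using x by auto
      qed (use False x in auto)
      then show ?thesis using x y xy by simp
    qed
  qed
  show ?thesis
    unfolding positive_cone_def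
  proof (intro conjI ballI)
    show "\<one> \<notin> {g \<in> carrier G. v < \<gamma> g v \<or> (\<gamma> g v = v \<and> g \<in> N)}"
      using \<gamma>(1)[OF v] N by (simp add: positive_cone_def)
    show "x = \<one> \<or> x \<in> {g \<in> carrier G. v < \<gamma> g v \<or> (\<gamma> g v = v \<and> g \<in> N)} \<or>
        inv x \<in> {g \<in> carrier G. v < \<gamma> g v \<or> (\<gamma> g v = v \<and> g \<in> N)}" if x: "x \<in> carrier G" for x
    proof -
      consider "v < \<gamma> x v" | "\<gamma> x v < v" | "\<gamma> x v = v" by fastforce
      then show ?thesis
      proof cases
        case 3
        have "x = \<one> \<or> x \<in> N \<or> inv x \<in> N" using N x by (simp add: positive_cone_def)
        then show ?thesis using 3 inv_fix[OF x 3] x by auto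
      qed (use x inv[OF x] in auto)
    qed
  qed (use m in auto)
qed

text \<open>
  The elements of \<open>P\<close> are positive whatever cone breaks the ties at \<open>v\<close>. Breaking them with
  the cone of \<open>r\<close> and with its reverse gives orders in which \<open>g\<close> has opposite signs.
\<close>

lemma (in plain_group) two_orders:
  assumes r: "r \<in> left_orders G" and act: "set_action G Z \<gamma>" and v: "v \<in> Z"
    and P: "P \<subseteq> carrier G" "\<And>p. p \<in> P \<Longrightarrow> v < \<gamma> p v"
    and g: "g \<in> carrier G" "g \<noteq> \<one>" "\<gamma> g v = v"
  shows "\<exists>r1\<in>basic_nbhd G P. \<exists>r2\<in>basic_nbhd G P. r1 \<noteq> r2"
proof -
  let ?N = "positive_elements G r"
  let ?N' = "{x \<in> carrier G. inv x \<in> ?N}"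
  have N: "positive_cone G ?N" by (rule left_order_cone[OF r])
  then have N': "positive_cone G ?N'"
  proof -
    have "inv x \<otimes> inv y \<in> ?N" if "inv x \<in> ?N" "inv y \<in> ?N" for x y
      using N that by (simp add: positive_cone_def)
    then show ?thesis using N by (auto simp: positive_cone_def inv_mult_group)
  qed
  define Q where "Q M = {g \<in> carrier G. v < \<gamma> g v \<or> (\<gamma> g v = v \<and> g \<in> M)}" for M
  have Q: "positive_cone G (Q ?N)" "positive_cone G (Q ?N')"
    unfolding Q_def by (rule dynamical_cone[OF act v N], rule dynamical_cone[OF act v N'])
  have nb: "cone_order G (Q M) \<in> basic_nbhd G P" if "positive_cone G (Q M)" for M
    using that P cone_order_left_order[OF that] positive_elements_cone_order[OF that]
    by (auto simp: basic_nbhd_def Q_def)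
  have notboth: "\<not> (x \<in> ?N \<and> inv x \<in> ?N)" if "x \<in> carrier G" for x
  proof
    assume "x \<in> ?N \<and> inv x \<in> ?N"
    then have "x \<otimes> inv x \<in> ?N" using N by (simp add: positive_cone_def)
    then show False using N that by (simp add: positive_cone_def)
  qed
  have "g \<in> ?N \<or> inv g \<in> ?N" using N g by (auto simp: positive_cone_def)
  then have "Q ?N \<noteq> Q ?N'" using g notboth[OF g(1)] unfolding Q_def by force
  then have "cone_order G (Q ?N) \<noteq> cone_order G (Q ?N')"
    using positive_elements_cone_order[OF Q(1)] positive_elements_cone_order[OF Q(2)] by metis
  then show ?thesis using nb[OF Q(1)] nb[OF Q(2)] by blast
qed

fun (in plain_group) group_letter :: "(nat \<Rightarrow> 'g) \<Rightarrow> bool \<times> nat \<Rightarrow> 'g" where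
  "group_letter c (b, i) = (if b then c i else inv (c i))"

primrec (in plain_group) group_word :: "(nat \<Rightarrow> 'g) \<Rightarrow> (bool \<times> nat) list \<Rightarrow> 'g" where
  "group_word c [] = \<one>"
| "group_word c (l # u) = group_letter c l \<otimes> group_word c u"

lemma (in plain_group) group_letter_closed: "(\<And>i. c i \<in> carrier G) \<Longrightarrow> group_letter c l \<in> carrier G"
  by (cases l) auto

lemma (in plain_group) group_word_closed: "(\<And>i. c i \<in> carrier G) \<Longrightarrow> group_word c u \<in> carrier G"
  by (induction u) (auto simp: group_letter_closed)

lemma (in plain_group) group_word_append:
  "(\<And>i. c i \<in> carrier G) \<Longrightarrow> group_word c (u @ v) = group_word c u \<otimes> group_word c v"
  by (induction u) (auto simp: group_word_closed group_letter_closed m_assoc)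

lemma (in plain_group) group_word_power:
  "(\<And>i. c i \<in> carrier G) \<Longrightarrow> group_word c (concat (replicate i u)) = group_word c u [^] i"
proof (induction i)
  case (Suc i)
  then have "group_word c (concat (replicate (Suc i) u)) = group_word c u \<otimes> group_word c u [^] i"
    by (simp add: group_word_append)
  then show ?case using nat_pow_Suc2[OF group_word_closed[OF Suc(2)]] by simp
qed simp

lemma (in plain_group) group_word_single: "group_word c [l] = group_letter c l" if "\<And>i. c i \<in> carrier G"
  using group_letter_closed[of c, OF that] by simp

section \<open>Free groups and amalgams\<close>

subsection \<open>Words in a free group\<close>

abbreviation free_words :: "nat \<Rightarrow> (bool \<times> nat) list set" where
  "free_words n \<equiv> lists (UNIV \<times> {..<n})"

abbreviation free_rels :: "nat \<Rightarrow> ((bool \<times> nat) list \<times> (bool \<times> nat) list) set" where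
  "free_rels n \<equiv> {([(b, x), (\<not> b, x)], []) | b x. x \<in> {..<n}}"

lemma word_map_cong:
  assumes t: "\<And>i. bij (t i)" and "word_cong S (free_rels n) u v"
  shows "word_map t u = word_map t v"
  using assms(2)
proof (induction rule: word_cong.induct)
  case (rel u v p q)
  then obtain b x where uv: "u = [(b, x), (\<not> b, x)]" "v = []" by auto
  have "word_map t u z = z" for z
    using t[of x] by (cases b) (simp_all add: uv bij_is_inj bij_is_surj surj_f_inv_f)
  then show ?case by (simp add: fun_eq_iff word_map_append uv)
qed auto

text \<open>
  Expresses that \<open>F\<close> is free of rank \<open>n\<close> through an evaluation of words, independently of the
  isomorphism with the presented group by which freeness is given.
\<close>

definition word_eval :: "'a monoid \<Rightarrow> nat \<Rightarrow> ((bool \<times> nat) list \<Rightarrow> 'a) \<Rightarrow> bool" where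
  "word_eval F n ev \<longleftrightarrow> group F \<and> ev ` free_words n = carrier F \<and> ev [] = \<one>\<^bsub>F\<^esub> \<and>
     (\<forall>u\<in>free_words n. \<forall>v\<in>free_words n. ev (u @ v) = ev u \<otimes>\<^bsub>F\<^esub> ev v \<and>
        (ev u = ev v \<longleftrightarrow> word_cong (UNIV \<times> {..<n}) (free_rels n) u v))"

lemma free_group_word_eval:
  assumes "free_group_of_rank F n" obtains ev where "word_eval F n ev"
proof -
  let ?P = "free_group {..<n}" and ?S = "UNIV \<times> {..<n}" and ?c = "word_class (UNIV \<times> {..<n}) (free_rels n)"
  interpret F: group F using assms by (simp add: free_group_of_rank_def)
  interpret P: group ?P by (rule group_free_group)
  have P: "?P = presented_monoid ?S (free_rels n)" by (simp add: free_group_def)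
  obtain \<phi> where "\<phi> \<in> iso F ?P" using assms by (auto simp: free_group_of_rank_def is_iso_def)
  then have psi: "inv_into (carrier F) \<phi> \<in> iso ?P F" by (rule F.iso_set_sym)
  let ?psi = "inv_into (carrier F) \<phi>"
  have psi_hom: "?psi \<in> hom ?P F" and psi_bij: "bij_betw ?psi (carrier ?P) (carrier F)"
    using psi by (auto simp: iso_def)
  have carP: "carrier ?P = ?c ` free_words n" by (simp add: P presented_monoid_def)
  have "word_eval F n (\<lambda>u. ?psi (?c u))"
    unfolding word_eval_def
  proof (intro conjI ballI)
    show "group F" by (rule F.is_group)
    show "(\<lambda>u. ?psi (?c u)) ` free_words n = carrier F"
      using psi_bij unfolding carP bij_betw_def by (simp add: image_image)
    have "?c [] = \<one>\<^bsub>?P\<^esub>" by (simp add: P presented_monoid_def)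
    then show "?psi (?c []) = \<one>\<^bsub>F\<^esub>" using hom_one[OF psi_hom P.is_group F.is_group] by simp
    fix u v assume u: "u \<in> free_words n" and v: "v \<in> free_words n"
    have c: "?c u \<in> carrier ?P" "?c v \<in> carrier ?P" using u v carP by auto
    have "?c (u @ v) = ?c u \<otimes>\<^bsub>?P\<^esub> ?c v"
      unfolding P by (rule presented_monoid_mult[OF u v, symmetric])
    then show "?psi (?c (u @ v)) = ?psi (?c u) \<otimes>\<^bsub>F\<^esub> ?psi (?c v)"
      using hom_mult[OF psi_hom c] by simp
    have "?psi (?c u) = ?psi (?c v) \<longleftrightarrow> ?c u = ?c v"
      by (rule inj_on_eq_iff[OF bij_betw_imp_inj_on[OF psi_bij] c])
    then show "?psi (?c u) = ?psi (?c v) \<longleftrightarrow> word_cong ?S (free_rels n) u v"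
      using word_class_eq_iff[OF u] by simp
  qed
  then show thesis by (rule that)
qed

lemma word_eval_in_carrier: "word_eval F n ev \<Longrightarrow> u \<in> free_words n \<Longrightarrow> ev u \<in> carrier F"
  unfolding word_eval_def by blast

lemma word_eval_append:
  "word_eval F n ev \<Longrightarrow> u \<in> free_words n \<Longrightarrow> v \<in> free_words n \<Longrightarrow> ev (u @ v) = ev u \<otimes>\<^bsub>F\<^esub> ev v"
  unfolding word_eval_def by blast

lemma word_eval_eq_iff:
  "word_eval F n ev \<Longrightarrow> u \<in> free_words n \<Longrightarrow> v \<in> free_words n \<Longrightarrow>
    ev u = ev v \<longleftrightarrow> word_cong (UNIV \<times> {..<n}) (free_rels n) u v"
  unfolding word_eval_def by blast

lemma word_eval_surj:
  assumes "word_eval F n ev" "x \<in> carrier F" obtains u where "u \<in> free_words n" "ev u = x"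
proof -
  have "x \<in> ev ` free_words n" using assms unfolding word_eval_def by simp
  then show thesis using that by (elim imageE) simp
qed

lemma word_eval_word_map:
  assumes "word_eval F n ev" "\<And>i. bij (t i)" "u \<in> free_words n" "v \<in> free_words n" "ev u = ev v"
  shows "word_map t u = word_map t v"
proof -
  have "word_cong (UNIV \<times> {..<n}) (free_rels n) u v" using word_eval_eq_iff[OF assms(1,3,4)] assms(5) by blast
  then show ?thesis by (rule word_map_cong[OF assms(2)])
qed

text \<open>
  A shortest word for an element is reduced.
\<close>

lemma word_eval_reduced:
  assumes ev: "word_eval F n ev" and x: "x \<in> carrier F" "x \<noteq> \<one>\<^bsub>F\<^esub>"
  obtains u where "u \<in> free_words n" "ev u = x" "reduced u" "u \<noteq> []"
proof -
  let ?Q = "\<lambda>u. u \<in> free_words n \<and> ev u = x"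
  obtain u0 where "?Q u0" using word_eval_surj[OF ev x(1)] by metis
  then obtain u where u: "?Q u" "\<And>v. ?Q v \<Longrightarrow> length u \<le> length v"
    using ex_has_least_nat[of ?Q u0 length] by blast
  have "reduced u"
    unfolding reduced_def
  proof (intro allI notI)
    fix p q b i assume eq: "u = p @ (b, i) # (\<not> b, i) # q"
    then have i: "i < n" and pq: "p @ q \<in> free_words n" using u(1) by auto
    have "word_cong (UNIV \<times> {..<n}) (free_rels n) (p @ [(b, i), (\<not> b, i)] @ q) (p @ [] @ q)"
      by (rule word_cong.rel) (use i pq in auto)
    then have "ev u = ev (p @ q)"
      unfolding word_eval_eq_iff[OF ev conjunct1[OF u(1)] pq] by (simp only: eq append_Cons append_Nil)
    then show False using u(1) u(2)[of "p @ q"] pq eq by simp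
  qed
  moreover have "u \<noteq> []" using u(1) x(2) ev unfolding word_eval_def by auto
  ultimately show thesis using that u(1) by blast
qed

text \<open>
  The choice of the word is immaterial, since words with equal values act equally
  (\<open>word_eval_word_map\<close>).
\<close>

definition free_action :: "nat \<Rightarrow> ((bool \<times> nat) list \<Rightarrow> 'a) \<Rightarrow> (nat \<Rightarrow> 'x \<Rightarrow> 'x) \<Rightarrow> 'a \<Rightarrow> 'x \<Rightarrow> 'x" where
  "free_action n ev t x = word_map t (SOME u. u \<in> free_words n \<and> ev u = x)"

lemma free_action_word:
  assumes "word_eval F n ev" "\<And>i. bij (t i)" "u \<in> free_words n"
  shows "free_action n ev t (ev u) = word_map t u"
proof -
  have "\<exists>v. v \<in> free_words n \<and> ev v = ev u" using assms(3) by blast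
  note v = conjunct1[OF someI_ex[OF this]] conjunct2[OF someI_ex[OF this]]
  show ?thesis
    unfolding free_action_def by (rule word_eval_word_map[OF assms(1,2) v(1) assms(3) v(2)])
qed

lemma free_action_mult:
  assumes ev: "word_eval F n ev" and t: "\<And>i. bij (t i)" and x: "x \<in> carrier F" and y: "y \<in> carrier F"
  shows "free_action n ev t (x \<otimes>\<^bsub>F\<^esub> y) v = free_action n ev t x (free_action n ev t y v)"
proof -
  obtain u1 where u1: "u1 \<in> free_words n" "ev u1 = x" using word_eval_surj[OF ev x] .
  obtain u2 where u2: "u2 \<in> free_words n" "ev u2 = y" using word_eval_surj[OF ev y] .
  have u12: "u1 @ u2 \<in> free_words n" using u1 u2 by simp
  have "x \<otimes>\<^bsub>F\<^esub> y = ev (u1 @ u2)" using word_eval_append[OF ev u1(1) u2(1)] u1 u2 by simp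
  then show ?thesis
    using free_action_word[OF ev t u12] free_action_word[OF ev t u1(1)] free_action_word[OF ev t u2(1)] u1 u2
    by (simp add: word_map_append)
qed

lemma free_action_one:
  assumes ev: "word_eval F n ev" and t: "\<And>i. bij (t i)" shows "free_action n ev t \<one>\<^bsub>F\<^esub> v = v"
  using free_action_word[OF ev t, of "[]"] ev by (simp add: word_eval_def)

lemma word_eval_inverse:
  assumes ev: "word_eval F k ev" and i: "i < k"
  shows "ev [(False, i)] \<otimes>\<^bsub>F\<^esub> ev [(True, i)] = \<one>\<^bsub>F\<^esub>"
proof -
  have w: "[(False, i)] \<in> free_words k" "[(True, i)] \<in> free_words k" "[(False, i), (True, i)] \<in> free_words k"
    using i by auto
  have "([(False, i), (\<not> False, i)], []) \<in> free_rels k" using i by blast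
  then have "word_cong (UNIV \<times> {..<k}) (free_rels k) ([] @ [(False, i), (\<not> False, i)] @ []) ([] @ [] @ [])"
    by (rule word_cong.rel) (use i in auto)
  then have "ev [(False, i), (True, i)] = ev []"
    using word_eval_eq_iff[OF ev w(3), of "[]"] by simp
  then show ?thesis using word_eval_append[OF ev w(1,2)] ev by (simp add: word_eval_def)
qed

text \<open>
  Padding the generators with the neutral element makes the family total, so that no index
  bounds are needed when it is used.
\<close>

definition (in plain_group) basis_image :: "('f \<Rightarrow> 'g) \<Rightarrow> ((bool \<times> nat) list \<Rightarrow> 'f) \<Rightarrow> nat \<Rightarrow> nat \<Rightarrow> 'g" where
  "basis_image j ev k i = (if i < k then j (ev [(True, i)]) else \<one>)"

lemma (in plain_group) hom_word_eval:
  fixes F :: "'f monoid"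
  assumes ev: "word_eval F k ev" and j: "j \<in> hom F G" and u: "u \<in> free_words k"
  shows "j (ev u) = group_word (basis_image j ev k) u"
proof -
  have "group F" using ev by (simp add: word_eval_def)
  then have one: "j \<one>\<^bsub>F\<^esub> = \<one>" using j by (intro hom_one is_group)
  have letter: "j (ev [l]) = group_letter (basis_image j ev k) l" if lw: "[l] \<in> free_words k" for l
  proof -
    obtain s i where l: "l = (s, i)" "i < k" using lw by auto
    have w: "[(False, i)] \<in> free_words k" "[(True, i)] \<in> free_words k" using l by auto
    note c = word_eval_in_carrier[OF ev w(1)] word_eval_in_carrier[OF ev w(2)]
    have "j (ev [(False, i)]) \<otimes> j (ev [(True, i)]) = \<one>"
      using hom_mult[OF j c] word_eval_inverse[OF ev l(2)] one by simp
    then have "inv (j (ev [(True, i)])) = j (ev [(False, i)])"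
      using hom_in_carrier[OF j c(2)] hom_in_carrier[OF j c(1)] by (rule inv_equality)
    then show ?thesis using l by (auto simp: basis_image_def)
  qed
  show ?thesis
    using u
  proof (induction u)
    case Nil
    then show ?case using ev one by (simp add: word_eval_def)
  next
    case (Cons l u)
    have lw: "[l] \<in> free_words k" and uw: "u \<in> free_words k" using Cons by auto
    note c = word_eval_in_carrier[OF ev lw] word_eval_in_carrier[OF ev uw]
    have "ev (l # u) = ev [l] \<otimes>\<^bsub>F\<^esub> ev u" using word_eval_append[OF ev lw uw] by simp
    then show ?case using hom_mult[OF j c] Cons.IH letter[OF lw] by simp
  qed
qed

lemma (in plain_group) basis_image_closed:
  fixes F :: "'f monoid"
  assumes "word_eval F k ev" "j \<in> hom F G" shows "basis_image j ev k i \<in> carrier G"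
  using hom_in_carrier[OF assms(2) word_eval_in_carrier[OF assms(1), of "[(True, i)]"]]
  by (auto simp: basis_image_def)

subsection \<open>Amalgams\<close>

definition amalgam_letter ::
  "'a monoid \<Rightarrow> 'a \<Rightarrow> 'b monoid \<Rightarrow> 'b \<Rightarrow> 'a + 'b \<Rightarrow> ('a + 'b) list set" where
  "amalgam_letter A a B b l = word_class (carrier A <+> carrier B)
     (amalgam_rels A (generate A {a}) (cyclic_map A a B b) B) [l]"

locale amalgam =
  fixes A :: "'a monoid" and a :: 'a and B :: "'b monoid" and b :: 'b
  assumes A: "group A" and B: "group B" and a: "a \<in> carrier A" and b: "b \<in> carrier B"
begin

sublocale A: group A by (rule A)
sublocale B: group B by (rule B)

abbreviation "S \<equiv> carrier A <+> carrier B"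
abbreviation "R \<equiv> amalgam_rels A (generate A {a}) (cyclic_map A a B b) B"
abbreviation "G \<equiv> cyclic_amalgam A a B b"
abbreviation "j1 x \<equiv> amalgam_letter A a B b (Inl x)"
abbreviation "j2 y \<equiv> amalgam_letter A a B b (Inr y)"

lemma group_G: "group G"
  unfolding cyclic_amalgam_def by (rule group_amalgamated_product[OF A B])

sublocale G: plain_group G
  by (intro plain_group.intro group_G)

lemma G_eq: "G = presented_monoid S R"
  by (simp add: cyclic_amalgam_def amalgamated_product_def)

lemma carrier_G: "carrier G = word_class S R ` lists S" and one_G: "\<one>\<^bsub>G\<^esub> = word_class S R []"
  by (simp_all add: G_eq presented_monoid_def)

lemma mult_G: "u \<in> lists S \<Longrightarrow> v \<in> lists S \<Longrightarrow>
    word_class S R u \<otimes>\<^bsub>G\<^esub> word_class S R v = word_class S R (u @ v)"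
  unfolding G_eq by (rule presented_monoid_mult)

lemma generated_element:
  assumes "generate A {a} = {a [^]\<^bsub>A\<^esub> (k::int) | k. k \<in> UNIV}" "x \<in> generate A {a}"
  obtains k :: int where "x = a [^]\<^bsub>A\<^esub> k" "cyclic_map A a B b x = b [^]\<^bsub>B\<^esub> k"
proof -
  have "\<exists>k::int. x = a [^]\<^bsub>A\<^esub> k" using assms by auto
  from someI_ex[OF this] show thesis using that unfolding cyclic_map_def by blast
qed

lemma generate_cyclic: "generate A {a} = {a [^]\<^bsub>A\<^esub> (k::int) | k. k \<in> UNIV}"
  by (rule A.generate_pow[OF a])

lemma rels_in_lists:
  assumes "(u, v) \<in> R" shows "u \<in> lists S \<and> v \<in> lists S"
proof -
  have gen: "x \<in> carrier A \<and> cyclic_map A a B b x \<in> carrier B" if "x \<in> generate A {a}" for x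
    using generated_element[OF generate_cyclic that] a b by (metis A.int_pow_closed B.int_pow_closed)
  then show ?thesis using assms by (auto simp: amalgam_rels_def)
qed

lemma class_rel: "(u, v) \<in> R \<Longrightarrow> word_class S R u = word_class S R v"
  using word_cong.rel[of u v R "[]" "[]" S] rels_in_lists[of u v] word_class_eq_iff[of u S R v] by simp

lemma j1_carrier: "x \<in> carrier A \<Longrightarrow> j1 x \<in> carrier G"
  and j2_carrier: "y \<in> carrier B \<Longrightarrow> j2 y \<in> carrier G"
  by (auto simp: carrier_G amalgam_letter_def)

lemma j1_mult:
  assumes "x \<in> carrier A" "x' \<in> carrier A" shows "j1 (x \<otimes>\<^bsub>A\<^esub> x') = j1 x \<otimes>\<^bsub>G\<^esub> j1 x'"
proof -
  have "([Inl x, Inl x'], [Inl (x \<otimes>\<^bsub>A\<^esub> x')]) \<in> R" using assms by (auto simp: amalgam_rels_def)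
  from class_rel[OF this] show ?thesis using assms mult_G[of "[Inl x]" "[Inl x']"]
    by (auto simp: amalgam_letter_def)
qed

lemma j2_mult:
  assumes "x \<in> carrier B" "x' \<in> carrier B" shows "j2 (x \<otimes>\<^bsub>B\<^esub> x') = j2 x \<otimes>\<^bsub>G\<^esub> j2 x'"
proof -
  have "([Inr x, Inr x'], [Inr (x \<otimes>\<^bsub>B\<^esub> x')]) \<in> R" using assms by (auto simp: amalgam_rels_def)
  from class_rel[OF this] show ?thesis using assms mult_G[of "[Inr x]" "[Inr x']"]
    by (auto simp: amalgam_letter_def)
qed

lemma j1_hom: "j1 \<in> hom A G" and j2_hom: "j2 \<in> hom B G"
  by (auto simp: hom_def j1_carrier j2_carrier j1_mult j2_mult)

text \<open>
  The identification of the cyclic subgroups is given by choosing an exponent, so it is the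
  expected one as soon as \<open>a\<close> determines the exponent \<open>1\<close>, that is, if \<open>a\<close> has infinite order.
\<close>

lemma j1_eq_j2:
  assumes "\<And>k::int. a [^]\<^bsub>A\<^esub> k = a \<Longrightarrow> k = 1" shows "j1 a = j2 b"
proof -
  have gen: "a \<in> generate A {a}" by (rule generate.incl) simp
  obtain k :: int where k: "a = a [^]\<^bsub>A\<^esub> k" "cyclic_map A a B b a = b [^]\<^bsub>B\<^esub> k"
    using generated_element[OF generate_cyclic gen] .
  then have "k = 1" using assms[of k] by simp
  then have "cyclic_map A a B b a = b" using k(2) b by simp
  moreover have "([Inl a], [Inr (cyclic_map A a B b a)]) \<in> R" using gen by (auto simp: amalgam_rels_def)
  ultimately show ?thesis using class_rel by (simp add: amalgam_letter_def)
qed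

lemma G_induct:
  assumes "g \<in> carrier G" "P \<one>\<^bsub>G\<^esub>"
    and "\<And>x g. x \<in> carrier A \<Longrightarrow> g \<in> carrier G \<Longrightarrow> P g \<Longrightarrow> P (j1 x \<otimes>\<^bsub>G\<^esub> g)"
    and "\<And>y g. y \<in> carrier B \<Longrightarrow> g \<in> carrier G \<Longrightarrow> P g \<Longrightarrow> P (j2 y \<otimes>\<^bsub>G\<^esub> g)"
  shows "P g"
proof -
  have "P (word_class S R u)" if "u \<in> lists S" for u
    using that
  proof (induction u)
    case (Cons l u)
    have "word_class S R (l # u) = amalgam_letter A a B b l \<otimes>\<^bsub>G\<^esub> word_class S R u"
      using Cons mult_G[of "[l]" u] by (simp add: amalgam_letter_def)
    moreover have c: "word_class S R u \<in> carrier G" unfolding carrier_G using Cons by blast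
    moreover have "l \<in> S" "P (word_class S R u)" using Cons by auto
    ultimately show ?case using assms(3)[OF _ c] assms(4)[OF _ c] by (auto elim!: PlusE)
  qed (use assms(2) one_G in simp)
  then show ?thesis using assms(1) carrier_G by auto
qed

text \<open>
  The universal property of the amalgam, for actions: the words over both carriers act letter
  by letter, and the defining relations hold because the two actions agree on all powers of
  the amalgamated element.
\<close>

lemma amalgam_action:
  fixes Z :: "'x::linorder set"
  assumes \<alpha>: "set_action A Z \<alpha>" and \<beta>: "set_action B Z \<beta>" and ab: "\<And>v. v \<in> Z \<Longrightarrow> \<alpha> a v = \<beta> b v"
  obtains \<gamma> where "set_action G Z \<gamma>"
    "\<And>x v. x \<in> carrier A \<Longrightarrow> v \<in> Z \<Longrightarrow> \<gamma> (j1 x) v = \<alpha> x v"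
    "\<And>y v. y \<in> carrier B \<Longrightarrow> v \<in> Z \<Longrightarrow> \<gamma> (j2 y) v = \<beta> y v"
proof -
  note \<alpha>' = set_actionD[OF \<alpha>] and \<beta>' = set_actionD[OF \<beta>]
  \<comment> \<open>agreement on the amalgamated element extends to its inverse and to all powers\<close>
  have inv_l: "\<alpha> (inv\<^bsub>A\<^esub> a) v = \<beta> (inv\<^bsub>B\<^esub> b) v" if v: "v \<in> Z" for v
  proof -
    let ?z = "\<beta> (inv\<^bsub>B\<^esub> b) v"
    have z: "?z \<in> Z" using \<beta>'(2)[of "inv\<^bsub>B\<^esub> b" v] b v by simp
    have "\<alpha> a ?z = \<beta> b ?z" by (rule ab[OF z])
    also have "\<dots> = v" using \<beta>'(3)[of b "inv\<^bsub>B\<^esub> b" v] \<beta>'(1)[OF v] b v by simp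
    finally have "\<alpha> (inv\<^bsub>A\<^esub> a) v = \<alpha> (inv\<^bsub>A\<^esub> a) (\<alpha> a ?z)" by simp
    also have "\<dots> = ?z" using \<alpha>'(3)[of "inv\<^bsub>A\<^esub> a" a ?z] \<alpha>'(1)[OF z] a z by simp
    finally show ?thesis .
  qed
  have pow: "\<alpha> (a [^]\<^bsub>A\<^esub> k) v = \<beta> (b [^]\<^bsub>B\<^esub> k) v" if v: "v \<in> Z" for k :: int and v
    using v
  proof (induction k arbitrary: v rule: int_induct[where k = 0])
    case base
    then show ?case using \<alpha>'(1) \<beta>'(1) by simp
  next
    case (step1 i)
    have "a [^]\<^bsub>A\<^esub> (i + 1) = a [^]\<^bsub>A\<^esub> i \<otimes>\<^bsub>A\<^esub> a" "b [^]\<^bsub>B\<^esub> (i + 1) = b [^]\<^bsub>B\<^esub> i \<otimes>\<^bsub>B\<^esub> b"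
      using A.int_pow_mult[OF a, of i 1] B.int_pow_mult[OF b, of i 1] a b by simp_all
    then show ?case using step1 \<alpha>'(2,3) \<beta>'(2,3) ab a b by simp
  next
    case (step2 i)
    have "a [^]\<^bsub>A\<^esub> (i - 1) = a [^]\<^bsub>A\<^esub> i \<otimes>\<^bsub>A\<^esub> inv\<^bsub>A\<^esub> a" "b [^]\<^bsub>B\<^esub> (i - 1) = b [^]\<^bsub>B\<^esub> i \<otimes>\<^bsub>B\<^esub> inv\<^bsub>B\<^esub> b"
      using A.int_pow_mult[OF a, of i "- 1"] B.int_pow_mult[OF b, of i "- 1"] a b
      by (simp_all add: A.int_pow_neg B.int_pow_neg)
    then show ?case using step2 \<alpha>'(2,3) \<beta>'(2,3) inv_l a b by simp
  qed
  \<comment> \<open>the action of words over both carriers, which respects the relations\<close>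
  define act where "act u v = foldr (case_sum \<alpha> \<beta>) u v" for u v
  have act_Z: "act u v \<in> Z" if "u \<in> lists S" "v \<in> Z" for u v
    using that \<alpha>'(2) \<beta>'(2) by (induction u) (auto simp: act_def)
  have act_app: "act (u @ u') v = act u (act u' v)" for u u' v by (simp add: act_def)
  have act_mono: "act u v < act u v'" if "u \<in> lists S" "v \<in> Z" "v' \<in> Z" "v < v'" for u v v'
    using that
  proof (induction u)
    case (Cons l u)
    then have "act u v < act u v'" "act u v \<in> Z" "act u v' \<in> Z" using act_Z by auto
    moreover have "l \<in> S" using Cons by auto
    ultimately show ?case using \<alpha>'(4) \<beta>'(4) by (auto simp: act_def elim!: PlusE)
  qed (simp add: act_def)
  have act_rel: "act u v = act u' v" if "(u, u') \<in> R" "v \<in> Z" for u u' v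
    using that(1) unfolding amalgam_rels_def
  proof (elim UnE)
    assume "(u, u') \<in> {([Inl h], [Inr (cyclic_map A a B b h)]) | h. h \<in> generate A {a}}"
    then obtain h where h: "u = [Inl h]" "u' = [Inr (cyclic_map A a B b h)]" "h \<in> generate A {a}" by auto
    obtain k :: int where "h = a [^]\<^bsub>A\<^esub> k" "cyclic_map A a B b h = b [^]\<^bsub>B\<^esub> k"
      using generated_element[OF generate_cyclic h(3)] .
    then show ?thesis using pow[OF that(2)] by (simp add: act_def h)
  qed (use that(2) \<alpha>' \<beta>' in \<open>auto simp: act_def\<close>)
  have act_cong: "act u v = act u' v" if "word_cong S R u u'" "v \<in> Z" for u u' v
    using that
  proof (induction arbitrary: v rule: word_cong.induct)
    case (rel u u' p q)
    then have "act q v \<in> Z" using act_Z by simp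
    then show ?case using act_rel[OF rel(1)] by (simp add: act_app)
  qed auto
  define \<gamma> where "\<gamma> X = act (SOME u. u \<in> lists S \<and> word_class S R u = X)" for X
  have \<gamma>: "\<gamma> (word_class S R u) v = act u v" if u: "u \<in> lists S" and v: "v \<in> Z" for u v
  proof -
    have "\<exists>u'. u' \<in> lists S \<and> word_class S R u' = word_class S R u" using u by blast
    note u' = conjunct1[OF someI_ex[OF this]] conjunct2[OF someI_ex[OF this]]
    show ?thesis
      unfolding \<gamma>_def by (rule act_cong[OF _ v]) (use u'(2) in \<open>simp only: word_class_eq_iff[OF u'(1)]\<close>)
  qed
  show thesis
  proof
    show "set_action G Z \<gamma>"
      unfolding set_action_def carrier_G one_G
      using \<gamma> act_Z act_mono by (auto simp: mult_G act_app) (simp add: act_def)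
    show "\<gamma> (j1 x) v = \<alpha> x v" if "x \<in> carrier A" "v \<in> Z" for x v
      using that \<gamma>[of "[Inl x]" v] by (auto simp add: amalgam_letter_def act_def)
    show "\<gamma> (j2 y) v = \<beta> y v" if "y \<in> carrier B" "v \<in> Z" for y v
      using that \<gamma>[of "[Inr y]" v] by (auto simp add: amalgam_letter_def act_def)
  qed
qed

end

section \<open>Actions of the amalgam with prescribed values\<close>

abbreviation single0 :: "real \<Rightarrow> (nat \<Rightarrow>\<^sub>0 real)" where "single0 \<equiv> Poly_Mapping.single 0"

lemma word_map_coordwise:
  fixes t :: "nat \<Rightarrow> real \<Rightarrow> real"
  assumes t: "\<And>i. order_aut (t i)" and t0: "\<And>i. t i 0 = 0"
  shows "word_map (\<lambda>i. coordwise (t i)) u p = coordwise (word_map t u) (p :: nat \<Rightarrow>\<^sub>0 real)"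
proof (induction u)
  case Nil
  then show ?case by (simp add: coordwise_id)
next
  case (Cons l u)
  obtain b i where l: "l = (b, i)" by (cases l)
  have "letter_map (\<lambda>i. coordwise (t i)) l q = coordwise (letter_map t l) q" for q :: "nat \<Rightarrow>\<^sub>0 real"
    by (simp add: l finv_coordwise[OF t t0])
  moreover have "word_map t u 0 = 0" "letter_map t l 0 = 0"
    using word_map_fixed[of t 0 u] letter_map_fixed[of t 0 l] t t0 by simp_all
  ultimately show ?case using Cons by (simp add: coordwise_comp)
qed

definition line_action :: "real \<Rightarrow> (nat \<Rightarrow> real \<Rightarrow> real) \<Rightarrow> bool" where
  "line_action T t \<longleftrightarrow> 0 < T \<and> (\<forall>i. order_aut (t i) \<and> t i 0 = 0 \<and> t i T = T \<and> t i (- T) = - T)"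

text \<open>
  With fewer directions of motion on the line, the induced map on sequences would not be
  mixing either.
\<close>

definition both_ways :: "real \<Rightarrow> (real \<Rightarrow> real) \<Rightarrow> bool" where
  "both_ways T f \<longleftrightarrow> (\<exists>x\<in>{- T..T}. x < f x) \<and> (\<exists>x\<in>{- T..T}. f x < x)"

lemma free_set_action:
  assumes ev: "word_eval F n ev" and t: "line_action T t" and S: "\<And>i. t i ` S = S"
  shows "set_action F (seqs S) (free_action n ev (\<lambda>i. coordwise (t i)))"
proof -
  have t': "order_aut (t i)" "t i 0 = 0" for i using t by (auto simp: line_action_def)
  have om: "order_aut (coordwise (t i) :: (nat \<Rightarrow>\<^sub>0 real) \<Rightarrow> _)" for i by (rule order_aut_coordwise[OF t'])
  then have bm: "bij (coordwise (t i) :: (nat \<Rightarrow>\<^sub>0 real) \<Rightarrow> _)" for i by (simp add: order_aut_def)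
  have im: "coordwise (t i) ` seqs S = seqs S" for i by (rule coordwise_seqs[OF t' S])
  have wi: "word_map (\<lambda>i. coordwise (t i)) u ` seqs S = seqs S" for u
    by (rule word_map_image[where t = "\<lambda>i. coordwise (t i)", OF om im])
  have wo: "order_aut (word_map (\<lambda>i. coordwise (t i)) u :: (nat \<Rightarrow>\<^sub>0 real) \<Rightarrow> _)" for u
    by (rule order_aut_word_map[where t = "\<lambda>i. coordwise (t i)", OF om])
  note fw = free_action_word[where t = "\<lambda>i. coordwise (t i)", OF ev bm]
  show ?thesis
    unfolding set_action_def
  proof (intro conjI ballI impI)
    fix v assume v: "v \<in> seqs S"
    show "free_action n ev (\<lambda>i. coordwise (t i)) \<one>\<^bsub>F\<^esub> v = v"
      by (rule free_action_one[where t = "\<lambda>i. coordwise (t i)", OF ev bm])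
    fix g assume g: "g \<in> carrier F"
    obtain u where u: "u \<in> free_words n" "ev u = g" using word_eval_surj[OF ev g] .
    show "free_action n ev (\<lambda>i. coordwise (t i)) g v \<in> seqs S"
      using fw[OF u(1)] wi[of u] v u(2) by auto
    show "free_action n ev (\<lambda>i. coordwise (t i)) (g \<otimes>\<^bsub>F\<^esub> h) v =
        free_action n ev (\<lambda>i. coordwise (t i)) g (free_action n ev (\<lambda>i. coordwise (t i)) h v)" if "h \<in> carrier F" for h
      by (rule free_action_mult[where t = "\<lambda>i. coordwise (t i)", OF ev bm g that])
    show "free_action n ev (\<lambda>i. coordwise (t i)) g v < free_action n ev (\<lambda>i. coordwise (t i)) g v'" if "v < v'" for v'
      using fw[OF u(1)] u(2) order_aut_less_iff[OF wo[of u]] that by simp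
  qed
qed

lemma set_action_transport:
  assumes \<beta>: "set_action B Y \<beta>" and h: "bij_betw h Z Y"
    and mono: "\<And>x y. x \<in> Z \<Longrightarrow> y \<in> Z \<Longrightarrow> h x < h y \<longleftrightarrow> x < y"
  shows "set_action B Z (\<lambda>y v. inv_into Z h (\<beta> y (h v)))"
proof -
  note \<beta>' = set_actionD[OF \<beta>]
  have hZ: "h v \<in> Y" if "v \<in> Z" for v using that h by (auto simp: bij_betw_def)
  have iY: "inv_into Z h w \<in> Z" "h (inv_into Z h w) = w" if "w \<in> Y" for w
    using that h by (auto simp: bij_betw_def inv_into_into f_inv_into_f)
  have ih: "inv_into Z h (h v) = v" if "v \<in> Z" for v using that h by (simp add: bij_betw_def)
  show ?thesis
    unfolding set_action_def
  proof (intro conjI ballI impI)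
    fix v assume v: "v \<in> Z"
    show "inv_into Z h (\<beta> \<one>\<^bsub>B\<^esub> (h v)) = v" using \<beta>'(1)[OF hZ[OF v]] ih[OF v] by simp
    fix g assume g: "g \<in> carrier B"
    have gv: "\<beta> g (h v) \<in> Y" by (rule \<beta>'(2)[OF g hZ[OF v]])
    show "inv_into Z h (\<beta> g (h v)) \<in> Z" by (rule iY(1)[OF gv])
    show "inv_into Z h (\<beta> (g \<otimes>\<^bsub>B\<^esub> k) (h v)) =
        inv_into Z h (\<beta> g (h (inv_into Z h (\<beta> k (h v)))))" if k: "k \<in> carrier B" for k
      using iY(2)[OF \<beta>'(2)[OF k hZ[OF v]]] \<beta>'(3)[OF g k hZ[OF v]] by simp
    show "inv_into Z h (\<beta> g (h v)) < inv_into Z h (\<beta> g (h v'))" if v': "v' \<in> Z" "v < v'" for v'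
    proof -
      have gv': "\<beta> g (h v') \<in> Y" by (rule \<beta>'(2)[OF g hZ[OF v'(1)]])
      have "\<beta> g (h v) < \<beta> g (h v')" using \<beta>'(4)[OF g hZ[OF v] hZ[OF v'(1)]] mono[OF v v'(1)] v'(2) by simp
      then show ?thesis using mono[OF iY(1)[OF gv] iY(1)[OF gv']] iY(2)[OF gv] iY(2)[OF gv'] by simp
    qed
  qed
qed

locale free_amalgam = amalgam A a B b
  for A :: "'a monoid" and a and B :: "'b monoid" and b +
  fixes n m :: nat and ev1 ev2 u1 u2
  assumes ev1: "word_eval A n ev1" and ev2: "word_eval B m ev2"
    and u1: "u1 \<in> free_words n" "ev1 u1 = a" and u2: "u2 \<in> free_words m" "ev2 u2 = b"
begin

text \<open>
  Both factors act on sequences, and both maps for the amalgamated element are mixing there.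
  By \<open>mixing_isomorphic\<close> they are isomorphic, by an isomorphism that fixes the points of \<open>K\<close>
  because their orbits interleave in the same way on both sides. Conjugating the second action
  by it makes the two maps equal, so that the actions combine. Values of the first action at
  \<open>Y\<close> are kept throughout; those of the second are kept as long as they stay within \<open>K\<close>.
\<close>

lemma realization:
  assumes t1: "line_action T1 t1" and t2: "line_action T2 t2"
    and bw1: "both_ways T1 (word_map t1 u1)" and bw2: "both_ways T2 (word_map t2 u2)"
    and Y: "finite Y" "Y \<subseteq> {- T1..T1}" and K: "K \<subseteq> Y" "K \<subseteq> {- T2..T2}"
    and match: "orbit_matching (word_map t1 u1) (word_map t2 u2) (Id_on K)"
  obtains Z :: "(nat \<Rightarrow>\<^sub>0 real) set" and \<gamma> where "set_action G Z \<gamma>"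
    "\<And>y. y \<in> Y \<Longrightarrow> single0 y \<in> Z"
    "\<And>y u. y \<in> Y \<Longrightarrow> u \<in> free_words n \<Longrightarrow> \<gamma> (j1 (ev1 u)) (single0 y) = single0 (word_map t1 u y)"
    "\<And>y u. y \<in> K \<Longrightarrow> u \<in> free_words m \<Longrightarrow> word_map t2 u y \<in> K \<Longrightarrow>
       \<gamma> (j2 (ev2 u)) (single0 y) = single0 (word_map t2 u y)"
proof -
  let ?f = "word_map t1 u1" and ?g = "word_map t2 u2"
  have t1': "order_aut (t1 i)" "t1 i 0 = 0" "t1 i T1 = T1" "t1 i (- T1) = - T1" "0 < T1" for i
    using t1 by (auto simp: line_action_def)
  have t2': "order_aut (t2 i)" "t2 i 0 = 0" "t2 i T2 = T2" "t2 i (- T2) = - T2" "0 < T2" for i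
    using t2 by (auto simp: line_action_def)
  have finK: "finite K" using K Y finite_subset by blast
  obtain a1 b1 where ab1: "a1 \<in> {- T1..T1}" "a1 < ?f a1" "b1 \<in> {- T1..T1}" "?f b1 < b1"
    using bw1 by (auto simp: both_ways_def)
  obtain a2 b2 where ab2: "a2 \<in> {- T2..T2}" "a2 < ?g a2" "b2 \<in> {- T2..T2}" "?g b2 < b2"
    using bw2 by (auto simp: both_ways_def)
  have "countable (insert 0 Y)" "insert 0 Y \<subseteq> {- T1..T1}" "countable (insert 0 K)" "insert 0 K \<subseteq> {- T2..T2}"
    using Y K finK t1'(5) t2'(5) by (simp_all add: countable_finite)
  then obtain S1 S2 where S1: "insert 0 Y \<subseteq> S1" "\<And>i. t1 i ` S1 = S1" "mixing_on (seqs S1) (coordwise ?f)"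
    and S2: "insert 0 K \<subseteq> S2" "\<And>i. t2 i ` S2 = S2" "mixing_on (seqs S2) (coordwise ?g)"
    using mixing_from_line[of t1 T1 "insert 0 Y" a1 u1 b1, OF t1']
      mixing_from_line[of t2 T2 "insert 0 K" a2 u2 b2, OF t2'] ab1 ab2 by metis
  have z1: "0 \<in> S1" and z2: "0 \<in> S2" using S1(1) S2(1) by auto
  have sS1: "single0 y \<in> seqs S1" if "y \<in> Y" for y
    using that S1(1) z1 by (auto simp: seqs_def lookup_single when_def)
  have sS2: "single0 y \<in> seqs S2" if "y \<in> K" for y
    using that S2(1) z2 by (auto simp: seqs_def lookup_single when_def)
  let ?p = "(\<lambda>y. (single0 y, single0 y)) ` K"
  have f: "order_aut ?f" "?f 0 = 0" and g: "order_aut ?g" "?g 0 = 0"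
    using order_aut_word_map[of t1 u1] order_aut_word_map[of t2 u2]
      word_map_fixed[of t1 0 u1] word_map_fixed[of t2 0 u2] t1' t2' by auto
  have zs: "zpow (coordwise q) k (single0 y) = single0 (zpow q k y)" if "order_aut q" "q 0 = 0" for q k y
    using zpow_coordwise[OF that] coordwise_single[of "zpow q k"] zpow_fixed[OF that] by simp
  have p1: "orbit_matching (coordwise ?f) (coordwise ?g) ?p"
    unfolding orbit_matching_def
  proof (clarify)
    fix k y y' assume y: "y \<in> K" "y' \<in> K"
    then have "(y, y) \<in> Id_on K" "(y', y') \<in> Id_on K" by auto
    from orbit_matchingD[OF match this]
    show "zpow (coordwise ?f) k (single0 y) < single0 y' \<longleftrightarrow> zpow (coordwise ?g) k (single0 y) < single0 y'"
      unfolding zs[OF f] zs[OF g] single_less_iff .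
  qed
  have p2: "finite ?p" using finK by simp
  have p3: "?p \<subseteq> seqs S1 \<times> seqs S2" using sS1 sS2 K(1) by auto
  obtain h where h: "bij_betw h (seqs S1) (seqs S2)"
      "\<And>x y. x \<in> seqs S1 \<Longrightarrow> y \<in> seqs S1 \<Longrightarrow> h x < h y \<longleftrightarrow> x < y"
      "\<And>x. x \<in> seqs S1 \<Longrightarrow> h (coordwise ?f x) = coordwise ?g (h x)" "\<And>x x'. (x, x') \<in> ?p \<Longrightarrow> h x = x'"
    by (rule mixing_isomorphic[OF S1(3) S2(3) p1 p2 p3]) (rule that)
  have hK: "h (single0 y) = single0 y" if "y \<in> K" for y
    by (rule h(4)) (use that in blast)
  let ?\<alpha> = "free_action n ev1 (\<lambda>i. coordwise (t1 i))" and ?actB = "free_action m ev2 (\<lambda>i. coordwise (t2 i))"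
  let ?conjB = "\<lambda>y v. inv_into (seqs S1) h (?actB y (h v))"
  have bm1: "bij (coordwise (t1 i) :: (nat \<Rightarrow>\<^sub>0 real) \<Rightarrow> _)" and bm2: "bij (coordwise (t2 i) :: (nat \<Rightarrow>\<^sub>0 real) \<Rightarrow> _)" for i
    using order_aut_coordwise[OF t1'(1,2)] order_aut_coordwise[OF t2'(1,2)] by (simp_all add: order_aut_def)
  have w1: "?\<alpha> (ev1 u) v = coordwise (word_map t1 u) v" if "u \<in> free_words n" for u and v :: "nat \<Rightarrow>\<^sub>0 real"
    using free_action_word[where t = "\<lambda>i. coordwise (t1 i)", OF ev1 bm1 that] word_map_coordwise[of t1, OF t1'(1,2)] by simp
  have w2: "?actB (ev2 u) v = coordwise (word_map t2 u) v" if "u \<in> free_words m" for u and v :: "nat \<Rightarrow>\<^sub>0 real"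
    using free_action_word[where t = "\<lambda>i. coordwise (t2 i)", OF ev2 bm2 that] word_map_coordwise[of t2, OF t2'(1,2)] by simp
  have ih: "inv_into (seqs S1) h (h v) = v" if "v \<in> seqs S1" for v
    using that h(1) by (simp add: bij_betw_def)
  have ident: "?\<alpha> a v = ?conjB b v" if v: "v \<in> seqs S1" for v
  proof -
    have "coordwise ?f v \<in> seqs S1" using S1(3) v by (auto simp: mixing_on_def)
    then show ?thesis using w1[OF u1(1)] w2[OF u2(1)] u1(2) u2(2) h(3)[OF v] ih[of "coordwise ?f v"] by simp
  qed
  have actA: "set_action A (seqs S1) ?\<alpha>" by (rule free_set_action[OF ev1 t1 S1(2)])
  have actB: "set_action B (seqs S1) ?conjB"
    by (rule set_action_transport[OF free_set_action[OF ev2 t2 S2(2)] h(1)]) (rule h(2))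
  obtain \<gamma> where \<gamma>: "set_action G (seqs S1) \<gamma>"
    "\<And>x v. x \<in> carrier A \<Longrightarrow> v \<in> seqs S1 \<Longrightarrow> \<gamma> (j1 x) v = ?\<alpha> x v"
    "\<And>y v. y \<in> carrier B \<Longrightarrow> v \<in> seqs S1 \<Longrightarrow> \<gamma> (j2 y) v = ?conjB y v"
    by (rule amalgam_action[OF actA actB]) (rule ident, assumption, rule that)
  show thesis
  proof (rule that[OF \<gamma>(1)])
    show "single0 y \<in> seqs S1" if "y \<in> Y" for y by (rule sS1[OF that])
    show "\<gamma> (j1 (ev1 u)) (single0 y) = single0 (word_map t1 u y)" if y: "y \<in> Y" and u: "u \<in> free_words n" for y u
      using \<gamma>(2)[OF word_eval_in_carrier[OF ev1 u] sS1[OF y]] w1[OF u]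
        coordwise_single[of "word_map t1 u"] word_map_fixed[of t1 0 u] t1'(1,2) by simp
    show "\<gamma> (j2 (ev2 u)) (single0 y) = single0 (word_map t2 u y)"
      if y: "y \<in> K" and u: "u \<in> free_words m" and uy: "word_map t2 u y \<in> K" for y u
    proof -
      have yY: "y \<in> Y" "word_map t2 u y \<in> Y" using y uy K(1) by auto
      have "?actB (ev2 u) (h (single0 y)) = h (single0 (word_map t2 u y))"
        using w2[OF u] hK[OF y] hK[OF uy] coordwise_single[of "word_map t2 u"] word_map_fixed[of t2 0 u] t2'(1,2) by simp
      then show ?thesis
        using \<gamma>(3)[OF word_eval_in_carrier[OF ev2 u] sS1[OF yY(1)]] ih[OF sS1[OF yY(2)]] by simp
    qed
  qed
qed

end

section \<open>Elements that survive in the amalgam\<close>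

lemma zpow_eq_self:
  assumes f: "order_aut f" and x: "f x \<noteq> x" and k: "zpow f k x = x" shows "k = 0"
proof -
  have "zpow f (- k) x = x"
    using zpow_add[of f "- k" k x] k f by (simp add: order_aut_def)
  then have n: "\<not> zpow f k x < x" "\<not> zpow f (- k) x < x" using k by simp_all
  consider "x < f x" | "f x < x" using x by fastforce
  then show ?thesis
  proof cases
    case 1
    then show ?thesis using n unfolding zpow_mono_up[OF f 1] by simp
  next
    case 2
    then show ?thesis using n unfolding zpow_mono_down[OF f 2] by simp
  qed
qed

lemma word_map_odd:
  fixes t :: "nat \<Rightarrow> real \<Rightarrow> real"
  assumes "\<And>i. bij (t i)"
  shows "word_map (\<lambda>i x. - t i (- x)) u x = - word_map t u (- x)"
proof (induction u)
  case (Cons l u)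
  obtain b i where l: "l = (b, i)" by (cases l)
  have "finv (\<lambda>x. - t i (- x)) = (\<lambda>x. - finv (t i) (- x))"
    by (rule inv_unique_comp)
      (auto simp: fun_eq_iff bij_is_inj[OF assms] surj_f_inv_f[OF bij_is_surj[OF assms]])
  then show ?case using Cons by (simp add: l)
qed simp

lemma bij_odd: "bij (t :: real \<Rightarrow> real) \<Longrightarrow> bij (\<lambda>x. - t (- x))"
  by (rule o_bij[of "\<lambda>x. - finv t (- x)"])
    (auto simp: fun_eq_iff bij_is_inj surj_f_inv_f[OF bij_is_surj])

lemma both_ways_odd:
  assumes x: "x \<in> {- T..T}" and f: "f x \<noteq> x" "f (- x) = - f x"
  shows "both_ways T f"
proof -
  have "- x \<in> {- T..T}" using x by simp
  moreover consider "x < f x" "f (- x) < - x" | "f x < x" "- x < f (- x)" using f by fastforce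
  ultimately show ?thesis using x unfolding both_ways_def by cases blast+
qed

text \<open>
  A reduced word concerns only finitely many points of the line. Beyond all of them, at \<open>c\<close>,
  nothing is prescribed, so that there the first two generators can be given different values.
\<close>

lemma free_line_action:
  assumes red: "reduced u" "u \<noteq> []"
  obtains T and t :: "nat \<Rightarrow> real \<Rightarrow> real" and c where "line_action T t" "both_ways T (word_map t u)"
    "1 \<in> {- T..T}" "word_map t u 1 \<noteq> 1" "c \<in> {- T..T}" "t 0 c = c + 1" "t 1 c = c + 2"
proof -
  obtain R :: "nat \<Rightarrow> (real \<times> real) set" and P y where P: "finite P" "P \<subseteq> {0<..}" "1 \<in> P"
    and R: "\<forall>i. R i \<subseteq> P \<times> P \<and> mono_rel (R i)" and y: "y \<noteq> 1"
    and path: "\<forall>t. (\<forall>i. bij (t i) \<and> (\<forall>(x, x')\<in>R i. t i x = x')) \<longrightarrow> word_map t u 1 = y"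
    using reduced_word_moves[OF red(1)] red(2) by blast
  \<comment> \<open>a point beyond all prescribed ones\<close>
  define c where "c = Max P + 1"
  have Pc: "0 < p \<and> p < c" if "p \<in> P" for p
    using Max_ge[OF P(1) that] that P(2) by (auto simp: c_def)
  have c: "1 < c" using Pc[OF P(3)] by simp
  let ?R = "\<lambda>i. R i \<union> (if i = 0 then {(c, c + 1)} else if i = 1 then {(c, c + 2)} else {})"
  have m: "mono_rel (?R i)" for i
  proof -
    have "mono_rel (insert (c, d) (R i))" if "c < d" for d
    proof (rule mono_rel_insert)
      show "mono_rel (R i)" using R by blast
      fix x z assume "(x, z) \<in> R i"
      then have "x \<in> P" "z \<in> P" using R by auto
      then show "(x < c \<longleftrightarrow> z < d) \<and> (c < x \<longleftrightarrow> d < z)" using Pc[of x] Pc[of z] that by auto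
    qed
    from this[of "c + 1"] this[of "c + 2"] show ?thesis using R by auto
  qed
  have RP: "R i \<subseteq> P \<times> P" for i using R by blast
  have fin: "finite (?R i)" for i using finite_subset[OF RP] P(1) by simp
  have bd: "?R i \<subseteq> {0<..<c + 3} \<times> {0<..<c + 3}" for i
  proof -
    have "P \<times> P \<subseteq> {0<..<c + 3} \<times> {0<..<c + 3}" using Pc by force
    then have "R i \<subseteq> {0<..<c + 3} \<times> {0<..<c + 3}" using RP by blast
    then show ?thesis using c by auto
  qed
  have "0 < c + 3" using c by simp
  obtain t where t: "\<And>i. order_aut (t i)" "\<And>i. t i 0 = 0" "\<And>i. t i (c + 3) = c + 3"
    "\<And>i. t i (- (c + 3)) = - (c + 3)"
    "\<And>i x y. (x, y) \<in> ?R i \<Longrightarrow> t i x = y" "\<And>i x y. (x, y) \<in> ?R i \<Longrightarrow> t i (- x) = - y"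
    by (rule extend_mono_rel_odd[of ?R, OF fin m bd \<open>0 < c + 3\<close>]) (rule that)
  have bt: "bij (t i)" for i using t(1) by (simp add: order_aut_def)
  have tR: "t i x = x'" "t i (- x) = - x'" if "(x, x') \<in> R i" for i x x'
    using t(5,6)[of x x' i] that by simp_all
  have one: "word_map t u 1 = y"
    by (rule mp[OF spec[OF path]]) (use tR(1) bt in auto)
  have "word_map (\<lambda>i x. - t i (- x)) u 1 = y"
    by (rule mp[OF spec[OF path]]) (use tR(2) bij_odd[OF bt] in force)
  then have minus: "word_map t u (- 1) = - y" using word_map_odd[of t u 1, OF bt] by simp
  have T1: "1 \<in> {- (c + 3)..c + 3}" "c \<in> {- (c + 3)..c + 3}" using c by auto
  show thesis
  proof (rule that)
    show "line_action (c + 3) t" using t(1-4) c unfolding line_action_def by simp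
    show "both_ways (c + 3) (word_map t u)" by (rule both_ways_odd[OF T1(1)]) (use one minus y in auto)
    show "t 0 c = c + 1" "t 1 c = c + 2" by (rule t(5), simp)+
  qed (use one y T1 in auto)
qed

context free_amalgam
begin

abbreviation "c1 \<equiv> G.basis_image j1 ev1 n"
abbreviation "c2 \<equiv> G.basis_image j2 ev2 m"

lemma c1_carrier: "c1 i \<in> carrier G" and c2_carrier: "c2 i \<in> carrier G"
  by (rule G.basis_image_closed[OF ev1 j1_hom] G.basis_image_closed[OF ev2 j2_hom])+

abbreviation "gen1 i \<equiv> j1 (ev1 [(True, i)])"

text \<open>
  The actions of \<open>free_line_action\<close> for the two factors combine by \<open>realization\<close>, where
  nothing has to be matched, and the resulting action of the amalgam tells these elements
  apart. The first claim comes before the amalgam acts: it needs that \<open>a\<close> has infinite order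
  in its factor, which holds since the map of the line by which it acts moves the point \<open>1\<close>.
\<close>

lemma amalgam_nontrivial:
  assumes red: "reduced u1" "u1 \<noteq> []" "reduced u2" "u2 \<noteq> []" and n: "2 \<le> n"
  shows "j1 a = j2 b" "j1 a \<noteq> \<one>\<^bsub>G\<^esub>" "gen1 0 \<noteq> \<one>\<^bsub>G\<^esub>" "gen1 1 \<noteq> \<one>\<^bsub>G\<^esub>" "gen1 0 \<noteq> gen1 1"
    "gen1 0 \<otimes>\<^bsub>G\<^esub> gen1 1 \<noteq> \<one>\<^bsub>G\<^esub>"
proof -
  obtain T1 c and t1 :: "nat \<Rightarrow> real \<Rightarrow> real" where t1: "line_action T1 t1" "both_ways T1 (word_map t1 u1)"
    "1 \<in> {- T1..T1}" "word_map t1 u1 1 \<noteq> 1" "c \<in> {- T1..T1}" "t1 0 c = c + 1" "t1 1 c = c + 2"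
    by (rule free_line_action[OF red(1,2)]) (rule that)
  obtain T2 d and t2 :: "nat \<Rightarrow> real \<Rightarrow> real" where t2: "line_action T2 t2" "both_ways T2 (word_map t2 u2)"
    "1 \<in> {- T2..T2}" "word_map t2 u2 1 \<noteq> 1" "d \<in> {- T2..T2}" "t2 0 d = d + 1" "t2 1 d = d + 2"
    by (rule free_line_action[OF red(3,4)]) (rule that)
  have o1: "order_aut (t1 i)" for i using t1(1) by (simp add: line_action_def)
  then have b1: "bij (t1 i)" for i by (simp add: order_aut_def)
  let ?f = "word_map t1 u1"
  have f: "order_aut ?f" by (rule order_aut_word_map[OF o1])
  then have bf: "bij ?f" by (simp add: order_aut_def)
  let ?al = "free_action n ev1 t1"
  have al_a: "?al a = ?f" using free_action_word[where t = t1, OF ev1 b1 u1(1)] u1(2) by simp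
  have pow: "?al (a [^]\<^bsub>A\<^esub> k) v = zpow ?f k v" for k :: int and v
  proof (induction k arbitrary: v rule: int_induct[where k = 0])
    case base
    then show ?case using free_action_one[where t = t1, OF ev1 b1] by simp
  next
    case (step1 i)
    have "a [^]\<^bsub>A\<^esub> (i + 1) = a [^]\<^bsub>A\<^esub> i \<otimes>\<^bsub>A\<^esub> a" using A.int_pow_mult[OF a, of i 1] a by simp
    then have "?al (a [^]\<^bsub>A\<^esub> (i + 1)) v = zpow ?f i (?f v)"
      using free_action_mult[where t = t1, OF ev1 b1 A.int_pow_closed[OF a] a] step1 al_a by simp
    then show ?case using zpow_add[OF bf, of i 1 v] by (simp add: zpow_1)
  next
    case (step2 i)
    have "a [^]\<^bsub>A\<^esub> i = a [^]\<^bsub>A\<^esub> (i - 1) \<otimes>\<^bsub>A\<^esub> a" using A.int_pow_mult[OF a, of "i - 1" 1] a by simp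
    then have "?al (a [^]\<^bsub>A\<^esub> (i - 1)) (?f w) = zpow ?f i w" for w
      using free_action_mult[where t = t1, OF ev1 b1 A.int_pow_closed[OF a, of "i - 1"] a] step2 al_a by simp
    from this[of "zpow ?f (- 1) v"] show ?case
      using zpow_add[OF bf, of i "- 1" v] zpow_add[OF bf, of 1 "- 1" v] by (simp add: zpow_1)
  qed
  show "j1 a = j2 b"
  proof (rule j1_eq_j2)
    fix k :: int assume "a [^]\<^bsub>A\<^esub> k = a"
    then have "zpow ?f k 1 = zpow ?f 1 1" using pow[of k 1] al_a by (simp add: zpow_1)
    then have "zpow ?f (k - 1) 1 = 1"
      using zpow_add[OF bf, of "- 1" k 1] zpow_add[OF bf, of "- 1" 1 1] by (simp add: zpow_1)
    then have "k - 1 = 0" by (rule zpow_eq_self[OF f t1(4)])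
    then show "k = 1" by simp
  qed
  have Y: "finite {1, c}" "{1, c} \<subseteq> {- T1..T1}" using t1(3,5) by auto
  \<comment> \<open>nothing needs to be matched\<close>
  have em: "orbit_matching ?f (word_map t2 u2) (Id_on {})" by (simp add: orbit_matching_def)
  obtain Z :: "(nat \<Rightarrow>\<^sub>0 real) set" and \<gamma> where \<gamma>: "set_action G Z \<gamma>"
    "\<And>y. y \<in> {1, c} \<Longrightarrow> single0 y \<in> Z"
    "\<And>y u. y \<in> {1, c} \<Longrightarrow> u \<in> free_words n \<Longrightarrow> \<gamma> (j1 (ev1 u)) (single0 y) = single0 (word_map t1 u y)"
    by (rule realization[OF t1(1) t2(1) t1(2) t2(2) Y, of "{}"]) (use em in auto)
  have moved: "j1 (ev1 u) \<noteq> \<one>\<^bsub>G\<^esub>" if "y \<in> {1, c}" "u \<in> free_words n" "word_map t1 u y \<noteq> y" for u y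
  proof
    assume "j1 (ev1 u) = \<one>\<^bsub>G\<^esub>"
    then have "single0 (word_map t1 u y) = single0 y"
      using \<gamma>(3)[OF that(1,2)] set_actionD(1)[OF \<gamma>(1) \<gamma>(2)[OF that(1)]] by simp
    then show False using that(3) by (metis lookup_single_eq)
  qed
  have w: "[(True, 0)] \<in> free_words n" "[(True, 1)] \<in> free_words n" "[(True, 0), (True, 1)] \<in> free_words n"
    using n by auto
  show "j1 a \<noteq> \<one>\<^bsub>G\<^esub>" using moved[of 1 u1] u1 t1(4) by simp
  show "gen1 0 \<noteq> \<one>\<^bsub>G\<^esub>" by (rule moved[OF _ w(1), of c]) (simp_all add: t1(6))
  show "gen1 1 \<noteq> \<one>\<^bsub>G\<^esub>" by (rule moved[OF _ w(2), of c]) (use t1(7) in simp_all)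
  show "gen1 0 \<noteq> gen1 1"
  proof
    assume "gen1 0 = gen1 1"
    then have "single0 (c + 1) = single0 (c + 2)"
      using \<gamma>(3)[OF _ w(1), of c] \<gamma>(3)[OF _ w(2), of c] t1(6,7) by simp
    then have "c + 1 = c + 2" by (metis lookup_single_eq)
    then show False by simp
  qed
  have "ev1 [(True, 0), (True, 1)] = ev1 [(True, 0)] \<otimes>\<^bsub>A\<^esub> ev1 [(True, 1)]"
    using word_eval_append[OF ev1 w(1,2)] by simp
  then have "j1 (ev1 [(True, 0), (True, 1)]) = gen1 0 \<otimes>\<^bsub>G\<^esub> gen1 1"
    using j1_mult[OF word_eval_in_carrier[OF ev1 w(1)] word_eval_in_carrier[OF ev1 w(2)]] by simp
  moreover have "t1 0 c < t1 0 (c + 2)" using order_aut_less_iff[OF o1] by simp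
  then have "word_map t1 [(True, 0), (True, 1)] c \<noteq> c" using t1(6,7) by simp
  then have "j1 (ev1 [(True, 0), (True, 1)]) \<noteq> \<one>\<^bsub>G\<^esub>" by (intro moved[OF _ w(3), of c]) auto
  ultimately show "gen1 0 \<otimes>\<^bsub>G\<^esub> gen1 1 \<noteq> \<one>\<^bsub>G\<^esub>" by simp
qed

end

section \<open>Cuts of a left order\<close>

locale left_ordered_group = plain_group G for G :: "'g monoid" (structure) +
  fixes r assumes r: "r \<in> left_orders G"
begin

text \<open>
  Besides the cuts \<open>cut_at x\<close> of group elements, these contain the suprema and infima of
  orbits, which are needed to separate orbits by fixed points.
\<close>

definition cuts :: "'g set set" where
  "cuts = {D. D \<subseteq> carrier G \<and> (\<forall>a\<in>D. \<forall>b\<in>carrier G. (b, a) \<in> r \<longrightarrow> b \<in> D)}"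

definition cut_at :: "'g \<Rightarrow> 'g set" where "cut_at x = {h \<in> carrier G. (h, x) \<in> r}"

definition shift :: "'g \<Rightarrow> 'g set \<Rightarrow> 'g set" where "shift g D = (\<lambda>d. g \<otimes> d) ` D"

lemma order_facts: "trans r" "antisym r" "total_on (carrier G) r" "x \<in> carrier G \<Longrightarrow> (x, x) \<in> r"
  using r by (auto simp: left_orders_def order_on_defs refl_on_def)

lemma cuts_subset: "D \<in> cuts \<Longrightarrow> D \<subseteq> carrier G"
  by (simp add: cuts_def)

lemma cuts_linear:
  assumes "D \<in> cuts" "D' \<in> cuts" shows "D \<subseteq> D' \<or> D' \<subseteq> D"
proof (rule ccontr)
  assume "\<not> ?thesis"
  then obtain a b where ab: "a \<in> D" "a \<notin> D'" "b \<in> D'" "b \<notin> D" by blast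
  then have c: "a \<in> carrier G" "b \<in> carrier G" using assms cuts_subset by auto
  have "(a, b) \<in> r \<or> (b, a) \<in> r" using order_facts(3,4) c unfolding total_on_def by metis
  then show False using assms ab c unfolding cuts_def by blast
qed

lemma cut_at_in_cuts: "cut_at x \<in> cuts"
  using order_facts(1) unfolding cuts_def cut_at_def by (auto dest: transD)

lemma cut_at_subset_iff:
  assumes "x \<in> carrier G" shows "cut_at x \<subseteq> cut_at y \<longleftrightarrow> (x, y) \<in> r"
  using assms order_facts(1,4) unfolding cut_at_def by (auto dest: transD)

lemma cut_at_eq_iff: "x \<in> carrier G \<Longrightarrow> y \<in> carrier G \<Longrightarrow> cut_at x = cut_at y \<longleftrightarrow> x = y"
  using cut_at_subset_iff order_facts(2) by (metis antisymD equalityE)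

lemma cut_at_psubset_iff:
  "x \<in> carrier G \<Longrightarrow> y \<in> carrier G \<Longrightarrow> cut_at x \<subset> cut_at y \<longleftrightarrow> (x, y) \<in> r \<and> x \<noteq> y"
  unfolding psubset_eq using cut_at_subset_iff cut_at_eq_iff by metis

lemma shift_mult:
  assumes "g \<in> carrier G" "h \<in> carrier G" "D \<subseteq> carrier G"
  shows "shift (g \<otimes> h) D = shift g (shift h D)"
proof -
  have "g \<otimes> h \<otimes> d = g \<otimes> (h \<otimes> d)" if "d \<in> D" for d using assms that by (intro m_assoc) auto
  then show ?thesis unfolding shift_def image_image by (intro image_cong) simp_all
qed

lemma shift_one: "D \<subseteq> carrier G \<Longrightarrow> shift \<one> D = D"
  unfolding shift_def by (force simp: subset_iff)

lemma shift_subset: "D \<subseteq> D' \<Longrightarrow> shift g D \<subseteq> shift g D'"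
  unfolding shift_def by (rule image_mono)

lemma shift_carrier: "g \<in> carrier G \<Longrightarrow> D \<subseteq> carrier G \<Longrightarrow> shift g D \<subseteq> carrier G"
  unfolding shift_def by auto

lemma shift_inv:
  assumes "g \<in> carrier G" "D \<subseteq> carrier G"
  shows "shift (inv g) (shift g D) = D" "shift g (shift (inv g) D) = D"
  using shift_mult[of "inv g" g D] shift_mult[of g "inv g" D] shift_one assms by simp_all

lemma shift_psubset_iff:
  assumes "g \<in> carrier G" "D \<subseteq> carrier G" "D' \<subseteq> carrier G"
  shows "shift g D \<subset> shift g D' \<longleftrightarrow> D \<subset> D'"
proof -
  have "shift g D \<subseteq> shift g D' \<longleftrightarrow> D \<subseteq> D'" if "D \<subseteq> carrier G" "D' \<subseteq> carrier G" for D D'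
    using shift_subset shift_inv(1)[OF assms(1)] that by metis
  then show ?thesis using assms unfolding psubset_eq by (metis subset_antisym order_refl)
qed

lemma shift_cut_at:
  assumes "g \<in> carrier G" "x \<in> carrier G" shows "shift g (cut_at x) = cut_at (g \<otimes> x)"
proof
  show "shift g (cut_at x) \<subseteq> cut_at (g \<otimes> x)"
    using assms left_order_mult_iff[OF r] by (auto simp: shift_def cut_at_def)
  show "cut_at (g \<otimes> x) \<subseteq> shift g (cut_at x)"
  proof
    fix h assume h: "h \<in> cut_at (g \<otimes> x)"
    then have hc: "h \<in> carrier G" by (simp add: cut_at_def)
    have eq: "h = g \<otimes> (inv g \<otimes> h)" using mult_inv_cancel(1)[OF assms(1) hc] by simp
    then have "(g \<otimes> (inv g \<otimes> h), g \<otimes> x) \<in> r" using h by (simp add: cut_at_def)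
    then have "(inv g \<otimes> h, x) \<in> r" using left_order_mult_iff[OF r assms(1)] assms hc by simp
    then have "inv g \<otimes> h \<in> cut_at x" using assms hc by (simp add: cut_at_def)
    then show "h \<in> shift g (cut_at x)" unfolding shift_def by (rule image_eqI[where f = "\<lambda>d. g \<otimes> d", OF eq])
  qed
qed

lemma shift_in_cuts:
  assumes g: "g \<in> carrier G" and D: "D \<in> cuts" shows "shift g D \<in> cuts"
proof -
  have Dc: "D \<subseteq> carrier G" by (rule cuts_subset[OF D])
  have "b \<in> shift g D" if a: "a \<in> D" and b: "b \<in> carrier G" "(b, g \<otimes> a) \<in> r" for a b
  proof -
    have ac: "a \<in> carrier G" using a Dc by blast
    have "b \<in> cut_at (g \<otimes> a)" using b by (simp add: cut_at_def)
    then have "b \<in> shift g (cut_at a)" using shift_cut_at[OF g ac] by simp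
    moreover have "cut_at a \<subseteq> D" using a D unfolding cut_at_def cuts_def by blast
    ultimately show ?thesis using shift_subset by blast
  qed
  then show ?thesis unfolding cuts_def using shift_carrier[OF g Dc] by (auto simp: shift_def)
qed

lemma shift_UN: "shift g (\<Union>i. X i) = (\<Union>i. shift g (X i))"
  unfolding shift_def by (rule image_UN)

lemma shift_INT:
  assumes "g \<in> carrier G" "\<And>i. X i \<subseteq> carrier G"
  shows "shift g (\<Inter>i. X i) = (\<Inter>i. shift g (X i))"
  unfolding shift_def
proof (rule image_INT)
  show "inj_on (\<lambda>d. g \<otimes> d) (carrier G)" using assms(1) by (rule inj_on_cmult)
qed (use assms(2) in auto)

lemma strict_mono_on_cuts:
  assumes "\<And>D D'. D \<in> A \<Longrightarrow> D' \<in> A \<Longrightarrow> D \<subset> D' \<Longrightarrow> e D < (e D' :: real)" "A \<subseteq> cuts" "D \<in> A" "D' \<in> A"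
  shows "e D < e D' \<longleftrightarrow> D \<subset> D'"
  using assms(1)[OF assms(3,4)] assms(1)[OF assms(4,3)] cuts_linear[of D D'] assms(2-4)
  by (metis less_asym less_irrefl psubset_eq subsetD)

subsection \<open>Following words\<close>

text \<open>
  Placed on the line by \<open>e\<close>, the finitely many cuts in \<open>A\<close> are moved by \<open>t\<close> as they are moved
  by translations, at least as far as the translates belong to \<open>A\<close> again.
\<close>

definition follows :: "(nat \<Rightarrow> 'g) \<Rightarrow> 'g set set \<Rightarrow> (nat \<Rightarrow> real \<Rightarrow> real) \<Rightarrow> ('g set \<Rightarrow> real) \<Rightarrow> bool" where
  "follows c A t e \<longleftrightarrow> (\<forall>i. bij (t i)) \<and>
     (\<forall>i. \<forall>D\<in>A. shift (c i) D \<in> A \<longrightarrow> t i (e D) = e (shift (c i) D))"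

lemma follows_letter:
  assumes c: "\<And>i. c i \<in> carrier G" and A: "A \<subseteq> cuts" and f: "follows c A t e"
    and D: "D \<in> A" "shift (group_letter c l) D \<in> A"
  shows "letter_map t l (e D) = e (shift (group_letter c l) D)"
proof -
  obtain b i where l: "l = (b, i)" by (cases l)
  have bt: "bij (t i)" and st: "\<And>D. D \<in> A \<Longrightarrow> shift (c i) D \<in> A \<Longrightarrow> t i (e D) = e (shift (c i) D)"
    using f unfolding follows_def by blast+
  show ?thesis
  proof (cases b)
    case False
    let ?D = "shift (inv (c i)) D"
    have "?D \<in> A" using D(2) l False by simp
    moreover have "shift (c i) ?D = D" using shift_inv(2)[OF c] cuts_subset A D(1) by blast
    ultimately have "t i (e ?D) = e D" using st[of ?D] D(1) by simp
    then have "finv (t i) (e D) = e ?D" by (metis bt bij_is_inj inv_f_f)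
    then show ?thesis using l False by simp
  qed (use l D st in simp)
qed

text \<open>
  It is enough that all translates met along the word belong to \<open>A\<close>.
\<close>

lemma follows_word:
  assumes c: "\<And>i. c i \<in> carrier G" and A: "A \<subseteq> cuts" and f: "follows c A t e" and D: "D \<in> cuts"
    and path: "\<And>p s. u = p @ s \<Longrightarrow> shift (group_word c s) D \<in> A"
  shows "word_map t u (e D) = e (shift (group_word c u) D)"
  using path
proof (induction u)
  case Nil
  then show ?case using shift_one cuts_subset[OF D] by simp
next
  case (Cons l u)
  have IH: "word_map t u (e D) = e (shift (group_word c u) D)"
    using Cons.IH Cons.prems by (metis append_Cons)
  have sm: "shift (group_word c (l # u)) D = shift (group_letter c l) (shift (group_word c u) D)"
    using shift_mult[OF group_letter_closed[OF c] group_word_closed[OF c] cuts_subset[OF D]] by simp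
  have "shift (group_word c u) D \<in> A" using Cons.prems[of "[l]" u] by simp
  moreover have "shift (group_letter c l) (shift (group_word c u) D) \<in> A"
    using Cons.prems[of "[]" "l # u"] sm by simp
  ultimately show ?case using follows_letter[OF c A f] IH sm by simp
qed

subsection \<open>Finitely many cuts determine how orbits interleave\<close>

lemma funpow_le:
  assumes "order_aut f" "v \<le> f v" "i \<le> j" shows "(f ^^ i) v \<le> (f ^^ j) v"
proof (rule lift_Suc_mono_le[of "\<lambda>i. (f ^^ i) v", OF _ assms(3)])
  fix k
  have "\<not> (f ^^ k) (f v) < (f ^^ k) v"
    using order_aut_less_iff[OF order_aut_funpow[OF assms(1)]] assms(2) by (simp add: not_less)
  then show "(f ^^ k) v \<le> (f ^^ Suc k) v" by (simp add: funpow_swap1)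
qed

lemma funpow_ge:
  assumes "order_aut f" "f v \<le> v" "i \<le> j" shows "(f ^^ j) v \<le> (f ^^ i) v"
proof (rule lift_Suc_antimono_le[of "\<lambda>i. (f ^^ i) v", OF _ assms(3)])
  fix k
  have "\<not> (f ^^ k) v < (f ^^ k) (f v)"
    using order_aut_less_iff[OF order_aut_funpow[OF assms(1)]] assms(2) by (simp add: not_less)
  then show "(f ^^ Suc k) v \<le> (f ^^ k) v" by (simp add: funpow_swap1)
qed

definition orbit_cut :: "'g \<Rightarrow> 'g \<Rightarrow> nat \<Rightarrow> 'g set" where
  "orbit_cut w x i = cut_at (w [^] i \<otimes> x)"

lemma orbit_cut_Suc:
  "w \<in> carrier G \<Longrightarrow> x \<in> carrier G \<Longrightarrow> orbit_cut w x (Suc i) = shift w (orbit_cut w x i)"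
  unfolding orbit_cut_def by (subst nat_pow_Suc2) (simp_all add: shift_cut_at m_assoc)

text \<open>
  Finitely many cuts, the first \<open>N\<close> translates of \<open>x\<close> and the \<open>w\<close>-fixed cuts in \<open>Sep\<close>, force
  the forward orbit of \<open>x\<close> under any \<open>f\<close> that acts on them like \<open>w\<close> to pass \<open>y\<close> exactly when
  the orbit of \<open>x\<close> under \<open>w\<close> does. Forward orbits suffice since \<open>x\<close> and \<open>y\<close> may be exchanged.
\<close>

definition pins :: "'g \<Rightarrow> 'g \<Rightarrow> 'g \<Rightarrow> nat \<Rightarrow> 'g set set \<Rightarrow> bool" where
  "pins w x y N Sep \<longleftrightarrow> (\<forall>e f. order_aut f \<longrightarrow>
     (let A = insert (cut_at y) (Sep \<union> orbit_cut w x ` {..N}) in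
       (\<forall>D\<in>A. \<forall>D'\<in>A. D \<subset> D' \<longrightarrow> e D < (e D' :: real))) \<longrightarrow>
     (\<forall>i<N. f (e (orbit_cut w x i)) = e (orbit_cut w x (Suc i))) \<longrightarrow>
     (\<forall>z\<in>Sep. f (e z) = e z) \<longrightarrow>
     (\<forall>i. ((f ^^ i) (e (cut_at x)) < e (cut_at y) \<longleftrightarrow> orbit_cut w x i \<subset> cut_at y) \<and>
          (e (cut_at y) < (f ^^ i) (e (cut_at x)) \<longleftrightarrow> cut_at y \<subset> orbit_cut w x i)))"

text \<open>
  Orbits are monotone: once on the far side of \<open>y\<close>, they stay there.
\<close>

lemma pins_crossing:
  assumes w: "w \<in> carrier G" and x: "x \<in> carrier G" and N: "0 < N"
    and dir: "orbit_cut w x 0 \<subset> orbit_cut w x 1 \<and> (\<forall>i\<ge>N. cut_at y \<subset> orbit_cut w x i) \<or>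
      orbit_cut w x 1 \<subset> orbit_cut w x 0 \<and> (\<forall>i\<ge>N. orbit_cut w x i \<subset> cut_at y)"
  shows "pins w x y N {}"
  unfolding pins_def Let_def
proof (intro allI impI)
  let ?X = "orbit_cut w x" and ?Y = "cut_at y"
  let ?A = "insert ?Y ({} \<union> ?X ` {..N})"
  fix e :: "'g set \<Rightarrow> real" and f i
  assume f: "order_aut f" and e: "\<forall>D\<in>?A. \<forall>D'\<in>?A. D \<subset> D' \<longrightarrow> e D < e D'"
    and fe: "\<forall>i<N. f (e (?X i)) = e (?X (Suc i))"
  have X0: "?X 0 = cut_at x" using x by (simp add: orbit_cut_def)
  have A: "?A \<subseteq> cuts" unfolding orbit_cut_def using cut_at_in_cuts by auto
  have less: "e D < e D' \<longleftrightarrow> D \<subset> D'" if "D \<in> ?A" "D' \<in> ?A" for D D'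
    by (rule strict_mono_on_cuts[OF _ A that], rule e[rule_format])
  have it: "(f ^^ i) (e (?X 0)) = e (?X i)" if "i \<le> N" for i
    using that by (induction i) (use fe in auto)
  show "((f ^^ i) (e (cut_at x)) < e ?Y \<longleftrightarrow> ?X i \<subset> ?Y) \<and> (e ?Y < (f ^^ i) (e (cut_at x)) \<longleftrightarrow> ?Y \<subset> ?X i)"
  proof (cases "i \<le> N")
    case True
    then show ?thesis using less[of "?X i" ?Y] less[of ?Y "?X i"] it[OF True] X0 by simp
  next
    case False
    have f0: "f (e (?X 0)) = e (?X 1)" using fe N by simp
    have XN: "?X 0 \<in> ?A" "?X 1 \<in> ?A" "?X N \<in> ?A" "?Y \<in> ?A" using N by auto
    show ?thesis
      using dir
    proof
      assume up: "?X 0 \<subset> ?X 1 \<and> (\<forall>i\<ge>N. ?Y \<subset> ?X i)"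
      then have "e (?X 0) \<le> f (e (?X 0))" using less[OF XN(1,2)] f0 by simp
      then have "e (?X N) \<le> (f ^^ i) (e (?X 0))" using funpow_le[OF f, of "e (?X 0)" N i] it[of N] False by simp
      moreover have "e ?Y < e (?X N)" using less[OF XN(4,3)] up by simp
      moreover have "?Y \<subset> ?X i" using up False by simp
      ultimately show ?thesis using X0 by auto
    next
      assume down: "?X 1 \<subset> ?X 0 \<and> (\<forall>i\<ge>N. ?X i \<subset> ?Y)"
      then have "f (e (?X 0)) \<le> e (?X 0)" using less[OF XN(2,1)] f0 by simp
      then have "(f ^^ i) (e (?X 0)) \<le> e (?X N)" using funpow_ge[OF f, of "e (?X 0)" N i] it[of N] False by simp
      moreover have "e (?X N) < e ?Y" using less[OF XN(3,4)] down by simp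
      moreover have "?X i \<subset> ?Y" using down False by simp
      ultimately show ?thesis using X0 by auto
    qed
  qed
qed

text \<open>
  An orbit cannot jump over a fixed point.
\<close>

lemma pins_separated:
  assumes x: "x \<in> carrier G"
    and dir: "(\<forall>i. orbit_cut w x i \<subset> z) \<and> z \<subset> cut_at y \<or> (\<forall>i. z \<subset> orbit_cut w x i) \<and> cut_at y \<subset> z"
  shows "pins w x y 0 {z}"
  unfolding pins_def Let_def
proof (intro allI impI)
  let ?X = "orbit_cut w x" and ?Y = "cut_at y"
  let ?A = "insert ?Y ({z} \<union> ?X ` {..0})"
  fix e :: "'g set \<Rightarrow> real" and f i
  assume f: "order_aut f" and e: "\<forall>D\<in>?A. \<forall>D'\<in>?A. D \<subset> D' \<longrightarrow> e D < e D'" and fz: "\<forall>z\<in>{z}. f (e z) = e z"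
  have X0: "?X 0 = cut_at x" using x by (simp add: orbit_cut_def)
  have z: "(f ^^ i) (e z) = e z" by (induction i) (use fz in auto)
  note f_less = order_aut_less_iff[OF order_aut_funpow[OF f, of i]]
  show "((f ^^ i) (e (cut_at x)) < e ?Y \<longleftrightarrow> ?X i \<subset> ?Y) \<and> (e ?Y < (f ^^ i) (e (cut_at x)) \<longleftrightarrow> ?Y \<subset> ?X i)"
    using dir
  proof
    assume up: "(\<forall>i. ?X i \<subset> z) \<and> z \<subset> ?Y"
    then have "e (?X 0) < e z" "e z < e ?Y" using e by simp_all
    then have "(f ^^ i) (e (?X 0)) < e ?Y" using f_less[of "e (?X 0)" "e z"] z by simp
    moreover have "?X i \<subset> ?Y" using up by (meson psubset_trans)
    ultimately show ?thesis using X0 by auto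
  next
    assume down: "(\<forall>i. z \<subset> ?X i) \<and> ?Y \<subset> z"
    then have "e z < e (?X 0)" "e ?Y < e z" using e by simp_all
    then have "e ?Y < (f ^^ i) (e (?X 0))" using f_less[of "e z" "e (?X 0)"] z by simp
    moreover have "?Y \<subset> ?X i" using down by (meson psubset_trans)
    ultimately show ?thesis using X0 by auto
  qed
qed

text \<open>
  Either the forward orbit of \<open>x\<close> passes \<open>y\<close>, or its supremum (or infimum) is a fixed cut
  between the orbit and \<open>y\<close>; it is not the cut at \<open>y\<close> itself, as \<open>w\<close> fixes no element. This
  cut is contained in \<open>cut_at x\<close> or in \<open>cut_at y\<close>, so fixed cuts never become the top of the
  data below.
\<close>

lemma ex_pins:
  assumes w: "w \<in> carrier G" "w \<noteq> \<one>" and x: "x \<in> carrier G" and y: "y \<in> carrier G"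
  shows "\<exists>N Sep. finite Sep \<and> Sep \<subseteq> cuts \<and>
    (\<forall>z\<in>Sep. shift w z = z \<and> (z \<subseteq> cut_at x \<or> z \<subseteq> cut_at y)) \<and> pins w x y N Sep"
proof -
  let ?X = "orbit_cut w x" and ?Y = "cut_at y"
  have Xc: "?X i \<in> cuts" for i unfolding orbit_cut_def by (rule cut_at_in_cuts)
  have Yc: "?Y \<in> cuts" by (rule cut_at_in_cuts)
  have X0: "?X 0 = cut_at x" using x by (simp add: orbit_cut_def)
  have XS: "?X (Suc i) = shift w (?X i)" for i by (rule orbit_cut_Suc[OF w(1) x])
  have shift_less: "?X (Suc i) \<subset> ?X (Suc j) \<longleftrightarrow> ?X i \<subset> ?X j" for i j
    unfolding XS by (rule shift_psubset_iff[OF w(1) cuts_subset[OF Xc] cuts_subset[OF Xc]])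
  have "w \<otimes> y \<noteq> y" using right_cancel[of y w \<one>] w y by auto
  then have wY: "shift w ?Y \<noteq> ?Y" using shift_cut_at[OF w(1) y] cut_at_eq_iff w y by simp
  have "w \<otimes> x \<noteq> x" using right_cancel[of x w \<one>] w x by auto
  then have "?X 1 \<noteq> ?X 0" using cut_at_eq_iff w x unfolding orbit_cut_def by simp
  then consider (up) "?X 0 \<subset> ?X 1" | (down) "?X 1 \<subset> ?X 0" using cuts_linear[OF Xc Xc, of 0 1] by blast
  then show ?thesis
  proof cases
    case up
    have step: "?X i \<subset> ?X (Suc i)" for i by (induction i) (use up shift_less in simp_all)
    have mono: "?X i \<subseteq> ?X j" if "i \<le> j" for i j
      by (rule lift_Suc_mono_le[of ?X, OF psubset_imp_subset[OF step] that])
    show ?thesis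
    proof (cases "\<exists>M. ?Y \<subset> ?X M")
      case True
      then obtain M where M: "?Y \<subset> ?X M" by blast
      have "?Y \<subset> ?X i" if "Suc M \<le> i" for i
        by (rule psubset_subset_trans[OF M mono]) (use that in simp)
      then have "pins w x y (Suc M) {}" using up by (intro pins_crossing[OF w(1) x]) simp_all
      then show ?thesis by (intro exI[of _ "Suc M"] exI[of _ "{}"]) simp
    next
      case False
      then have le: "?X i \<subseteq> ?Y" for i using cuts_linear[OF Xc Yc] by blast
      \<comment> \<open>the orbit of \<open>x\<close> stays below \<open>y\<close>; its supremum is a \<open>w\<close>-fixed cut in between\<close>
      define z where "z = (\<Union>i. ?X i)"
      have zc: "z \<in> cuts" using Xc unfolding z_def cuts_def by blast
      have "shift w z = (\<Union>i. ?X (Suc i))" unfolding z_def shift_UN XS by (rule HOL.refl)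
      also have "\<dots> = z" unfolding z_def using step by blast
      finally have wz: "shift w z = z" .
      have "z \<subseteq> ?Y" unfolding z_def by (rule UN_least) (rule le)
      moreover have "z \<noteq> ?Y" using wz wY by metis
      ultimately have zY: "z \<subset> ?Y" by (rule psubsetI)
      have "?X i \<subset> z" for i
        unfolding z_def by (rule psubset_subset_trans[OF step]) (rule UN_upper, simp)
      then have "pins w x y 0 {z}" using zY by (intro pins_separated[OF x]) simp
      then show ?thesis using zc wz zY by (intro exI[of _ 0] exI[of _ "{z}"]) auto
    qed
  next
    case down
    have step: "?X (Suc i) \<subset> ?X i" for i by (induction i) (use down shift_less in simp_all)
    have mono: "?X j \<subseteq> ?X i" if "i \<le> j" for i j
      by (rule lift_Suc_antimono_le[of ?X, OF psubset_imp_subset[OF step] that])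
    show ?thesis
    proof (cases "\<exists>M. ?X M \<subset> ?Y")
      case True
      then obtain M where M: "?X M \<subset> ?Y" by blast
      have "?X i \<subset> ?Y" if "Suc M \<le> i" for i
        by (rule subset_psubset_trans[OF mono M]) (use that in simp)
      then have "pins w x y (Suc M) {}" using down by (intro pins_crossing[OF w(1) x]) simp_all
      then show ?thesis by (intro exI[of _ "Suc M"] exI[of _ "{}"]) simp
    next
      case False
      then have le: "?Y \<subseteq> ?X i" for i using cuts_linear[OF Xc Yc] by blast
      define z where "z = (\<Inter>i. ?X i)"
      have zc: "z \<in> cuts" using Xc unfolding z_def cuts_def by blast
      have "shift w z = (\<Inter>i. ?X (Suc i))"
        unfolding z_def shift_INT[OF w(1) cuts_subset[OF Xc]] XS by (rule HOL.refl)
      also have "\<dots> = z" unfolding z_def using step by blast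
      finally have wz: "shift w z = z" .
      have "?Y \<subseteq> z" unfolding z_def by (rule INT_greatest) (rule le)
      moreover have "?Y \<noteq> z" using wz wY by metis
      ultimately have Yz: "?Y \<subset> z" by (rule psubsetI)
      have zX: "z \<subset> ?X i" for i
        unfolding z_def by (rule subset_psubset_trans[OF _ step]) (rule INT_lower, simp)
      then have "pins w x y 0 {z}" using Yz by (intro pins_separated[OF x]) simp
      then show ?thesis using zc wz zX[of 0] X0 by (intro exI[of _ 0] exI[of _ "{z}"]) auto
    qed
  qed
qed

end

lemma word_map_power: "word_map t (concat (replicate i u)) x = (word_map t u ^^ i) x"
  by (induction i) (simp_all add: word_map_append)

context left_ordered_group
begin

lemma pins_mono:
  assumes "pins w x y N Sep" "N \<le> N'" "Sep \<subseteq> Sep'" shows "pins w x y N' Sep'"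
  unfolding pins_def Let_def
proof (intro allI impI)
  fix e :: "'g set \<Rightarrow> real" and f i
  let ?A = "\<lambda>N Sep. insert (cut_at y) (Sep \<union> orbit_cut w x ` {..N})"
  assume f: "order_aut f" and e: "\<forall>D\<in>?A N' Sep'. \<forall>D'\<in>?A N' Sep'. D \<subset> D' \<longrightarrow> e D < e D'"
    and fe: "\<forall>i<N'. f (e (orbit_cut w x i)) = e (orbit_cut w x (Suc i))" and fz: "\<forall>z\<in>Sep'. f (e z) = e z"
  have sub: "?A N Sep \<subseteq> ?A N' Sep'" using assms(2,3) by auto
  have h1: "\<forall>D\<in>?A N Sep. \<forall>D'\<in>?A N Sep. D \<subset> D' \<longrightarrow> e D < e D'"
    by (intro ballI impI e[rule_format] subsetD[OF sub])
  have h2: "\<forall>i<N. f (e (orbit_cut w x i)) = e (orbit_cut w x (Suc i))" using fe assms(2) by simp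
  have h3: "\<forall>z\<in>Sep. f (e z) = e z" using fz assms(3) by blast
  show "((f ^^ i) (e (cut_at x)) < e (cut_at y) \<longleftrightarrow> orbit_cut w x i \<subset> cut_at y) \<and>
      (e (cut_at y) < (f ^^ i) (e (cut_at x)) \<longleftrightarrow> cut_at y \<subset> orbit_cut w x i)"
    by (rule assms(1)[unfolded pins_def Let_def, THEN spec, THEN spec, THEN mp, OF f, THEN mp, OF h1, THEN mp, OF h2, THEN mp, OF h3, THEN spec])
qed

text \<open>
  The cuts in \<open>A\<close> determine the interleaving of the \<open>w\<close>-orbits of \<open>K\<close> for every family of
  increasing maps of the line that follows them. Their largest element is the translate of a
  point \<open>x\<close> of \<open>K\<close> by a word \<open>s\<close>, and \<open>A\<close> contains enough translates for \<open>s\<close> to act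
  accordingly; this is the place at which the freedom in the choice of the maps will be used.
\<close>

definition captures ::
  "(nat \<Rightarrow> 'g) \<Rightarrow> (bool \<times> nat) list \<Rightarrow> 'g \<Rightarrow> 'g set \<Rightarrow> 'g set set \<Rightarrow> (bool \<times> nat) list \<Rightarrow> 'g \<Rightarrow> bool" where
  "captures c u w K A s x \<longleftrightarrow>
     finite A \<and> A \<subseteq> cuts \<and> cut_at ` K \<subseteq> A \<and> x \<in> K \<and> set s \<subseteq> set u \<and>
     cut_at (group_word c s \<otimes> x) \<in> A \<and> (\<forall>D\<in>A. D \<subseteq> cut_at (group_word c s \<otimes> x)) \<and>
     (\<forall>y\<in>K. cut_at (w \<otimes> y) \<in> A) \<and>
     (\<forall>t e. follows c A t e \<longrightarrow>
        word_map t s (e (cut_at x)) = e (cut_at (group_word c s \<otimes> x)) \<and>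
        (\<forall>y\<in>K. word_map t u (e (cut_at y)) = e (cut_at (w \<otimes> y))) \<and>
        ((\<forall>i. order_aut (t i)) \<and> (\<forall>D\<in>A. \<forall>D'\<in>A. D \<subset> D' \<longrightarrow> e D < e D') \<longrightarrow>
          (\<forall>y\<in>K. \<forall>z\<in>K. \<forall>i.
            ((word_map t u ^^ i) (e (cut_at y)) < e (cut_at z) \<longleftrightarrow> orbit_cut w y i \<subset> cut_at z) \<and>
            (e (cut_at z) < (word_map t u ^^ i) (e (cut_at y)) \<longleftrightarrow> cut_at z \<subset> orbit_cut w y i))))"

lemma capturesD:
  assumes "captures c u w K A s x"
  shows "finite A" "A \<subseteq> cuts" "cut_at ` K \<subseteq> A" "x \<in> K" "set s \<subseteq> set u"
    "cut_at (group_word c s \<otimes> x) \<in> A" "\<And>D. D \<in> A \<Longrightarrow> D \<subseteq> cut_at (group_word c s \<otimes> x)"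
    "\<And>t e. follows c A t e \<Longrightarrow> word_map t s (e (cut_at x)) = e (cut_at (group_word c s \<otimes> x))"
    "\<And>y. y \<in> K \<Longrightarrow> cut_at (w \<otimes> y) \<in> A"
    "\<And>t e y. follows c A t e \<Longrightarrow> y \<in> K \<Longrightarrow> word_map t u (e (cut_at y)) = e (cut_at (w \<otimes> y))"
    "\<And>t e y z i. follows c A t e \<Longrightarrow> (\<And>i. order_aut (t i)) \<Longrightarrow>
       (\<And>D D'. D \<in> A \<Longrightarrow> D' \<in> A \<Longrightarrow> D \<subset> D' \<Longrightarrow> e D < e D') \<Longrightarrow> y \<in> K \<Longrightarrow> z \<in> K \<Longrightarrow>
       ((word_map t u ^^ i) (e (cut_at y)) < e (cut_at z) \<longleftrightarrow> orbit_cut w y i \<subset> cut_at z) \<and>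
       (e (cut_at z) < (word_map t u ^^ i) (e (cut_at y)) \<longleftrightarrow> cut_at z \<subset> orbit_cut w y i)"
proof -
  note r1 = assms[unfolded captures_def]
  note r2 = conjunct2[OF r1] note r3 = conjunct2[OF r2] note r4 = conjunct2[OF r3]
  note r5 = conjunct2[OF r4] note r6 = conjunct2[OF r5] note r7 = conjunct2[OF r6]
  note r8 = conjunct2[OF r7] note r9 = conjunct2[OF r8]
  show "finite A" "A \<subseteq> cuts" "cut_at ` K \<subseteq> A" "x \<in> K" "set s \<subseteq> set u"
    "cut_at (group_word c s \<otimes> x) \<in> A"
    by (rule conjunct1[OF r1] conjunct1[OF r2] conjunct1[OF r3] conjunct1[OF r4] conjunct1[OF r5] conjunct1[OF r6])+
  show "D \<subseteq> cut_at (group_word c s \<otimes> x)" if "D \<in> A" for D by (rule bspec[OF conjunct1[OF r7] that])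
  show "cut_at (w \<otimes> y) \<in> A" if "y \<in> K" for y by (rule bspec[OF conjunct1[OF r8] that])
  note f = mp[OF spec[OF spec[OF r9]]]
  show "word_map t s (e (cut_at x)) = e (cut_at (group_word c s \<otimes> x))" if "follows c A t e" for t e
    by (rule conjunct1[OF f[OF that]])
  show "word_map t u (e (cut_at y)) = e (cut_at (w \<otimes> y))" if "follows c A t e" "y \<in> K" for t e y
    by (rule bspec[OF conjunct1[OF conjunct2[OF f[OF that(1)]]] that(2)])
  fix t e y z i
  assume fo: "follows c A t e" and t: "\<And>i. order_aut (t i)"
    and e: "\<And>D D'. D \<in> A \<Longrightarrow> D' \<in> A \<Longrightarrow> D \<subset> D' \<Longrightarrow> e D < e D'" and y: "y \<in> K" and z: "z \<in> K"
  have "(\<forall>i. order_aut (t i)) \<and> (\<forall>D\<in>A. \<forall>D'\<in>A. D \<subset> D' \<longrightarrow> e D < e D')"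
    by (intro conjI allI ballI impI t e)
  from spec[OF bspec[OF bspec[OF mp[OF conjunct2[OF conjunct2[OF f[OF fo]]] this] y] z], of i]
  show "((word_map t u ^^ i) (e (cut_at y)) < e (cut_at z) \<longleftrightarrow> orbit_cut w y i \<subset> cut_at z) \<and>
       (e (cut_at z) < (word_map t u ^^ i) (e (cut_at y)) \<longleftrightarrow> cut_at z \<subset> orbit_cut w y i)" .
qed

text \<open>
  Take the cuts provided by \<open>ex_pins\<close> for all pairs in \<open>K\<close>, and their translates by all
  suffixes of the word \<open>u\<close> for \<open>w\<close>, so that the effect of \<open>u\<close> on them can be followed letter
  by letter. Separating cuts lie below points of \<open>K\<close>, hence the largest cut is a translate of
  a cut \<open>orbit_cut w x i\<close> by a suffix of \<open>u\<close>.
\<close>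

lemma orbit_data:
  assumes c: "\<And>i. c i \<in> carrier G" and w: "group_word c u = w" "w \<noteq> \<one>"
    and K: "finite K" "K \<subseteq> carrier G" "K \<noteq> {}"
  obtains A s x where "captures c u w K A s x"
proof -
  have gw: "group_word c v \<in> carrier G" for v by (rule group_word_closed[OF c])
  have wc: "w \<in> carrier G" using gw w(1) by blast
  let ?W = "\<lambda>q p. finite (snd p) \<and> snd p \<subseteq> cuts \<and>
    (\<forall>z\<in>snd p. shift w z = z \<and> (z \<subseteq> cut_at (fst q) \<or> z \<subseteq> cut_at (snd q))) \<and> pins w (fst q) (snd q) (fst p) (snd p)"
  have "\<forall>q\<in>K \<times> K. \<exists>p. ?W q p"
  proof
    fix q assume "q \<in> K \<times> K"
    then have "fst q \<in> carrier G" "snd q \<in> carrier G" using K(2) by auto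
    from ex_pins[OF wc w(2) this] show "\<exists>p. ?W q p" by simp
  qed
  then obtain p where p: "\<forall>q\<in>K \<times> K. ?W q (p q)" by (rule bchoice[THEN exE])
  define N where "N = Max ((fst \<circ> p) ` (K \<times> K))"
  define Sep where "Sep = (\<Union>q\<in>K \<times> K. snd (p q))"
  have finKK: "finite (K \<times> K)" using K(1) by simp
  have pin: "pins w y z N Sep" if "y \<in> K" "z \<in> K" for y z
  proof (rule pins_mono)
    have q: "(y, z) \<in> K \<times> K" using that by simp
    show "pins w y z (fst (p (y, z))) (snd (p (y, z)))" using bspec[OF p q] by simp
    show "fst (p (y, z)) \<le> N" unfolding N_def using finKK q by (intro Max_ge) (auto intro!: rev_image_eqI)
    show "snd (p (y, z)) \<subseteq> Sep" unfolding Sep_def using q by blast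
  qed
  have Sep_fin: "finite Sep" unfolding Sep_def using finKK p by blast
  have Sep_cuts: "Sep \<subseteq> cuts" unfolding Sep_def using p by blast
  have Sep_fix: "shift w z = z" and Sep_le: "\<exists>y\<in>K. z \<subseteq> cut_at y" if z: "z \<in> Sep" for z
  proof -
    obtain q where q: "q \<in> K \<times> K" "z \<in> snd (p q)" using z unfolding Sep_def by blast
    then have "shift w z = z \<and> (z \<subseteq> cut_at (fst q) \<or> z \<subseteq> cut_at (snd q))" using p by blast
    then show "shift w z = z" "\<exists>y\<in>K. z \<subseteq> cut_at y" using q(1) by auto
  qed
  define Orb where "Orb = (\<lambda>(y, i). orbit_cut w y i) ` (K \<times> {..N})"
  define suf where "suf k = group_word c (drop k u)" for k
  define A where "A = (\<lambda>(k, D). shift (suf k) D) ` ({..length u} \<times> (Orb \<union> Sep))"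
  have sufc: "suf k \<in> carrier G" for k unfolding suf_def by (rule gw)
  have Orb_cuts: "Orb \<subseteq> cuts" unfolding Orb_def orbit_cut_def using cut_at_in_cuts by auto
  have finA: "finite A" unfolding A_def Orb_def using K(1) Sep_fin by simp
  have A_cuts: "A \<subseteq> cuts" unfolding A_def using shift_in_cuts[OF sufc] Orb_cuts Sep_cuts by auto
  have inA: "shift (group_word c s) D \<in> A" if "D \<in> Orb \<union> Sep" "u = q @ s" for D q s
  proof -
    have "s = drop (length q) u" "length q \<le> length u" using that(2) by simp_all
    then show ?thesis unfolding A_def suf_def using that(1)
      by (intro image_eqI[of _ _ "(length q, D)"]) auto
  qed
  have BA: "D \<in> A" if "D \<in> Orb \<union> Sep" for D
  proof -
    have "D \<subseteq> carrier G" using that Orb_cuts Sep_cuts cuts_subset by blast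
    then show ?thesis using inA[OF that, of u "[]"] shift_one by simp
  qed
  have path: "word_map t s (e D) = e (shift (group_word c s) D)"
    if fo: "follows c A t e" and D: "D \<in> Orb \<union> Sep" and s: "u = q @ s" for t e D q s
  proof (rule follows_word[OF c A_cuts fo])
    show "D \<in> cuts" using D Orb_cuts Sep_cuts by blast
    show "shift (group_word c s') D \<in> A" if "s = q' @ s'" for q' s'
      by (rule inA[OF D, of "q @ q'"]) (simp add: s that)
  qed
  have orb: "orbit_cut w y i \<in> Orb" if "y \<in> K" "i \<le> N" for y i
    unfolding Orb_def using that by (intro image_eqI[of _ _ "(y, i)"]) auto
  have orb0: "orbit_cut w y 0 = cut_at y" if "y \<in> K" for y
    using that K(2) by (auto simp: orbit_cut_def)
  have orbS: "shift w (orbit_cut w y i) = orbit_cut w y (Suc i)" if "y \<in> K" for y i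
    using orbit_cut_Suc[OF wc] that K(2) by auto
  have it: "word_map t u (e (orbit_cut w y i)) = e (orbit_cut w y (Suc i))"
    if "follows c A t e" "y \<in> K" "i \<le> N" for t e y i
    using path[OF that(1), of "orbit_cut w y i" "[]" u] orb[OF that(2,3)] orbS[OF that(2)] w(1) by simp
  have orbSA: "orbit_cut w y (Suc i) \<in> A" if "y \<in> K" "i \<le> N" for y i
    using inA[of "orbit_cut w y i" "[]" u] orb[OF that] orbS[OF that(1)] w(1) by simp
  have itn: "(word_map t u ^^ i) (e (cut_at y)) = e (orbit_cut w y i)"
    if "follows c A t e" "y \<in> K" "i \<le> N" for t e y i
    using that(3) by (induction i) (simp_all add: orb0[OF that(2)] it[OF that(1,2)])
  \<comment> \<open>the top of \<open>A\<close> is a translate of a point of \<open>K\<close>, not of one of the separating cuts\<close>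
  let ?A' = "(\<lambda>(k, D). shift (suf k) D) ` ({..length u} \<times> Orb)"
  have A'A: "?A' \<subseteq> A" unfolding A_def by auto
  have "Orb \<noteq> {}" unfolding Orb_def using K(3) by auto
  then have "finite ?A'" "?A' \<noteq> {}" using finite_subset[OF A'A finA] by auto
  then obtain M where M: "M \<in> ?A'" "\<And>D. D \<in> ?A' \<Longrightarrow> M \<subseteq> D \<Longrightarrow> M = D"
    using finite_has_maximal[of ?A'] by metis
  have M': "D \<subseteq> M" if "D \<in> ?A'" for D
    using cuts_linear[of D M] M(2)[OF that] M(1) that A'A A_cuts by blast
  have top: "D \<subseteq> M" if D: "D \<in> A" for D
  proof -
    obtain k B where kB: "k \<le> length u" "B \<in> Orb \<union> Sep" "D = shift (suf k) B"
      using D unfolding A_def by auto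
    show ?thesis
    proof (cases "B \<in> Orb")
      case True
      then show ?thesis using kB by (intro M') auto
    next
      case False
      then obtain y where y: "y \<in> K" "B \<subseteq> cut_at y" using kB(2) Sep_le by blast
      have "cut_at y \<in> Orb" using orb[OF y(1), of 0] orb0[OF y(1)] by simp
      then have "shift (suf k) (cut_at y) \<subseteq> M" using kB(1) by (intro M') auto
      then show ?thesis using shift_subset[OF y(2)] kB(3) by blast
    qed
  qed
  obtain k x i where x: "k \<le> length u" "x \<in> K" "i \<le> N" "M = shift (suf k) (orbit_cut w x i)"
    using M(1) unfolding Orb_def by auto
  define s where "s = drop k u @ concat (replicate i u)"
  have xc: "x \<in> carrier G" using x(2) K(2) by blast
  have gs: "group_word c s = suf k \<otimes> w [^] i"
    unfolding s_def suf_def group_word_append[OF c] group_word_power[OF c] w(1) by (rule HOL.refl)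
  have Meq: "M = cut_at (group_word c s \<otimes> x)"
    unfolding x(4) gs orbit_cut_def using shift_cut_at[OF sufc] wc xc sufc m_assoc by simp
  have "captures c u w K A s x"
    unfolding captures_def
  proof (intro conjI ballI allI impI)
    show "finite A" "A \<subseteq> cuts" by (rule finA, rule A_cuts)
    show "cut_at ` K \<subseteq> A" using BA orb[of _ 0] orb0 by fastforce
    show "x \<in> K" by (rule x(2))
    show "set s \<subseteq> set u" unfolding s_def using set_drop_subset[of k u] by auto
    show "cut_at (group_word c s \<otimes> x) \<in> A" unfolding Meq[symmetric] by (rule subsetD[OF A'A M(1)])
    show "D \<subseteq> cut_at (group_word c s \<otimes> x)" if "D \<in> A" for D using top[OF that] Meq by simp
    show "cut_at (w \<otimes> y) \<in> A" if "y \<in> K" for y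
      using orbSA[OF that, of 0] that K(2) wc by (simp add: orbit_cut_def)
    show "word_map t s (e (cut_at x)) = e (cut_at (group_word c s \<otimes> x))" if fo: "follows c A t e" for t e
    proof -
      have "word_map t s (e (cut_at x)) = word_map t (drop k u) (e (orbit_cut w x i))"
        unfolding s_def word_map_append word_map_power itn[OF fo x(2,3)] by (rule HOL.refl)
      also have "\<dots> = e M"
        using path[OF fo, of "orbit_cut w x i" "take k u" "drop k u"] orb[OF x(2,3)] x(4) by (simp add: suf_def)
      finally show ?thesis using Meq by simp
    qed
    show "word_map t u (e (cut_at y)) = e (cut_at (w \<otimes> y))" if "follows c A t e" "y \<in> K" for t e y
      using it[OF that, of 0] orb0[OF that(2)] wc by (simp add: orbit_cut_def)
    fix t e y z j
    assume fo: "follows c A t e"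
      and te: "(\<forall>i. order_aut (t i)) \<and> (\<forall>D\<in>A. \<forall>D'\<in>A. D \<subset> D' \<longrightarrow> e D < e D')" and y: "y \<in> K" and z: "z \<in> K"
    note t = spec[OF conjunct1[OF te]] and e = conjunct2[OF te, rule_format]
    have sub: "insert (cut_at z) (Sep \<union> orbit_cut w y ` {..N}) \<subseteq> A"
      using BA orb[OF y] orb[OF z, of 0] orb0[OF z] by auto
    have h1: "\<forall>D\<in>insert (cut_at z) (Sep \<union> orbit_cut w y ` {..N}).
        \<forall>D'\<in>insert (cut_at z) (Sep \<union> orbit_cut w y ` {..N}). D \<subset> D' \<longrightarrow> e D < e D'"
      by (intro ballI impI e subsetD[OF sub])
    have h2: "\<forall>i<N. word_map t u (e (orbit_cut w y i)) = e (orbit_cut w y (Suc i))"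
      using it[OF fo y] by simp
    have h3: "\<forall>z\<in>Sep. word_map t u (e z) = e z"
      using path[OF fo, of _ "[]" u] Sep_fix w(1) by simp
    have f: "order_aut (word_map t u)" by (rule order_aut_word_map[OF t])
    note result = pin[OF y z, unfolded pins_def Let_def, THEN spec, THEN spec, THEN mp, OF f, THEN mp, OF h1, THEN mp, OF h2, THEN mp, OF h3, THEN spec]
    show "(word_map t u ^^ j) (e (cut_at y)) < e (cut_at z) \<longleftrightarrow> orbit_cut w y j \<subset> cut_at z"
      "e (cut_at z) < (word_map t u ^^ j) (e (cut_at y)) \<longleftrightarrow> cut_at z \<subset> orbit_cut w y j"
      by (rule conjunct1[OF result], rule conjunct2[OF result])
  qed
  then show thesis by (rule that)
qed

end

section \<open>Reaching group elements by generators\<close>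

context free_amalgam
begin

definition letters :: "('a + 'b) list set set" where
  "letters = G.group_letter c1 ` (UNIV \<times> {..<n}) \<union> G.group_letter c2 ` (UNIV \<times> {..<m})"

text \<open>
  The action follows the generators inside \<open>K\<close>, starting from the points assigned by \<open>v\<close>.
\<close>

definition traced :: "('a + 'b) list set set \<Rightarrow> (nat \<Rightarrow>\<^sub>0 real) set \<Rightarrow>
    (('a + 'b) list set \<Rightarrow> (nat \<Rightarrow>\<^sub>0 real) \<Rightarrow> (nat \<Rightarrow>\<^sub>0 real)) \<Rightarrow> (('a + 'b) list set \<Rightarrow> (nat \<Rightarrow>\<^sub>0 real)) \<Rightarrow> bool" where
  "traced K Z \<gamma> v \<longleftrightarrow> set_action G Z \<gamma> \<and> v ` K \<subseteq> Z \<and>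
     (\<forall>l\<in>letters. \<forall>k\<in>K. l \<otimes>\<^bsub>G\<^esub> k \<in> K \<longrightarrow> \<gamma> l (v k) = v (l \<otimes>\<^bsub>G\<^esub> k))"

text \<open>
  Stated by its consequence: steps by generators inside \<open>K\<close> lead from \<open>1\<close> to every element of
  \<open>K\<close>, so that an action which is right for these steps sends the point of \<open>1\<close> to the point of
  each \<open>k\<close>.
\<close>

definition generator_connected :: "('a + 'b) list set set \<Rightarrow> bool" where
  "generator_connected K \<longleftrightarrow> finite K \<and> K \<subseteq> carrier G \<and> \<one>\<^bsub>G\<^esub> \<in> K \<and>
     (\<forall>Z \<gamma> v. traced K Z \<gamma> v \<longrightarrow> (\<forall>k\<in>K. \<gamma> k (v \<one>\<^bsub>G\<^esub>) = v k))"

lemma traced_subset: "traced K' Z \<gamma> v \<Longrightarrow> K \<subseteq> K' \<Longrightarrow> traced K Z \<gamma> v"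
  unfolding traced_def by blast

lemma letters_carrier: "letters \<subseteq> carrier G"
  unfolding letters_def
  using G.group_letter_closed[of c1, OF c1_carrier] G.group_letter_closed[of c2, OF c2_carrier] by blast

lemma connected_one: "generator_connected {\<one>\<^bsub>G\<^esub>}"
proof -
  show ?thesis unfolding generator_connected_def traced_def using set_actionD(1) by auto
qed

lemma connected_insert:
  assumes K: "generator_connected K" and k: "k \<in> K" and l: "l \<in> letters"
  shows "generator_connected (insert (l \<otimes>\<^bsub>G\<^esub> k) K)"
proof -
  have lc: "l \<in> carrier G" and kc: "k \<in> carrier G" using l letters_carrier k K by (auto simp: generator_connected_def)
  have "\<gamma> j (v \<one>\<^bsub>G\<^esub>) = v j" if tr: "traced (insert (l \<otimes>\<^bsub>G\<^esub> k) K) Z \<gamma> v" and j: "j \<in> insert (l \<otimes>\<^bsub>G\<^esub> k) K" for Z \<gamma> v j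
  proof -
    have old: "\<gamma> j (v \<one>\<^bsub>G\<^esub>) = v j" if "j \<in> K" for j
      using K traced_subset[OF tr, of K] that unfolding generator_connected_def by blast
    have "v \<one>\<^bsub>G\<^esub> \<in> Z" using tr K unfolding traced_def generator_connected_def by blast
    then have "\<gamma> (l \<otimes>\<^bsub>G\<^esub> k) (v \<one>\<^bsub>G\<^esub>) = \<gamma> l (\<gamma> k (v \<one>\<^bsub>G\<^esub>))"
      using set_actionD(3)[OF _ lc kc] tr unfolding traced_def by blast
    also have "\<dots> = v (l \<otimes>\<^bsub>G\<^esub> k)" using tr l k old[OF k] unfolding traced_def by simp
    finally show ?thesis using j old by blast
  qed
  then show ?thesis using K lc kc unfolding generator_connected_def by auto
qed

lemma connected_union:
  assumes "generator_connected K" "generator_connected K'" shows "generator_connected (K \<union> K')"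
proof -
  have "\<gamma> k (v \<one>\<^bsub>G\<^esub>) = v k" if "traced (K \<union> K') Z \<gamma> v" "k \<in> K \<union> K'" for Z \<gamma> v k
    using assms traced_subset[OF that(1), of K] traced_subset[OF that(1), of K'] that(2)
    unfolding generator_connected_def by blast
  then show ?thesis using assms unfolding generator_connected_def by auto
qed

lemma ex_connected:
  assumes "g \<in> carrier G" shows "\<exists>K. generator_connected K \<and> g \<in> K"
proof -
  let ?P = "\<lambda>g. \<exists>K. generator_connected K \<and> g \<in> K"
  have step: "?P (l \<otimes>\<^bsub>G\<^esub> g)" if "?P g" "l \<in> letters" for l g
    using connected_insert that by blast
  have word: "?P (G.group_word c u \<otimes>\<^bsub>G\<^esub> g)"
    if c: "\<And>i. c i \<in> carrier G" and g: "g \<in> carrier G" "?P g" and u: "\<And>l. l \<in> set u \<Longrightarrow> G.group_letter c l \<in> letters" for c u g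
    using u
  proof (induction u)
    case Nil
    then show ?case using g by simp
  next
    case (Cons l u)
    have "G.group_word c (l # u) \<otimes>\<^bsub>G\<^esub> g = G.group_letter c l \<otimes>\<^bsub>G\<^esub> (G.group_word c u \<otimes>\<^bsub>G\<^esub> g)"
      using G.group_letter_closed[OF c] G.group_word_closed[OF c] g(1) by (simp add: G.m_assoc)
    then show ?case using step[OF Cons.IH Cons.prems[of l]] Cons.prems by simp
  qed
  show ?thesis
    using assms
  proof (induction rule: G_induct[consumes 1])
    case 1
    show ?case using connected_one by blast
  next
    case (2 x g)
    obtain u where u: "u \<in> free_words n" "ev1 u = x" using word_eval_surj[OF ev1 2(1)] .
    have "G.group_letter c1 l \<in> letters" if "l \<in> set u" for l
      unfolding letters_def using u(1) that by blast
    from word[of c1, OF c1_carrier 2(2,3) this] show ?case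
      using G.hom_word_eval[OF ev1 j1_hom u(1)] u(2) by simp
  next
    case (3 y g)
    obtain u where u: "u \<in> free_words m" "ev2 u = y" using word_eval_surj[OF ev2 3(1)] .
    have "G.group_letter c2 l \<in> letters" if "l \<in> set u" for l
      unfolding letters_def using u(1) that by blast
    from word[of c2, OF c2_carrier 3(2,3) this] show ?case
      using G.hom_word_eval[OF ev2 j2_hom u(1)] u(2) by simp
  qed
qed

lemma ex_connected_superset:
  assumes "finite P" "P \<subseteq> carrier G" shows "\<exists>K. generator_connected K \<and> P \<subseteq> K"
  using assms
proof (induction P)
  case empty
  show ?case using connected_one by blast
next
  case (insert g P)
  then obtain K K' where "generator_connected K" "P \<subseteq> K" "generator_connected K'" "g \<in> K'"
    using ex_connected[of g] by auto
  then show ?case using connected_union[of K K'] by blast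
qed

end

section \<open>Perturbing a left order\<close>

context left_ordered_group
begin

text \<open>
  Any strictly increasing map of the finitely many cuts to the positive reals would serve.
\<close>

definition rank :: "'g set set \<Rightarrow> 'g set \<Rightarrow> real" where
  "rank A D = real (card {B \<in> A. B \<subset> D}) + 1"

lemma rank_mono: "finite A \<Longrightarrow> D \<in> A \<Longrightarrow> D \<subset> D' \<Longrightarrow> rank A D < rank A D'"
  unfolding rank_def by (auto intro!: psubset_card_mono)

lemma rank_bounds: "finite A \<Longrightarrow> 0 < rank A D \<and> rank A D \<le> real (card A) + 1"
  unfolding rank_def by (auto intro!: card_mono)

definition translation_rel :: "('g set \<Rightarrow> real) \<Rightarrow> 'g set set \<Rightarrow> 'g \<Rightarrow> (real \<times> real) set" where
  "translation_rel e A g = {(e D, e (shift g D)) | D. D \<in> A \<and> shift g D \<in> A}"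

lemma translation_rel_props:
  assumes A: "finite A" "A \<subseteq> cuts" and g: "g \<in> carrier G"
    and e: "\<And>D D'. D \<in> A \<Longrightarrow> D' \<in> A \<Longrightarrow> D \<subset> D' \<Longrightarrow> e D < e D'"
  shows "finite (translation_rel e A g)" "mono_rel (translation_rel e A g)"
proof -
  have "translation_rel e A g \<subseteq> (\<lambda>D. (e D, e (shift g D))) ` A" by (auto simp: translation_rel_def)
  then show "finite (translation_rel e A g)" using A(1) finite_surj by blast
  have eD: "e D < e D' \<longleftrightarrow> D \<subset> D'" if "D \<in> A" "D' \<in> A" for D D'
    by (rule strict_mono_on_cuts[OF e A(2) that])
  show "mono_rel (translation_rel e A g)"
    unfolding mono_rel_def
  proof (clarify)
    fix x y x' y' assume "(x, y) \<in> translation_rel e A g" "(x', y') \<in> translation_rel e A g"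
    then obtain D D' where D: "D \<in> A" "shift g D \<in> A" "x = e D" "y = e (shift g D)"
      and D': "D' \<in> A" "shift g D' \<in> A" "x' = e D'" "y' = e (shift g D')"
      unfolding translation_rel_def by blast
    have "shift g D \<subset> shift g D' \<longleftrightarrow> D \<subset> D'"
      using D(1) D'(1) A(2) cuts_subset by (intro shift_psubset_iff[OF g]) auto
    then show "x < x' \<longleftrightarrow> y < y'" unfolding D(3,4) D'(3,4) eD[OF D(1) D'(1)] eD[OF D(2) D'(2)] by simp
  qed
qed

end

context free_amalgam
begin

text \<open>
  Two actions on the line are chosen, one for each factor, that follow the translations on
  finitely many cuts; these cuts force the orbits of \<open>w\<close> through points of \<open>K\<close> to interleave
  as they do under \<open>r\<close>, hence equally in both. So \<open>realization\<close> applies and, as \<open>K\<close> is reached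
  by generators, the base point is sent to the point of \<open>k\<close> by every \<open>k\<close> in \<open>K\<close>; in particular
  the elements of \<open>P\<close> move it up. For the first factor the maps are subject to one more
  condition. The largest cut \<open>M\<close> of its data is moved up by each of the first two generators
  or its inverse, so no translate by that letter is in the data, and the value of the letter
  at \<open>M\<close> is free. Sending \<open>M\<close> to the same new point in both cases makes two different elements
  of the amalgam agree at the base point.
\<close>

lemma perturbation:
  assumes red: "reduced u1" "u1 \<noteq> []" "reduced u2" "u2 \<noteq> []" and n: "2 \<le> n"
    and r: "r \<in> left_orders G" and P: "finite P" "P \<subseteq> positive_elements G r"
  obtains Z :: "(nat \<Rightarrow>\<^sub>0 real) set" and \<gamma> v g where "set_action G Z \<gamma>" "v \<in> Z"
    "\<And>p. p \<in> P \<Longrightarrow> v < \<gamma> p v" "g \<in> carrier G" "g \<noteq> \<one>\<^bsub>G\<^esub>" "\<gamma> g v = v"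
proof -
  have Lo: "left_ordered_group G r" by (intro left_ordered_group.intro left_ordered_group_axioms.intro G.plain_group_axioms r)
  interpret L: left_ordered_group G r by (rule Lo)
  note nontriv = amalgam_nontrivial[OF red n]
  have PG: "P \<subseteq> carrier G" using P(2) by (auto simp: positive_elements_def)
  obtain K where K: "generator_connected K" "P \<subseteq> K" using ex_connected_superset[OF P(1) PG] by blast
  have Kf: "finite K" "K \<subseteq> carrier G" "\<one>\<^bsub>G\<^esub> \<in> K" using K(1) by (auto simp: generator_connected_def)
  have Kne: "K \<noteq> {}" using Kf(3) by blast
  let ?w = "j1 a"
  have w1: "G.group_word c1 u1 = ?w" using G.hom_word_eval[OF ev1 j1_hom u1(1)] u1(2) by simp
  have w2: "G.group_word c2 u2 = ?w" using G.hom_word_eval[OF ev2 j2_hom u2(1)] u2(2) nontriv(1) by simp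
  have wc: "?w \<in> carrier G" by (rule j1_carrier[OF a])
  obtain A1 s x where cap1: "L.captures c1 u1 ?w K A1 s x"
    by (rule L.orbit_data[OF c1_carrier w1 nontriv(2) Kf(1,2) Kne])
  obtain A2 s2 x2 where cap2: "L.captures c2 u2 ?w K A2 s2 x2"
    by (rule L.orbit_data[OF c2_carrier w2 nontriv(2) Kf(1,2) Kne])
  note A1 = L.capturesD[OF cap1] and A2 = L.capturesD[OF cap2]
  let ?A = "A1 \<union> A2"
  define e where "e = L.rank ?A"
  have finA: "finite ?A" using A1(1) A2(1) by simp
  have Ac: "?A \<subseteq> L.cuts" using A1(2) A2(2) by simp
  have e_mono: "e D < e D'" if "D \<in> ?A" "D \<subset> D'" for D D'
    unfolding e_def by (rule L.rank_mono[OF finA that])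
  define top where "top = real (card ?A) + 2"
  have e_bd: "0 < e D" "e D < top" for D
    using L.rank_bounds[OF finA, of D] unfolding e_def top_def by auto
  have top: "0 < top" unfolding top_def by simp
  let ?T = "top + 1"
  have e_less: "e D < e D' \<longleftrightarrow> D \<subset> D'" if "D \<in> ?A" "D' \<in> ?A" for D D'
    by (rule L.strict_mono_on_cuts[OF e_mono Ac that])
  have e_eq: "e D = e D' \<longleftrightarrow> D = D'" if "D \<in> ?A" "D' \<in> ?A" for D D'
    using e_less[OF that] e_less[OF that(2,1)] L.cuts_linear[of D D'] that Ac by (metis less_irrefl psubsetI subsetD)
  \<comment> \<open>the largest cut of the data for the first factor, and for each generator the letter
    that does not move it down; the new value \<open>top\<close> at \<open>M\<close> is given to two letters only\<close>
  define mx where "mx = G.group_word c1 s \<otimes>\<^bsub>G\<^esub> x"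
  define M where "M = L.cut_at mx"
  have xc: "x \<in> carrier G" using A1(4) Kf(2) by blast
  have sc: "G.group_word c1 s \<in> carrier G" by (rule G.group_word_closed[OF c1_carrier])
  have mxc: "mx \<in> carrier G" unfolding mx_def using xc sc by simp
  have MA: "M \<in> A1" "\<And>D. D \<in> A1 \<Longrightarrow> D \<subseteq> M" unfolding M_def mx_def using A1(6,7) by auto
  have Mc: "M \<subseteq> carrier G" using MA(1) A1(2) L.cuts_subset by blast
  define up where "up i \<longleftrightarrow> M \<subset> L.shift (c1 i) M" for i
  define l where "l i = G.group_letter c1 (up i, i)" for i
  define R1 where "R1 i = oriented (up i)
    ((if i < 2 then {(e M, top)} else {}) \<union> L.translation_rel e A1 (l i))" for i
  have lc: "l i \<in> carrier G" for i unfolding l_def by (rule G.group_letter_closed[OF c1_carrier])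
  have move: "M \<subset> L.shift (l i) M" if i: "i < 2" for i
  proof (cases "up i")
    case False
    have ne: "c1 i \<noteq> \<one>\<^bsub>G\<^esub>" using i n nontriv(3,4) by (cases "i = 0") (auto simp: G.basis_image_def less_2_cases_iff)
    have "c1 i \<otimes>\<^bsub>G\<^esub> mx \<noteq> mx" using G.right_cancel[of mx "c1 i" "\<one>\<^bsub>G\<^esub>"] ne mxc c1_carrier by auto
    then have neq: "L.shift (c1 i) M \<noteq> M"
      unfolding M_def L.shift_cut_at[OF c1_carrier mxc] using L.cut_at_eq_iff mxc c1_carrier by simp
    have "L.shift (c1 i) M \<in> L.cuts" "M \<in> L.cuts"
      unfolding M_def L.shift_cut_at[OF c1_carrier mxc] by (rule L.cut_at_in_cuts)+
    then have "L.shift (c1 i) M \<subset> M" using L.cuts_linear neq False unfolding up_def by blast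
    then have "L.shift (inv\<^bsub>G\<^esub> (c1 i)) (L.shift (c1 i) M) \<subset> L.shift (inv\<^bsub>G\<^esub> (c1 i)) M"
      using L.shift_psubset_iff[OF G.inv_closed[OF c1_carrier] L.shift_carrier[OF c1_carrier Mc] Mc] by blast
    then show ?thesis using L.shift_inv(1)[OF c1_carrier Mc] False by (simp add: l_def)
  qed (simp add: l_def up_def)
  have base: "finite (L.translation_rel e A1 (l i))" "mono_rel (L.translation_rel e A1 (l i))" for i
    by (rule L.translation_rel_props[OF A1(1,2) lc], rule e_mono, blast, assumption)+
  have R1fin: "finite (R1 i)" for i unfolding R1_def oriented_simps using base(1) by simp
  have R1mono: "mono_rel (R1 i)" for i
  proof (cases "i < 2")
    case True
    have "(p < e M \<longleftrightarrow> q < top) \<and> (e M < p \<longleftrightarrow> top < q)" if pq: "(p, q) \<in> L.translation_rel e A1 (l i)" for p q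
    proof -
      obtain D where D: "D \<in> A1" "L.shift (l i) D \<in> A1" "p = e D" "q = e (L.shift (l i) D)"
        using pq unfolding L.translation_rel_def by blast
      \<comment> \<open>the translate of \<open>M\<close> is larger than all cuts in \<open>A1\<close>, so nothing is prescribed at
        \<open>M\<close>\<close>
      have "D \<noteq> M" using D(2) MA(2)[of "L.shift (l i) M"] move[OF True] by blast
      then have "D \<subset> M" using MA(2)[OF D(1)] by blast
      then have "p < e M" using e_mono[of D M] D by simp
      then show ?thesis using D(4) e_bd(2)[of "L.shift (l i) D"] by simp
    qed
    then show ?thesis unfolding R1_def oriented_simps using True mono_rel_insert[OF base(2)] by simp
  qed (use base(2) in \<open>simp add: R1_def oriented_simps\<close>)
  have tb: "L.translation_rel e B g \<subseteq> {0<..<?T} \<times> {0<..<?T}" for B g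
    unfolding L.translation_rel_def using e_bd less_trans[OF e_bd(2), of ?T] by auto
  have R1bd: "R1 i \<subseteq> {0<..<?T} \<times> {0<..<?T}" for i
    unfolding R1_def oriented_simps using tb e_bd[of M] top less_trans[OF e_bd(2), of ?T] by simp
  have T0: "0 < ?T" using top by simp
  obtain t1 where t1: "\<And>i. order_aut (t1 i)" "\<And>i. t1 i 0 = 0" "\<And>i. t1 i ?T = ?T" "\<And>i. t1 i (- ?T) = - ?T"
    "\<And>i x y. (x, y) \<in> R1 i \<Longrightarrow> t1 i x = y" "\<And>i x y. (x, y) \<in> R1 i \<Longrightarrow> t1 i (- x) = - y"
    by (rule extend_mono_rel_odd[of R1, OF R1fin R1mono R1bd T0]) (rule that)
  define R2 where "R2 i = L.translation_rel e A2 (c2 i)" for i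
  have R2p: "finite (R2 i)" "mono_rel (R2 i)" for i
    unfolding R2_def by (rule L.translation_rel_props[OF A2(1,2) c2_carrier], rule e_mono, blast, assumption)+
  have R2bd: "R2 i \<subseteq> {0<..<?T} \<times> {0<..<?T}" for i unfolding R2_def by (rule tb)
  obtain t2 where t2: "\<And>i. order_aut (t2 i)" "\<And>i. t2 i 0 = 0" "\<And>i. t2 i ?T = ?T" "\<And>i. t2 i (- ?T) = - ?T"
    "\<And>i x y. (x, y) \<in> R2 i \<Longrightarrow> t2 i x = y" "\<And>i x y. (x, y) \<in> R2 i \<Longrightarrow> t2 i (- x) = - y"
    by (rule extend_mono_rel_odd[of R2, OF R2p R2bd T0]) (rule that)
  have b1: "bij (t1 i)" and b2: "bij (t2 i)" for i using t1(1) t2(1) by (auto simp: order_aut_def)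
  have tr1: "(e D, e (L.shift (c1 i) D)) \<in> R1 i" if D: "D \<in> A1" "L.shift (c1 i) D \<in> A1" for i D
  proof (cases "up i")
    case True
    then show ?thesis unfolding R1_def L.translation_rel_def oriented_def using D by (auto simp: l_def)
  next
    case False
    have "L.shift (l i) (L.shift (c1 i) D) = D"
      using L.shift_inv(1)[OF c1_carrier] D(1) A1(2) L.cuts_subset False by (auto simp: l_def)
    then have "(e (L.shift (c1 i) D), e D) \<in> L.translation_rel e A1 (l i)"
      unfolding L.translation_rel_def using D by force
    then show ?thesis unfolding R1_def oriented_def using False by simp
  qed
  have tr2: "(e D, e (L.shift (c2 i) D)) \<in> R2 i" if "D \<in> A2" "L.shift (c2 i) D \<in> A2" for i D
    unfolding R2_def L.translation_rel_def using that by blast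
  have f1: "L.follows c1 A1 t1 e" "L.follows c1 A1 t1 (\<lambda>D. - e D)"
    unfolding L.follows_def using b1 t1(5)[OF tr1] t1(6)[OF tr1] by simp_all
  have f2: "L.follows c2 A2 t2 e" "L.follows c2 A2 t2 (\<lambda>D. - e D)"
    unfolding L.follows_def using b2 t2(5)[OF tr2] t2(6)[OF tr2] by simp_all
  let ?e = "\<lambda>k. e (L.cut_at k)"
  have e_T: "?e k \<in> {- ?T..?T}" for k using e_bd[of "L.cut_at k"] by simp
  have cA: "L.cut_at k \<in> ?A" if "k \<in> K" for k using that A1(3) by blast
  have w_one: "?e (?w \<otimes>\<^bsub>G\<^esub> \<one>\<^bsub>G\<^esub>) \<noteq> ?e \<one>\<^bsub>G\<^esub>"
    using e_eq[of "L.cut_at (?w \<otimes>\<^bsub>G\<^esub> \<one>\<^bsub>G\<^esub>)" "L.cut_at \<one>\<^bsub>G\<^esub>"] A1(9)[OF Kf(3)] cA[OF Kf(3)]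
      L.cut_at_eq_iff[of ?w "\<one>\<^bsub>G\<^esub>"] wc nontriv(2) by simp
  \<comment> \<open>\<open>w\<close> moves the point of \<open>1\<close> one way and its mirror image the other way\<close>
  have bw1: "both_ways ?T (word_map t1 u1)"
    by (rule both_ways_odd[OF e_T[of "\<one>\<^bsub>G\<^esub>"]])
      (use A1(10)[OF f1(1) Kf(3)] A1(10)[OF f1(2) Kf(3)] w_one in simp_all)
  have bw2: "both_ways ?T (word_map t2 u2)"
    by (rule both_ways_odd[OF e_T[of "\<one>\<^bsub>G\<^esub>"]])
      (use A2(10)[OF f2(1) Kf(3)] A2(10)[OF f2(2) Kf(3)] w_one in simp_all)
  have la: "line_action ?T t1" "line_action ?T t2"
    using t1(1-4) t2(1-4) T0 unfolding line_action_def by simp_all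
  have o1: "order_aut (word_map t1 u1)" and o2: "order_aut (word_map t2 u2)"
    using order_aut_word_map[of t1 u1] order_aut_word_map[of t2 u2] t1(1) t2(1) by auto
  let ?Y = "?e ` K"
  have em1: "e D < e D'" if "D \<in> A1" "D' \<in> A1" "D \<subset> D'" for D D' using e_mono that by simp
  have em2: "e D < e D'" if "D \<in> A2" "D' \<in> A2" "D \<subset> D'" for D D' using e_mono that by simp
  have match: "orbit_matching (word_map t1 u1) (word_map t2 u2) (Id_on ?Y)"
    unfolding orbit_matching_def
  proof (clarify)
    fix k :: int and y z assume y: "y \<in> K" and z: "z \<in> K"
    show "zpow (word_map t1 u1) k (?e y) < ?e z \<longleftrightarrow> zpow (word_map t2 u2) k (?e y) < ?e z"
    proof (cases "0 \<le> k")
      case True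
      then obtain i where k: "k = int i" by (metis nonneg_int_cases)
      show ?thesis unfolding k zpow_nat
        using A1(11)[OF f1(1) t1(1) em1 y z, of i] A2(11)[OF f2(1) t2(1) em2 y z, of i] by blast
    next
      case False
      \<comment> \<open>for negative exponents compare the forward orbit of the other point\<close>
      then obtain i where k: "k = - int i" by (metis int_cases2 linear of_nat_0_le_iff)
      have "zpow f k (?e y) < ?e z \<longleftrightarrow> ?e y < (f ^^ i) (?e z)" if "order_aut f" for f
        using zpow_shift[OF that, of 0 "?e y" "int i" "?e z"] by (simp add: k zpow_nat)
      then show ?thesis
        using A1(11)[OF f1(1) t1(1) em1 z y, of i] A2(11)[OF f2(1) t2(1) em2 z y, of i] o1 o2 by blast
    qed
  qed
  have Yf: "finite ?Y" "?Y \<subseteq> {- ?T..?T}" using Kf(1) e_T by auto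
  obtain Z :: "(nat \<Rightarrow>\<^sub>0 real) set" and \<gamma> where \<gamma>: "set_action G Z \<gamma>"
    "\<And>y. y \<in> ?Y \<Longrightarrow> single0 y \<in> Z"
    "\<And>y u. y \<in> ?Y \<Longrightarrow> u \<in> free_words n \<Longrightarrow> \<gamma> (j1 (ev1 u)) (single0 y) = single0 (word_map t1 u y)"
    "\<And>y u. y \<in> ?Y \<Longrightarrow> u \<in> free_words m \<Longrightarrow> word_map t2 u y \<in> ?Y \<Longrightarrow>
       \<gamma> (j2 (ev2 u)) (single0 y) = single0 (word_map t2 u y)"
    by (rule realization[OF la bw1 bw2 Yf subset_refl Yf(2) match]) (rule that)
  let ?v = "\<lambda>k. single0 (?e k)"
  have "traced K Z \<gamma> ?v"
    unfolding traced_def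
  proof (intro conjI ballI impI)
    show "set_action G Z \<gamma>" by (rule \<gamma>(1))
    show "?v ` K \<subseteq> Z" using \<gamma>(2) by blast
    fix g k assume g: "g \<in> letters" and k: "k \<in> K" and gk: "g \<otimes>\<^bsub>G\<^esub> k \<in> K"
    have kc: "k \<in> carrier G" using k Kf(2) by blast
    have kY: "?e k \<in> ?Y" "?e (g \<otimes>\<^bsub>G\<^esub> k) \<in> ?Y" using k gk by auto
    have step: "word_map t [q] (?e k) = ?e (g \<otimes>\<^bsub>G\<^esub> k)"
      if "\<And>i. c i \<in> carrier G" "C \<subseteq> L.cuts" "L.follows c C t e" "L.cut_at ` K \<subseteq> C" "g = G.group_letter c q" for c C t q
    proof -
      have "L.shift g (L.cut_at k) = L.cut_at (g \<otimes>\<^bsub>G\<^esub> k)"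
        by (rule L.shift_cut_at[OF _ kc]) (use g letters_carrier in blast)
      moreover have "L.cut_at k \<in> C" "L.cut_at (g \<otimes>\<^bsub>G\<^esub> k) \<in> C" using that(4) k gk by blast+
      ultimately show ?thesis using L.follows_letter[OF that(1-3), of "L.cut_at k" q] that(5) by simp
    qed
    consider q where "g = G.group_letter c1 q" "[q] \<in> free_words n" | q where "g = G.group_letter c2 q" "[q] \<in> free_words m"
      using g unfolding letters_def by auto
    then show "\<gamma> g (?v k) = ?v (g \<otimes>\<^bsub>G\<^esub> k)"
    proof cases
      case 1
      have "g = j1 (ev1 [q])" using G.hom_word_eval[OF ev1 j1_hom 1(2)] G.group_word_single[of c1, OF c1_carrier] 1(1) by simp
      then show ?thesis using \<gamma>(3)[OF kY(1) 1(2)] step[OF c1_carrier A1(2) f1(1) A1(3) 1(1)] by simp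
    next
      case 2
      have "g = j2 (ev2 [q])" using G.hom_word_eval[OF ev2 j2_hom 2(2)] G.group_word_single[of c2, OF c2_carrier] 2(1) by simp
      moreover have wm: "word_map t2 [q] (?e k) = ?e (g \<otimes>\<^bsub>G\<^esub> k)" by (rule step[OF c2_carrier A2(2) f2(1) A2(3) 2(1)])
      have "word_map t2 [q] (?e k) \<in> ?Y" unfolding wm by (rule kY(2))
      from \<gamma>(4)[OF kY(1) 2(2) this] have "\<gamma> (j2 (ev2 [q])) (?v k) = ?v (g \<otimes>\<^bsub>G\<^esub> k)" unfolding wm .
      ultimately show ?thesis by simp
    qed
  qed
  then have reach: "\<gamma> k (?v \<one>\<^bsub>G\<^esub>) = ?v k" if "k \<in> K" for k
    using K(1) that unfolding generator_connected_def by blast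
  have vZ: "?v \<one>\<^bsub>G\<^esub> \<in> Z" using \<gamma>(2) Kf(3) by blast
  have pos: "?v \<one>\<^bsub>G\<^esub> < \<gamma> p (?v \<one>\<^bsub>G\<^esub>)" if p: "p \<in> P" for p
  proof -
    have pK: "p \<in> K" using p K(2) by blast
    have "L.cut_at \<one>\<^bsub>G\<^esub> \<subset> L.cut_at p"
      using p P(2) L.cut_at_psubset_iff[of "\<one>\<^bsub>G\<^esub>" p] by (auto simp: positive_elements_def)
    then have "?e \<one>\<^bsub>G\<^esub> < ?e p" using e_mono[OF cA[OF Kf(3)]] by blast
    then show ?thesis unfolding reach[OF pK] single_less_iff .
  qed
  \<comment> \<open>both elements \<open>h 0\<close> and \<open>h 1\<close> send the point of \<open>x\<close> first to \<open>M\<close> and then to \<open>top\<close>\<close>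
  define h where "h i = j1 (ev1 ((up i, i) # s))" for i
  have sw: "(up i, i) # s \<in> free_words n" if "i < 2" for i
    using that n A1(5) u1(1) by (auto simp: lists_eq_set)
  have hc: "h i \<in> carrier G" if "i < 2" for i
    unfolding h_def by (rule j1_carrier[OF word_eval_in_carrier[OF ev1 sw[OF that]]])
  have hx: "\<gamma> (h i) (?v x) = single0 top" if i: "i < 2" for i
  proof -
    have "word_map t1 s (?e x) = e M" using A1(8)[OF f1(1)] unfolding M_def mx_def .
    moreover have "letter_map t1 (up i, i) (e M) = top"
    proof (cases "up i")
      case True
      then show ?thesis using t1(5)[of "e M" top i] i by (simp add: R1_def oriented_def)
    next
      case False
      then have "t1 i top = e M" using t1(5)[of top "e M" i] i by (simp add: R1_def oriented_def)
      then show ?thesis using False b1[of i] by (metis bij_is_inj inv_f_f letter_map.simps)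
    qed
    ultimately have "word_map t1 ((up i, i) # s) (?e x) = top" by simp
    then show ?thesis unfolding h_def using \<gamma>(3)[OF _ sw[OF i], of "?e x"] A1(4) by simp
  qed
  have hne: "h 0 \<noteq> h 1"
  proof
    assume "h 0 = h 1"
    then have "G.group_letter c1 (up 0, 0) \<otimes>\<^bsub>G\<^esub> G.group_word c1 s = G.group_letter c1 (up 1, 1) \<otimes>\<^bsub>G\<^esub> G.group_word c1 s"
      unfolding h_def using G.hom_word_eval[OF ev1 j1_hom sw[of 0]] G.hom_word_eval[OF ev1 j1_hom sw[of 1]] by simp
    moreover have gl: "G.group_letter c1 l \<in> carrier G" for l by (rule G.group_letter_closed[OF c1_carrier])
    ultimately have eq: "G.group_letter c1 (up 0, 0) = G.group_letter c1 (up 1, 1)"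
      using G.right_cancel[OF sc gl[of "(up 0, 0)"] gl[of "(up 1, 1)"]] by (simp only:)
    have c01: "c1 0 = gen1 0" "c1 1 = gen1 1" using n by (simp_all add: G.basis_image_def)
    have ne: "c1 0 \<noteq> c1 1" "c1 0 \<otimes>\<^bsub>G\<^esub> c1 1 \<noteq> \<one>\<^bsub>G\<^esub>" using nontriv(5,6) c01 by simp_all
    have c: "c1 0 \<in> carrier G" "c1 1 \<in> carrier G" by (rule c1_carrier)+
    \<comment> \<open>the letters may be inverted, hence the four cases\<close>
    consider "c1 0 = c1 1" | "c1 0 = inv\<^bsub>G\<^esub> (c1 1)" | "inv\<^bsub>G\<^esub> (c1 0) = c1 1" | "inv\<^bsub>G\<^esub> (c1 0) = inv\<^bsub>G\<^esub> (c1 1)"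
      using eq by (cases "up 0"; cases "up 1") auto
    then show False
    proof cases
      case 2
      then show False using ne(2) c(2) by (metis G.l_inv)
    next
      case 3
      then show False using ne(2) c(1) by (metis G.r_inv)
    next
      case 4
      then show False using ne(1) c by (metis G.inv_inv)
    qed (use ne(1) in blast)
  qed
  \<comment> \<open>precomposing with \<open>x\<close> turns this into a coincidence at the base point\<close>
  define k where "k i = h i \<otimes>\<^bsub>G\<^esub> x" for i
  have kc: "k 0 \<in> carrier G" "k 1 \<in> carrier G" unfolding k_def using hc xc by simp_all
  have kv: "\<gamma> (k i) (?v \<one>\<^bsub>G\<^esub>) = single0 top" if "i < 2" for i
    unfolding k_def using set_actionD(3)[OF \<gamma>(1) hc[OF that] xc vZ] reach[OF A1(4)] hx[OF that] by simp
  define g where "g = inv\<^bsub>G\<^esub> (k 0) \<otimes>\<^bsub>G\<^esub> k 1"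
  have gc: "g \<in> carrier G" unfolding g_def using kc by simp
  have "g \<noteq> \<one>\<^bsub>G\<^esub>"
  proof
    assume "g = \<one>\<^bsub>G\<^esub>"
    then have "k 0 = k 1" unfolding g_def using G.mult_inv_cancel(1)[OF kc] kc(1) by (metis G.r_one)
    then show False using hne G.right_cancel[OF xc hc[of 0] hc[of 1]] unfolding k_def by simp
  qed
  moreover have "\<gamma> g (?v \<one>\<^bsub>G\<^esub>) = ?v \<one>\<^bsub>G\<^esub>"
  proof -
    have ic: "inv\<^bsub>G\<^esub> (k 0) \<in> carrier G" using kc by simp
    have "\<gamma> g (?v \<one>\<^bsub>G\<^esub>) = \<gamma> (inv\<^bsub>G\<^esub> (k 0)) (\<gamma> (k 1) (?v \<one>\<^bsub>G\<^esub>))"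
      unfolding g_def by (rule set_actionD(3)[OF \<gamma>(1) ic kc(2) vZ])
    also have "\<dots> = \<gamma> (inv\<^bsub>G\<^esub> (k 0)) (\<gamma> (k 0) (?v \<one>\<^bsub>G\<^esub>))" using kv[of 0] kv[of 1] by simp
    also have "\<dots> = \<gamma> (inv\<^bsub>G\<^esub> (k 0) \<otimes>\<^bsub>G\<^esub> k 0) (?v \<one>\<^bsub>G\<^esub>)"
      by (rule set_actionD(3)[OF \<gamma>(1) ic kc(1) vZ, symmetric])
    also have "\<dots> = ?v \<one>\<^bsub>G\<^esub>" using set_actionD(1)[OF \<gamma>(1) vZ] kc by simp
    finally show ?thesis .
  qed
  ultimately show thesis using that[OF \<gamma>(1) vZ] pos gc by blast
qed

lemma no_isolated_order:
  assumes red: "reduced u1" "u1 \<noteq> []" "reduced u2" "u2 \<noteq> []" and n: "2 \<le> n"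
  shows "\<not> isolated_point (left_order_space G) r"
proof
  assume iso: "isolated_point (left_order_space G) r"
  then have r: "r \<in> left_orders G" by (simp add: isolated_point_def topspace_left_order_space)
  have "openin (left_order_space G) {r}" using iso by (simp add: isolated_point_def)
  then obtain P where P: "finite P" "P \<subseteq> positive_elements G r" "basic_nbhd G P \<subseteq> {r}"
    unfolding openin_left_order_space by blast
  obtain Z :: "(nat \<Rightarrow>\<^sub>0 real) set" and \<gamma> v g where act: "set_action G Z \<gamma>" "v \<in> Z"
    "\<And>p. p \<in> P \<Longrightarrow> v < \<gamma> p v" "g \<in> carrier G" "g \<noteq> \<one>\<^bsub>G\<^esub>" "\<gamma> g v = v"
    by (rule perturbation[OF red n r P(1,2)]) (rule that)
  have PG: "P \<subseteq> carrier G" using P(2) by (auto simp: positive_elements_def)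
  from G.two_orders[OF r act(1,2) PG act(3-6)] show False using P(3) by blast
qed

end

theorem corollary1p2:
  fixes F\<^sub>n :: "'a monoid" and F\<^sub>m :: "'b monoid" and n m :: nat and w\<^sub>1 :: 'a and w\<^sub>2 :: 'b
  assumes "n \<ge> 2" and "m \<ge> 1"
    and "free_group_of_rank F\<^sub>n n" and "free_group_of_rank F\<^sub>m m"
    and "w\<^sub>1 \<in> carrier F\<^sub>n" and "w\<^sub>1 \<noteq> \<one>\<^bsub>F\<^sub>n\<^esub>"
    and "w\<^sub>2 \<in> carrier F\<^sub>m" and "w\<^sub>2 \<noteq> \<one>\<^bsub>F\<^sub>m\<^esub>"
  shows "\<not> (\<exists>r. isolated_point (left_order_space (cyclic_amalgam F\<^sub>n w\<^sub>1 F\<^sub>m w\<^sub>2)) r)"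
proof -
  obtain ev1 where ev1: "word_eval F\<^sub>n n ev1" by (rule free_group_word_eval[OF assms(3)])
  obtain ev2 where ev2: "word_eval F\<^sub>m m ev2" by (rule free_group_word_eval[OF assms(4)])
  obtain u1 where U1: "u1 \<in> free_words n" "ev1 u1 = w\<^sub>1" "reduced u1" "u1 \<noteq> []"
    by (rule word_eval_reduced[OF ev1 assms(5,6)])
  obtain u2 where U2: "u2 \<in> free_words m" "ev2 u2 = w\<^sub>2" "reduced u2" "u2 \<noteq> []"
    by (rule word_eval_reduced[OF ev2 assms(7,8)])
  have "group F\<^sub>n" "group F\<^sub>m" using assms(3,4) by (simp_all add: free_group_of_rank_def)
  then interpret free_amalgam F\<^sub>n w\<^sub>1 F\<^sub>m w\<^sub>2 n m ev1 ev2 u1 u2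
    using assms(5,7) ev1 ev2 U1(1,2) U2(1,2) by (intro free_amalgam.intro amalgam.intro free_amalgam_axioms.intro)
  show ?thesis using no_isolated_order[OF U1(3,4) U2(3,4) assms(1)] by blast
qed

end
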